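(* Let $\Delta=(\Gamma,(X_a),(G(v)))$ be a local action diagram. Then the following are equivalent: (i) $\mathbf U(\Delta)$ is compactly generated, locally compact and has geometrically dense action on its associated tree; (ii) $\Delta$ is irreducible; $\Gamma$ is finite; and each of the groups $G(v)$ is compactly generated and subdegree-finite. Moreover, if (i) and (ii) hold, then $\mathbf U(\Delta)$ is Polish, acting on a countable tree, and all arc stabilisers of $\mathbf U(\Delta)$ are compact.
   Context: Graphs. A graph $\Gamma$ has a vertex set $V\Gamma$, an arc set $A\Gamma$, an origin map $o:A\Gamma\to V\Gamma$ and a reversal map $a\mapsto\overline a$ on $A\Gamma$ with $\overline{\overline a}=a$; $t(a):=o(\overline a)$. An arc with $o(a)=t(a)$ is a loop; for a loop both $\overline a=a$ and $\overline a\neq a$ are allowed. $o^{-1}(v)$ is the set of arcs with origin $v$. $\Gamma$ is finite if $V\Gamma\sqcup A\Gamma$ is finite. A tree is a nonempty connected graph without loops, multiple edges or cycles; subtrees are nonempty connected subgraphs; ends are equivalence classes of rays, two rays being equivalent if they share infinitely many vertices. "Countable" includes finite. Permutation groups carry the permutation topology (pointwise stabilisers of finite sets form a base of neighbourhoods of the identity), and $\mathrm{Aut}(T)\le\mathrm{Sym}(VT)$ the subspace topology. Local action diagrams. A local action diagram $\Delta=(\Gamma,(X_a),(G(v)))$ consists of a connected graph $\Gamma$; nonempty pairwise disjoint sets $X_a$ $(a\in A\Gamma)$; and for each $v\in V\Gamma$ a closed subgroup $G(v)\le\mathrm{Sym}(X_v)$, $X_v=\bigsqcup_{a\in o^{-1}(v)}X_a$,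 whose orbits are the sets $X_a$, $a\in o^{-1}(v)$. A permutation group is subdegree-finite if all orbits of its point stabilisers are finite. A topological group is compactly generated if it is generated as an abstract group by a compact subset. A scopo of $\Delta$ is a subset $O\subseteq A\Gamma$ such that: if $a\in O$ then $\overline a\notin O$ and $|X_a|=1$; and for all $v\in V\Gamma$, if $O$ contains an arc $a$ originating at $v$, then $O$ contains all arcs other than $\overline a$ terminating at $v$. $\Delta$ is irreducible if its only scopo is $\emptyset$. Universal group. A $\Delta$-tree is a tree $T$ with a surjective graph homomorphism $\pi:T\to\Gamma$ and a map $\mathcal L:AT\to\bigsqcup_{a\in A\Gamma}X_a$ such that for all $v\in VT$ and $a\in o^{-1}(\pi(v))$, $\mathcal L$ restricts to a bijection $\{b\in o^{-1}(v):\pi(b)=a\}\to X_a$ (such a tree exists). Let $\mathcal L_v:o^{-1}(v)\to X_{\pi(v)}$ be the resulting bijection. For $g\in\mathrm{Aut}(T)$ with $\pi\circ g=\pi$ let $\sigma_{\mathcal L,v}(g)=\mathcal L_{gv}\circ g\circ\mathcal L_v^{-1}\in\mathrm{Sym}(X_{\pi(v)})$. $\mathbf U(\Delta)$ is the group of all $g\in\mathrm{Aut}(T)$ with $\pi\circ g=\pi$ and $\sigma_{\mathcal L,v}(g)\in G(\pi(v))$ for all $v\in VT$, with the topology of $\mathrm{Aut}(T)$; its associated tree is $T$; the pair is independent of the choice of $\Delta$-tree up to isomorphism of trees. A group acting on a tree is geometrically dense if it preserves no proper subtree and fixes no end. *)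

theory Defs
  imports
    "HOL-Analysis.Abstract_Metric_Spaces"
    "HOL-Analysis.Function_Topology"
    "HOL-Algebra.Bij"
    "HOL-Algebra.Group_Action"
    "HOL-Algebra.Generated_Groups"
begin

section \<open>Permutation groups and the permutation topology\<close>

text \<open>
  The symmetric group on a set \<open>\<Omega>\<close> is the library's \<open>BijGroup \<Omega>\<close>, whose elements are the
  bijections of \<open>\<Omega>\<close> that are extensional (\<open>undefined\<close> outside \<open>\<Omega>\<close>).
\<close>

definition perm_group :: "'p set \<Rightarrow> ('p \<Rightarrow> 'p) set \<Rightarrow> ('p \<Rightarrow> 'p) monoid" where
  "perm_group \<Omega> H = (BijGroup \<Omega>)\<lparr>carrier := H\<rparr>"

definition pointwise_stabilizer :: "'p set \<Rightarrow> ('p \<Rightarrow> 'p) set \<Rightarrow> 'p set \<Rightarrow> ('p \<Rightarrow> 'p) set" where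
  "pointwise_stabilizer \<Omega> H F = {g \<in> H. \<forall>x\<in>F. g x = x}"

definition perm_open :: "'p set \<Rightarrow> ('p \<Rightarrow> 'p) set \<Rightarrow> bool" where
  "perm_open \<Omega> U \<longleftrightarrow> U \<subseteq> Bij \<Omega> \<and>
     (\<forall>g\<in>U. \<exists>F. finite F \<and> F \<subseteq> \<Omega> \<and>
        g <#\<^bsub>BijGroup \<Omega>\<^esub> pointwise_stabilizer \<Omega> (Bij \<Omega>) F \<subseteq> U)"

definition perm_topology :: "'p set \<Rightarrow> ('p \<Rightarrow> 'p) topology" where
  "perm_topology \<Omega> = topology (perm_open \<Omega>)"

lemma l_coset_pointwise_stabilizer:
  assumes g: "g \<in> Bij \<Omega>" and F: "F \<subseteq> \<Omega>"
  shows "g <#\<^bsub>BijGroup \<Omega>\<^esub> pointwise_stabilizer \<Omega> (Bij \<Omega>) F = {h \<in> Bij \<Omega>. \<forall>x\<in>F. h x = g x}"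
proof (intro Set.set_eqI iffI)
  fix h assume "h \<in> g <#\<^bsub>BijGroup \<Omega>\<^esub> pointwise_stabilizer \<Omega> (Bij \<Omega>) F"
  then obtain k where "k \<in> Bij \<Omega>" "\<forall>x\<in>F. k x = x" "h = compose \<Omega> g k"
    using g by (auto simp: l_coset_def pointwise_stabilizer_def BijGroup_def)
  then show "h \<in> {h \<in> Bij \<Omega>. \<forall>x\<in>F. h x = g x}"
    using g F by (auto simp: compose_Bij compose_eq subset_iff)
next
  fix h assume "h \<in> {h \<in> Bij \<Omega>. \<forall>x\<in>F. h x = g x}"
  then have h: "h \<in> Bij \<Omega>" and eq: "\<And>x. x \<in> F \<Longrightarrow> h x = g x" by auto
  define k where "k = compose \<Omega> (restrict (inv_into \<Omega> g) \<Omega>) h"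
  have k: "k \<in> Bij \<Omega>"
    using g h by (simp add: k_def compose_Bij restrict_inv_into_Bij)
  have surj: "g ` \<Omega> = \<Omega>" and inj: "inj_on g \<Omega>" and hm: "\<And>x. x \<in> \<Omega> \<Longrightarrow> h x \<in> \<Omega>"
    using g h by (auto simp: Bij_def bij_betw_def)
  have "k x = x" if "x \<in> F" for x
    using that F eq inj hm[of x] by (auto simp: k_def compose_eq inv_into_f_f subset_iff)
  moreover have "h = compose \<Omega> g k"
  proof
    fix x
    show "h x = compose \<Omega> g k x"
      using surj hm[of x] h
      by (cases "x \<in> \<Omega>") (auto simp: k_def compose_def f_inv_into_f Bij_def extensional_def)
  qed
  ultimately show "h \<in> g <#\<^bsub>BijGroup \<Omega>\<^esub> pointwise_stabilizer \<Omega> (Bij \<Omega>) F"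
    using g k by (auto simp: l_coset_def pointwise_stabilizer_def BijGroup_def)
qed

lemma perm_open_iff:
  "perm_open \<Omega> U \<longleftrightarrow> U \<subseteq> Bij \<Omega> \<and>
     (\<forall>g\<in>U. \<exists>F. finite F \<and> F \<subseteq> \<Omega> \<and> {h \<in> Bij \<Omega>. \<forall>x\<in>F. h x = g x} \<subseteq> U)"
proof -
  have "g <#\<^bsub>BijGroup \<Omega>\<^esub> pointwise_stabilizer \<Omega> (Bij \<Omega>) F = {h \<in> Bij \<Omega>. \<forall>x\<in>F. h x = g x}"
    if "U \<subseteq> Bij \<Omega>" "g \<in> U" "F \<subseteq> \<Omega>" for g F
    using that by (intro l_coset_pointwise_stabilizer) auto
  then show ?thesis unfolding perm_open_def by (auto cong: conj_cong)
qed

lemma istopology_perm_open: "istopology (perm_open \<Omega>)"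
  unfolding istopology_def
proof (intro conjI allI impI)
  fix S T assume S: "perm_open \<Omega> S" and T: "perm_open \<Omega> T"
  show "perm_open \<Omega> (S \<inter> T)"
    unfolding perm_open_iff
  proof (intro conjI ballI)
    show "S \<inter> T \<subseteq> Bij \<Omega>" using S by (auto simp: perm_open_iff)
    fix g assume g: "g \<in> S \<inter> T"
    obtain F where F: "finite F" "F \<subseteq> \<Omega>" "{h \<in> Bij \<Omega>. \<forall>x\<in>F. h x = g x} \<subseteq> S"
      using S g by (auto simp: perm_open_iff)
    obtain F' where F': "finite F'" "F' \<subseteq> \<Omega>" "{h \<in> Bij \<Omega>. \<forall>x\<in>F'. h x = g x} \<subseteq> T"
      using T g by (auto simp: perm_open_iff)
    have "{h \<in> Bij \<Omega>. \<forall>x\<in>F \<union> F'. h x = g x} \<subseteq> S \<inter> T" using F F' by blast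
    then show "\<exists>F. finite F \<and> F \<subseteq> \<Omega> \<and> {h \<in> Bij \<Omega>. \<forall>x\<in>F. h x = g x} \<subseteq> S \<inter> T"
      using F F' by (intro exI[of _ "F \<union> F'"]) auto
  qed
next
  fix \<K> assume K: "\<forall>S\<in>\<K>. perm_open \<Omega> S"
  show "perm_open \<Omega> (\<Union>\<K>)"
    unfolding perm_open_iff
  proof (intro conjI ballI)
    show "\<Union>\<K> \<subseteq> Bij \<Omega>" using K by (auto simp: perm_open_iff)
    fix g assume "g \<in> \<Union>\<K>"
    then obtain S where "S \<in> \<K>" "g \<in> S" by auto
    have "perm_open \<Omega> S" using K \<open>S \<in> \<K>\<close> by simp
    then obtain F where F: "finite F" "F \<subseteq> \<Omega>" "{h \<in> Bij \<Omega>. \<forall>x\<in>F. h x = g x} \<subseteq> S"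
      using \<open>g \<in> S\<close> by (auto simp: perm_open_iff)
    have "{h \<in> Bij \<Omega>. \<forall>x\<in>F. h x = g x} \<subseteq> \<Union>\<K>"
      by (rule subset_trans[OF F(3)]) (use \<open>S \<in> \<K>\<close> in auto)
    with F show "\<exists>F. finite F \<and> F \<subseteq> \<Omega> \<and> {h \<in> Bij \<Omega>. \<forall>x\<in>F. h x = g x} \<subseteq> \<Union>\<K>"
      by (intro exI[of _ F]) simp
  qed
qed

lemma openin_perm_topology: "openin (perm_topology \<Omega>) U \<longleftrightarrow> perm_open \<Omega> U"
  by (simp add: perm_topology_def topology_inverse' istopology_perm_open)

lemma topspace_perm_topology [simp]: "topspace (perm_topology \<Omega>) = Bij \<Omega>"
proof (rule antisym)
  show "topspace (perm_topology \<Omega>) \<subseteq> Bij \<Omega>"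
    using openin_topspace openin_perm_topology perm_open_def by metis
  have "perm_open \<Omega> (Bij \<Omega>)" unfolding perm_open_iff by auto
  then show "Bij \<Omega> \<subseteq> topspace (perm_topology \<Omega>)"
    by (simp add: openin_perm_topology openin_subset)
qed

definition subgroup_topology :: "'p set \<Rightarrow> ('p \<Rightarrow> 'p) set \<Rightarrow> ('p \<Rightarrow> 'p) topology" where
  "subgroup_topology \<Omega> H = subtopology (perm_topology \<Omega>) H"

definition compactly_generated :: "('g, 'm) monoid_scheme \<Rightarrow> 'g topology \<Rightarrow> bool" where
  "compactly_generated G X \<longleftrightarrow>
     (\<exists>K \<subseteq> carrier G. compactin X K \<and> generate G K = carrier G)"

definition subdegree_finite :: "'p set \<Rightarrow> ('p \<Rightarrow> 'p) set \<Rightarrow> bool" where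
  "subdegree_finite \<Omega> H \<longleftrightarrow>
     (\<forall>x\<in>\<Omega>. \<forall>B \<in> orbits (perm_group \<Omega> (stabilizer (perm_group \<Omega> H) (\<lambda>g. g) x)) \<Omega> (\<lambda>g. g).
        finite B)"

definition polish_space_on :: "'t topology \<Rightarrow> bool" where
  "polish_space_on X \<longleftrightarrow> completely_metrizable_space X \<and> separable_space X"


section \<open>Graphs and trees\<close>

record ('v, 'a) graph =
  verts :: "'v set"
  arcs :: "'a set"
  origin :: "'a \<Rightarrow> 'v"
  reversal :: "'a \<Rightarrow> 'a"

definition terminus :: "('v, 'a, 'm) graph_scheme \<Rightarrow> 'a \<Rightarrow> 'v" where
  "terminus \<Gamma> a = origin \<Gamma> (reversal \<Gamma> a)"

definition is_graph :: "('v, 'a, 'm) graph_scheme \<Rightarrow> bool" where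
  "is_graph \<Gamma> \<longleftrightarrow>
     (\<forall>a\<in>arcs \<Gamma>. origin \<Gamma> a \<in> verts \<Gamma> \<and> reversal \<Gamma> a \<in> arcs \<Gamma> \<and>
        reversal \<Gamma> (reversal \<Gamma> a) = a)"

definition arcs_from :: "('v, 'a, 'm) graph_scheme \<Rightarrow> 'v \<Rightarrow> 'a set" where
  "arcs_from \<Gamma> v = {a \<in> arcs \<Gamma>. origin \<Gamma> a = v}"

definition finite_graph :: "('v, 'a, 'm) graph_scheme \<Rightarrow> bool" where
  "finite_graph \<Gamma> \<longleftrightarrow> finite (verts \<Gamma>) \<and> finite (arcs \<Gamma>)"

definition countable_graph :: "('v, 'a, 'm) graph_scheme \<Rightarrow> bool" where
  "countable_graph \<Gamma> \<longleftrightarrow> countable (verts \<Gamma>) \<and> countable (arcs \<Gamma>)"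

primrec walk :: "('v, 'a, 'm) graph_scheme \<Rightarrow> 'v \<Rightarrow> 'a list \<Rightarrow> 'v \<Rightarrow> bool" where
  "walk \<Gamma> u [] v \<longleftrightarrow> u \<in> verts \<Gamma> \<and> u = v"
| "walk \<Gamma> u (a # p) v \<longleftrightarrow> a \<in> arcs \<Gamma> \<and> origin \<Gamma> a = u \<and> walk \<Gamma> (terminus \<Gamma> a) p v"

definition connected_graph :: "('v, 'a, 'm) graph_scheme \<Rightarrow> bool" where
  "connected_graph \<Gamma> \<longleftrightarrow> (\<forall>u\<in>verts \<Gamma>. \<forall>v\<in>verts \<Gamma>. \<exists>p. walk \<Gamma> u p v)"

definition loop_free :: "('v, 'a, 'm) graph_scheme \<Rightarrow> bool" where
  "loop_free \<Gamma> \<longleftrightarrow> (\<forall>a\<in>arcs \<Gamma>. origin \<Gamma> a \<noteq> terminus \<Gamma> a)"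

definition no_multiple_edges :: "('v, 'a, 'm) graph_scheme \<Rightarrow> bool" where
  "no_multiple_edges \<Gamma> \<longleftrightarrow>
     (\<forall>a\<in>arcs \<Gamma>. \<forall>b\<in>arcs \<Gamma>.
        origin \<Gamma> a = origin \<Gamma> b \<and> terminus \<Gamma> a = terminus \<Gamma> b \<longrightarrow> a = b)"

text \<open>
  Closed walks of length 1 and 2 through distinct vertices come from loops, multiple edges
  or a single edge traversed back and forth, so cycles are required to have length at least 3.
\<close>

definition cycle :: "('v, 'a, 'm) graph_scheme \<Rightarrow> 'a list \<Rightarrow> bool" where
  "cycle \<Gamma> p \<longleftrightarrow> 3 \<le> length p \<and> (\<exists>v. walk \<Gamma> v p v) \<and> distinct (map (origin \<Gamma>) p)"

definition tree :: "('v, 'a, 'm) graph_scheme \<Rightarrow> bool" where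
  "tree T \<longleftrightarrow> is_graph T \<and> verts T \<noteq> {} \<and> connected_graph T \<and> loop_free T \<and>
     no_multiple_edges T \<and> (\<nexists>p. cycle T p)"

definition subtree :: "('v, 'a, 'm) graph_scheme \<Rightarrow> 'v set \<Rightarrow> 'a set \<Rightarrow> bool" where
  "subtree T W B \<longleftrightarrow> W \<noteq> {} \<and> W \<subseteq> verts T \<and> B \<subseteq> arcs T \<and>
     is_graph (T\<lparr>verts := W, arcs := B\<rparr>) \<and> connected_graph (T\<lparr>verts := W, arcs := B\<rparr>)"

definition rays :: "('v, 'a, 'm) graph_scheme \<Rightarrow> (nat \<Rightarrow> 'v) set" where
  "rays T = {r. inj r \<and> range r \<subseteq> verts T \<and>
     (\<forall>n. \<exists>a\<in>arcs T. origin T a = r n \<and> terminus T a = r (Suc n))}"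

definition ray_equiv :: "('v, 'a, 'm) graph_scheme \<Rightarrow> ((nat \<Rightarrow> 'v) \<times> (nat \<Rightarrow> 'v)) set" where
  "ray_equiv T = {(r, s). r \<in> rays T \<and> s \<in> rays T \<and> infinite (range r \<inter> range s)}"

definition ends :: "('v, 'a, 'm) graph_scheme \<Rightarrow> (nat \<Rightarrow> 'v) set set" where
  "ends T = rays T // ray_equiv T"

definition graph_hom ::
  "('v, 'a, 'm) graph_scheme \<Rightarrow> ('w, 'b, 'n) graph_scheme \<Rightarrow> ('v \<Rightarrow> 'w) \<Rightarrow> ('a \<Rightarrow> 'b) \<Rightarrow> bool"
where
  "graph_hom \<Gamma> \<Gamma>' f h \<longleftrightarrow> f ` verts \<Gamma> \<subseteq> verts \<Gamma>' \<and> h ` arcs \<Gamma> \<subseteq> arcs \<Gamma>' \<and>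
     (\<forall>a\<in>arcs \<Gamma>. origin \<Gamma>' (h a) = f (origin \<Gamma> a) \<and> reversal \<Gamma>' (h a) = h (reversal \<Gamma> a))"

definition graph_aut ::
  "('v, 'a, 'm) graph_scheme \<Rightarrow> ('v \<Rightarrow> 'v) \<Rightarrow> ('a \<Rightarrow> 'a) \<Rightarrow> bool"
where
  "graph_aut \<Gamma> g h \<longleftrightarrow> g \<in> Bij (verts \<Gamma>) \<and> h \<in> Bij (arcs \<Gamma>) \<and> graph_hom \<Gamma> \<Gamma> g h"

text \<open>
  Following the convention \<open>Aut(T) \<le> Sym(VT)\<close>, an automorphism of a tree is a permutation
  of the vertices; its action on arcs is the arc part of the graph automorphism, which is
  unique as there are no multiple edges (lemma \<open>arc_map_eq\<close> below).
\<close>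

definition Aut :: "('v, 'a, 'm) graph_scheme \<Rightarrow> ('v \<Rightarrow> 'v) set" where
  "Aut T = {g. \<exists>h. graph_aut T g h}"

definition arc_map :: "('v, 'a, 'm) graph_scheme \<Rightarrow> ('v \<Rightarrow> 'v) \<Rightarrow> 'a \<Rightarrow> 'a" where
  "arc_map T g = (THE h. graph_aut T g h)"

lemma graph_aut_unique:
  assumes T: "is_graph T" "no_multiple_edges T" and h: "graph_aut T g h" and k: "graph_aut T g k"
  shows "h = k"
proof (rule extensionalityI)
  show "h \<in> extensional (arcs T)" "k \<in> extensional (arcs T)"
    using h k by (auto simp: graph_aut_def Bij_def)
  fix a assume a: "a \<in> arcs T"
  then have ra: "reversal T a \<in> arcs T" using T by (simp add: is_graph_def)
  have "origin T (h a) = origin T (k a)" "terminus T (h a) = terminus T (k a)"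
       "h a \<in> arcs T" "k a \<in> arcs T"
    using h k a ra unfolding graph_aut_def graph_hom_def terminus_def by auto
  then show "h a = k a" using T by (auto simp: no_multiple_edges_def)
qed

lemma arc_map_eq:
  assumes "tree T" "graph_aut T g h" shows "arc_map T g = h"
  unfolding arc_map_def using assms graph_aut_unique[of T g] by (auto simp: tree_def)

definition geometrically_dense :: "('v, 'a, 'm) graph_scheme \<Rightarrow> ('v \<Rightarrow> 'v) set \<Rightarrow> bool" where
  "geometrically_dense T H \<longleftrightarrow>
     (\<forall>W B. subtree T W B \<and> (\<forall>g\<in>H. g ` W = W \<and> arc_map T g ` B = B) \<longrightarrow>
        W = verts T \<and> B = arcs T) \<and>
     \<not> (\<exists>e\<in>ends T. \<forall>g\<in>H. (\<lambda>r. g \<circ> r) ` e = e)"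


section \<open>Local action diagrams\<close>

record ('v, 'a, 'x) local_action_diagram =
  lgraph :: "('v, 'a) graph"
  colours :: "'a \<Rightarrow> 'x set"
  lgroup :: "'v \<Rightarrow> ('x \<Rightarrow> 'x) set"

definition vcolours :: "('v, 'a, 'x) local_action_diagram \<Rightarrow> 'v \<Rightarrow> 'x set" where
  "vcolours \<Delta> v = (\<Union>a\<in>arcs_from (lgraph \<Delta>) v. colours \<Delta> a)"

definition is_local_action_diagram :: "('v, 'a, 'x) local_action_diagram \<Rightarrow> bool" where
  "is_local_action_diagram \<Delta> \<longleftrightarrow>
     is_graph (lgraph \<Delta>) \<and> connected_graph (lgraph \<Delta>) \<and>
     (\<forall>a\<in>arcs (lgraph \<Delta>). colours \<Delta> a \<noteq> {}) \<and>
     disjoint_family_on (colours \<Delta>) (arcs (lgraph \<Delta>)) \<and>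
     (\<forall>v\<in>verts (lgraph \<Delta>).
        subgroup (lgroup \<Delta> v) (BijGroup (vcolours \<Delta> v)) \<and>
        closedin (perm_topology (vcolours \<Delta> v)) (lgroup \<Delta> v) \<and>
        orbits (perm_group (vcolours \<Delta> v) (lgroup \<Delta> v)) (vcolours \<Delta> v) (\<lambda>g. g) =
          colours \<Delta> ` arcs_from (lgraph \<Delta>) v)"

definition scopo :: "('v, 'a, 'x) local_action_diagram \<Rightarrow> 'a set \<Rightarrow> bool" where
  "scopo \<Delta> S \<longleftrightarrow> S \<subseteq> arcs (lgraph \<Delta>) \<and>
     (\<forall>a\<in>S. reversal (lgraph \<Delta>) a \<notin> S \<and> card (colours \<Delta> a) = 1) \<and>
     (\<forall>v\<in>verts (lgraph \<Delta>). \<forall>a\<in>S. origin (lgraph \<Delta>) a = v \<longrightarrow>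
        {b \<in> arcs (lgraph \<Delta>). terminus (lgraph \<Delta>) b = v} - {reversal (lgraph \<Delta>) a} \<subseteq> S)"

definition irreducible_diagram :: "('v, 'a, 'x) local_action_diagram \<Rightarrow> bool" where
  "irreducible_diagram \<Delta> \<longleftrightarrow> (\<forall>S. scopo \<Delta> S \<longleftrightarrow> S = {})"

text \<open>
  A \<open>\<Delta>\<close>-tree is given by the tree \<open>T\<close>, the vertex part \<open>\<pi>V\<close> and the arc part \<open>\<pi>A\<close> of the
  homomorphism to the graph of \<open>\<Delta>\<close>, and the labelling \<open>L\<close> of the arcs.
\<close>

definition delta_tree ::
  "('v, 'a, 'x) local_action_diagram \<Rightarrow> ('w, 'b) graph \<Rightarrow> ('w \<Rightarrow> 'v) \<Rightarrow> ('b \<Rightarrow> 'a) \<Rightarrow> ('b \<Rightarrow> 'x)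
    \<Rightarrow> bool"
where
  "delta_tree \<Delta> T \<pi>V \<pi>A L \<longleftrightarrow>
     tree T \<and> graph_hom T (lgraph \<Delta>) \<pi>V \<pi>A \<and>
     \<pi>V ` verts T = verts (lgraph \<Delta>) \<and> \<pi>A ` arcs T = arcs (lgraph \<Delta>) \<and>
     L ` arcs T \<subseteq> (\<Union>a\<in>arcs (lgraph \<Delta>). colours \<Delta> a) \<and>
     (\<forall>v\<in>verts T. \<forall>a\<in>arcs_from (lgraph \<Delta>) (\<pi>V v).
        bij_betw L {b \<in> arcs_from T v. \<pi>A b = a} (colours \<Delta> a))"

definition local_action ::
  "('v, 'a, 'x) local_action_diagram \<Rightarrow> ('w, 'b) graph \<Rightarrow> ('w \<Rightarrow> 'v) \<Rightarrow> ('b \<Rightarrow> 'x) \<Rightarrow> 'w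
    \<Rightarrow> ('w \<Rightarrow> 'w) \<Rightarrow> 'x \<Rightarrow> 'x"
where
  "local_action \<Delta> T \<pi>V L v g =
     restrict (L \<circ> arc_map T g \<circ> inv_into (arcs_from T v) L) (vcolours \<Delta> (\<pi>V v))"

definition universal_group ::
  "('v, 'a, 'x) local_action_diagram \<Rightarrow> ('w, 'b) graph \<Rightarrow> ('w \<Rightarrow> 'v) \<Rightarrow> ('b \<Rightarrow> 'a) \<Rightarrow> ('b \<Rightarrow> 'x)
    \<Rightarrow> ('w \<Rightarrow> 'w) set"
where
  "universal_group \<Delta> T \<pi>V \<pi>A L =
     {g \<in> Aut T. (\<forall>v\<in>verts T. \<pi>V (g v) = \<pi>V v) \<and> (\<forall>a\<in>arcs T. \<pi>A (arc_map T g a) = \<pi>A a) \<and>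
        (\<forall>v\<in>verts T. local_action \<Delta> T \<pi>V L v g \<in> lgroup \<Delta> (\<pi>V v))}"

definition arc_stabilizer ::
  "('w, 'b) graph \<Rightarrow> ('w \<Rightarrow> 'w) set \<Rightarrow> 'b \<Rightarrow> ('w \<Rightarrow> 'w) set" where
  "arc_stabilizer T H a = {g \<in> H. arc_map T g a = a}"

end

theory Submission
  imports Defs
begin

text \<open>
  Call an arc \<open>a'\<close> of \<open>\<Gamma>\<close> a successor of \<open>a\<close> if \<open>a a'\<close> lifts to a path without backtracking in \<open>T\<close>.
  Scopos are exactly the predecessor-closed sets of arcs that contain no reverses and only arcs with
  one colour, and their lifts to \<open>T\<close> are the orientations towards a \<open>U\<close>-invariant subtree or end.
  In an irreducible diagram every arc therefore reaches every other one, so every half-tree contains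
  a translate of every other half-tree; this gives geometric density.

  If \<open>U\<close> is locally compact, the fixator of some finite set is compact; moving that set into both
  half-trees of an arc and using Tits' independence property makes the arc stabilisers compact,
  hence the local groups subdegree-finite. If \<open>U\<close> is generated by a compact set, the translates of
  finitely many paths form an invariant subtree, so \<open>\<Gamma>\<close> is finite; and replacing \<open>G(v)\<close> by a compactly
  generated subgroup containing point stabilisers cuts \<open>T\<close> into pieces, which for a large enough
  subgroup are preserved by \<open>U\<close>, so that the subgroup is all of \<open>G(v)\<close>. Conversely, permutations in the
  local groups extend to elements of \<open>U\<close>, which lifts their finiteness properties to \<open>U\<close>.
\<close>

section \<open>Reduced walks in trees\<close>

text \<open>Topology enters through finiteness: a compact set of permutations moves each point to
  finitely many places, and a closed set is compact as soon as every point has finitely many images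
  and preimages. Compact arc stabilisers therefore amount to finite orbits, which can be followed
  along paths of \<open>T\<close>. The obstacle in using local compactness is that it bounds only
  the orbits of the fixator of some finite set, which may be spread over the tree; half-trees make
  it possible to push that set to one side of any arc. The obstacle in passing compact generation
  from \<open>U\<close> to \<open>G(v)\<close> is that \<open>G(v)\<close> acts at a single vertex
  of \<open>T\<close>, while products of generators of \<open>U\<close> move that vertex.
  Subdegree-finiteness helps: point stabilisers of \<open>G(v)\<close> are then compact, so only
  finitely many further elements have to be found, and a compact generating set of \<open>U\<close>
  moves one chosen arc to finitely many arcs. Vertices of \<open>T\<close> may have infinitely many
  neighbours, and an arc of the quotient may equal its own reversal, in which case \<open>U\<close>
  inverts edges of \<open>T\<close>.\<close>

lemma walk_snoc:
  assumes "is_graph \<Gamma>"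
  shows "walk \<Gamma> u (p @ [b]) v \<longleftrightarrow> walk \<Gamma> u p (origin \<Gamma> b) \<and> b \<in> arcs \<Gamma> \<and> v = terminus \<Gamma> b"
  using assms by (induction p arbitrary: u) (auto simp: terminus_def is_graph_def)

locale arc_graph =
  fixes T :: "('v, 'a, 'm) graph_scheme"
  assumes is_graph: "is_graph T"
begin

abbreviation "V \<equiv> verts T"
abbreviation "E \<equiv> arcs T"
abbreviation "src \<equiv> origin T"
abbreviation "tgt \<equiv> terminus T"
abbreviation "rv \<equiv> reversal T"

lemma rv_arc [simp]: "b \<in> E \<Longrightarrow> rv b \<in> E"
  and rv_rv [simp]: "b \<in> E \<Longrightarrow> rv (rv b) = b"
  and src_vert [simp]: "b \<in> E \<Longrightarrow> src b \<in> V"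
  using is_graph by (auto simp: is_graph_def)

lemma src_rv [simp]: "src (rv b) = tgt b" by (simp add: terminus_def)
lemma tgt_rv [simp]: "b \<in> E \<Longrightarrow> tgt (rv b) = src b" by (simp add: terminus_def)
lemma tgt_vert [simp]: "b \<in> E \<Longrightarrow> tgt b \<in> V"
  using src_vert[of "rv b"] by simp

lemma rv_eq_iff: "a \<in> E \<Longrightarrow> b \<in> E \<Longrightarrow> rv a = b \<longleftrightarrow> a = rv b"
  by auto

lemma walk_verts: "walk T u p v \<Longrightarrow> u \<in> V \<and> v \<in> V"
  by (induction p arbitrary: u) auto

lemma walk_arcs: "walk T u p v \<Longrightarrow> set p \<subseteq> E"
  by (induction p arbitrary: u) auto

lemma walk_append:
  "walk T u (p @ q) v \<longleftrightarrow> (\<exists>w. walk T u p w \<and> walk T w q v)"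
proof (induction p arbitrary: u)
  case Nil
  show ?case by (auto dest: walk_verts)
qed auto

lemma walk_revwalk: "walk T u p v \<Longrightarrow> walk T v (map rv (rev p)) u"
proof (induction p arbitrary: u)
  case (Cons a p)
  then have "walk T v (map rv (rev p)) (tgt a)" "a \<in> E" "src a = u" by auto
  then show ?case by (auto simp: walk_append)
qed auto

lemma connected_closed:
  assumes "connected_graph T" "S \<subseteq> V" "S \<noteq> {}"
    and step: "\<And>b. b \<in> E \<Longrightarrow> src b \<in> S \<Longrightarrow> tgt b \<in> S"
  shows "S = V"
proof -
  obtain u where u: "u \<in> S" using assms by auto
  have "walk T u p v \<Longrightarrow> u \<in> S \<Longrightarrow> v \<in> S" for u p v
    by (induction p arbitrary: u) (auto intro: step)
  then show ?thesis using assms u unfolding connected_graph_def by blast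
qed

definition reduced :: "'a list \<Rightarrow> bool" where
  "reduced p \<longleftrightarrow> successively (\<lambda>a b. b \<noteq> rv a) p"

lemma reduced_Nil [simp]: "reduced []" and reduced_single [simp]: "reduced [a]"
  and reduced_Cons2 [simp]: "reduced (a # b # p) \<longleftrightarrow> b \<noteq> rv a \<and> reduced (b # p)"
  by (auto simp: reduced_def)

lemma reduced_Cons: "reduced (a # p) \<longleftrightarrow> (p = [] \<or> hd p \<noteq> rv a) \<and> reduced p"
  by (auto simp: reduced_def successively_Cons)

lemma reduced_append:
  "reduced (p @ q) \<longleftrightarrow> reduced p \<and> reduced q \<and> (p = [] \<or> q = [] \<or> hd q \<noteq> rv (last p))"
  by (auto simp: reduced_def successively_append_iff)

lemma reduced_revwalk: "set p \<subseteq> E \<Longrightarrow> reduced p \<Longrightarrow> reduced (map rv (rev p))"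
proof (induction p)
  case (Cons a p)
  then have "last (map rv (rev p)) = rv (hd p)" if "p \<noteq> []"
    using that by (simp add: last_map last_rev)
  moreover have "hd p \<in> E" if "p \<noteq> []" using that Cons.prems by (cases p) auto
  ultimately show ?case using Cons
    by (cases "p = []") (auto simp: reduced_append reduced_Cons rv_eq_iff hd_map)
qed auto

end

locale tree_graph =
  fixes T :: "('v, 'a, 'm) graph_scheme"
  assumes tree: "tree T"

sublocale tree_graph \<subseteq> arc_graph
  using tree by unfold_locales (simp add: tree_def)

context tree_graph
begin

lemma connected: "connected_graph T" and nonempty: "V \<noteq> {}"
  and loopless: "b \<in> E \<Longrightarrow> src b \<noteq> tgt b"
  and arc_unique: "a \<in> E \<Longrightarrow> b \<in> E \<Longrightarrow> src a = src b \<Longrightarrow> tgt a = tgt b \<Longrightarrow> a = b"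
  using tree by (auto simp: tree_def loop_free_def no_multiple_edges_def)

lemma rv_neq [simp]: "b \<in> E \<Longrightarrow> rv b \<noteq> b"
  by (metis loopless src_rv)

text \<open>A shortest nonempty reduced closed walk would be a cycle.\<close>

lemma reduced_closed_walk:
  "walk T u p u \<Longrightarrow> reduced p \<Longrightarrow> p = []"
proof (induction "length p" arbitrary: u p rule: less_induct)
  case less
  show ?case
  proof (rule ccontr)
    assume ne: "p \<noteq> []"
    have dist: "distinct (map src p)"
    proof (rule ccontr)
      assume "\<not> distinct (map src p)"
      \<comment> \<open>A repeated origin cuts out a shorter nonempty closed walk \<open>p3\<close>,
        still reduced because it is a contiguous part of \<open>p\<close>.\<close>
      then obtain xs ys zs y where d: "map src p = xs @ [y] @ ys @ [y] @ zs"
        using not_distinct_decomp by blast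
      then obtain p1 p2 where p: "p = p1 @ p2" "map src p1 = xs" "map src p2 = [y] @ ys @ [y] @ zs"
        by (auto simp: map_eq_append_conv)
      then obtain p3 p4 where p2: "p2 = p3 @ p4" "map src p3 = y # ys" "map src p4 = y # zs"
        by (metis append.assoc append_Cons append_Nil map_eq_append_conv)
      obtain w1 w2 where w: "walk T w1 p3 w2" "walk T w2 p4 u"
        using less.prems(1) p p2 by (auto simp: walk_append)
      have "w1 = y" using w p2 by (cases p3) auto
      moreover have "w2 = y" using w p2 by (cases p4) auto
      moreover have "length p3 < length p" "reduced p3" "p3 \<noteq> []"
        using p p2 less.prems(2) by (auto simp: reduced_append)
      ultimately show False using less.hyps w by blast
    qed
    have "length p < 3"
    proof (rule ccontr)
      assume "\<not> length p < 3"
      then have "cycle T p" using less.prems dist unfolding cycle_def by auto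
      then show False using tree by (auto simp: tree_def)
    qed
    \<comment> \<open>Lengths 1 and 2 are outside the definition of \<open>cycle\<close>: they would
      give a loop, or an arc parallel to the reversal of \<open>a\<close>.\<close>
    then consider a where "p = [a]" | a b where "p = [a, b]" using ne
      by (cases p; cases "tl p"; cases "tl (tl p)") auto
    then show False
    proof cases
      case 1 then show False using less.prems loopless[of a] by auto
    next
      case 2
      then have ab: "a \<in> E" "b \<in> E" "src b = tgt a" "tgt b = src a" "b \<noteq> rv a"
        using less.prems by auto
      then have "b = rv a" by (intro arc_unique) auto
      then show False using ab by simp
    qed
  qed
qed

text \<open>Where two reduced walks diverge, returning along one and leaving along the other creates
  no backtracking, so a nonempty reduced closed walk would arise.\<close>

lemma reduced_walk_unique:
  "walk T u p v \<Longrightarrow> reduced p \<Longrightarrow> walk T u q v \<Longrightarrow> reduced q \<Longrightarrow> p = q"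
proof (induction p arbitrary: u q)
  case Nil
  then show ?case using reduced_closed_walk by auto
next
  case (Cons a p)
  show ?case
  proof (cases q)
    case Nil
    then show ?thesis using Cons.prems reduced_closed_walk[of u "a # p"] by auto
  next
    case (Cons b q')
    show ?thesis
    proof (cases "a = b")
      case True
      then show ?thesis using Cons.IH[of "tgt a" q'] Cons.prems \<open>q = b # q'\<close>
        by (auto simp: reduced_Cons)
    next
      case False
      let ?r = "map rv (rev (a # p)) @ q"
      have "walk T v ?r v" using walk_revwalk[OF Cons.prems(1)] Cons.prems(3) walk_append by blast
      moreover have "reduced ?r"
        using reduced_revwalk[OF walk_arcs[OF Cons.prems(1)] Cons.prems(2)] Cons.prems False Cons
        by (subst reduced_append) (auto)
      ultimately have "?r = []" by (rule reduced_closed_walk)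
      then show ?thesis using Cons by simp
    qed
  qed
qed

lemma reduced_walk_exists:
  assumes "u \<in> V" "v \<in> V" shows "\<exists>p. walk T u p v \<and> reduced p"
proof -
  have "walk T u p v \<Longrightarrow> \<exists>q. walk T u q v \<and> reduced q" for u p
  proof (induction p arbitrary: u)
    case Nil then show ?case by (intro exI[of _ "[]"]) auto
  next
    case (Cons a p)
    then obtain q where q: "walk T (tgt a) q v" "reduced q" by auto
    show ?case
    proof (cases "q \<noteq> [] \<and> hd q = rv a")
      case True
      then obtain q' where "q = rv a # q'" by (cases q) auto
      then show ?thesis using q Cons.prems by (intro exI[of _ q']) (auto simp: reduced_Cons)
    next
      case False
      then show ?thesis using q Cons.prems by (intro exI[of _ "a # q"]) (auto simp: reduced_Cons)
    qed
  qed
  then show ?thesis using connected assms unfolding connected_graph_def by blast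
qed

definition tpath :: "'v \<Rightarrow> 'v \<Rightarrow> 'a list" where
  "tpath u v = (THE p. walk T u p v \<and> reduced p)"

lemma tpath_eq: "walk T u p v \<Longrightarrow> reduced p \<Longrightarrow> tpath u v = p"
  unfolding tpath_def using reduced_walk_unique by blast

lemma walk_tpath: "u \<in> V \<Longrightarrow> v \<in> V \<Longrightarrow> walk T u (tpath u v) v"
  and reduced_tpath: "u \<in> V \<Longrightarrow> v \<in> V \<Longrightarrow> reduced (tpath u v)"
  using reduced_walk_exists tpath_eq by metis+

lemma tpath_self [simp]: "u \<in> V \<Longrightarrow> tpath u u = []"
  by (rule tpath_eq) auto

lemma tpath_arc [simp]: "b \<in> E \<Longrightarrow> tpath (src b) (tgt b) = [b]"
  by (rule tpath_eq) auto

text \<open>Seen from \<open>x\<close>, each arc points either away from \<open>x\<close> or back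
  towards it. This dichotomy takes the place of a distance function.\<close>

lemma tpath_step:
  assumes "x \<in> V" "b \<in> E"
  obtains "tpath x (tgt b) = tpath x (src b) @ [b]"
  | "tpath x (src b) = tpath x (tgt b) @ [rv b]"
proof -
  let ?p = "tpath x (src b)"
  have p: "walk T x ?p (src b)" "reduced ?p" using assms walk_tpath reduced_tpath by auto
  show thesis
  proof (cases "?p \<noteq> [] \<and> last ?p = rv b")
    case True
    then obtain q where q: "?p = q @ [rv b]" by (metis append_butlast_last_id)
    then have "walk T x q (tgt b)" "reduced q" using p by (auto simp: walk_snoc[OF is_graph] reduced_append)
    then have "tpath x (tgt b) = q" by (rule tpath_eq)
    then show thesis using q that by simp
  next
    case False
    then have "reduced (?p @ [b])" using p assms walk_arcs[OF p(1)]
      by (auto simp: reduced_append rv_eq_iff)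
         (metis assms(2) last_in_set rv_rv subsetD)
    moreover have "walk T x (?p @ [b]) (tgt b)" using p assms by (simp add: walk_snoc[OF is_graph])
    ultimately show thesis using that tpath_eq by blast
  qed
qed

subsection \<open>Half-trees\<close>

text \<open>The component of \<open>tgt b\<close> after removal of the edge of \<open>b\<close>. The
  description by paths lets membership be read off from the first arc of a path.\<close>

definition half :: "'a \<Rightarrow> 'v set" where
  "half b = {x \<in> V. tpath (src b) x = b # tpath (tgt b) x}"

lemma half_verts: "x \<in> half b \<Longrightarrow> x \<in> V" by (simp add: half_def)

lemma tgt_in_half [simp]: "b \<in> E \<Longrightarrow> tgt b \<in> half b"
  and src_notin_half [simp]: "b \<in> E \<Longrightarrow> src b \<notin> half b"
  by (auto simp: half_def)

lemma half_iff: "b \<in> E \<Longrightarrow> x \<in> half b \<longleftrightarrow> x \<in> V \<and> (\<exists>p. tpath (src b) x = b # p)"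
proof (safe)
  fix p assume b: "b \<in> E" "x \<in> V" and p: "tpath (src b) x = b # p"
  then have "walk T (src b) (b # p) x" "reduced (b # p)" using walk_tpath reduced_tpath by (metis src_vert)+
  then have "tpath (tgt b) x = p" by (intro tpath_eq) (auto simp: reduced_Cons)
  then show "x \<in> half b" using b p by (auto simp: half_def)
qed (auto simp: half_def)

text \<open>If the path from \<open>tgt b\<close> to \<open>x\<close> does not start with
  \<open>rv b\<close>, then prefixing \<open>b\<close> keeps it reduced and yields the path from
  \<open>src b\<close>. The two half-trees of an edge are thus complementary.\<close>

lemma half_rv:
  assumes "b \<in> E" "x \<in> V" shows "x \<in> half (rv b) \<longleftrightarrow> x \<notin> half b"
proof
  assume "x \<in> half (rv b)"
  then show "x \<notin> half b" using assms by (auto simp: half_def)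
next
  assume n: "x \<notin> half b"
  let ?p = "tpath (tgt b) x"
  have p: "walk T (tgt b) ?p x" "reduced ?p" using assms walk_tpath reduced_tpath by auto
  show "x \<in> half (rv b)"
  proof (cases "?p \<noteq> [] \<and> hd ?p = rv b")
    case True
    then obtain q where q: "?p = rv b # q" by (cases ?p) auto
    then show ?thesis using assms by (auto simp: half_iff)
  next
    case False
    then have "walk T (src b) (b # ?p) x" "reduced (b # ?p)" using p assms by (auto simp: reduced_Cons)
    then have "tpath (src b) x = b # ?p" by (rule tpath_eq)
    then show ?thesis using n assms by (auto simp: half_def)
  qed
qed

lemma half_succ:
  assumes "b \<in> E" "c \<in> E" "src c = tgt b" "c \<noteq> rv b" shows "half c \<subseteq> half b"
proof
  fix x assume x: "x \<in> half c"
  then have "x \<notin> half (rv b)" using assms by (auto simp: half_def)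
  then show "x \<in> half b" using half_rv assms half_verts[OF x] by blast
qed

lemma half_leave:
  assumes "b \<in> E" "d \<in> E" "src d \<in> half b" "tgt d \<notin> half b" shows "d = rv b"
proof -
  have V: "src b \<in> V" using assms by auto
  from assms(3) have s: "tpath (src b) (src d) = b # tpath (tgt b) (src d)" by (simp add: half_def)
  from V assms(2) show ?thesis
  proof (cases rule: tpath_step)
    case 1
    then show ?thesis using s assms by (auto simp: half_iff)
  next
    case 2
    then show ?thesis using s assms half_iff[of b "tgt d"]
      by (cases "tpath (src b) (tgt d)") (auto simp: rv_eq_iff)
  qed
qed

section \<open>Recursion, induction and coverings on trees\<close>

lemma tree_recursion:
  assumes "x \<in> V"
  obtains f :: "'v \<Rightarrow> 's" where "f x = s"
    "\<And>b. b \<in> E \<Longrightarrow> tpath x (tgt b) = tpath x (src b) @ [b] \<Longrightarrow> f (tgt b) = F b (f (src b))"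
proof -
  \<comment> \<open>Reduced paths from \<open>x\<close> are unique, so folding \<open>F\<close>
    along them replaces a well-founded recursion.\<close>
  define f where "f y = foldl (\<lambda>s b. F b s) s (tpath x y)" for y
  show thesis by (rule that[of f]) (use assms in \<open>auto simp: f_def\<close>)
qed

lemma tree_induct [consumes 2, case_names root step]:
  assumes "x \<in> V" "y \<in> V" and root: "P x"
    and step: "\<And>b. b \<in> E \<Longrightarrow> tpath x (tgt b) = tpath x (src b) @ [b] \<Longrightarrow> P (src b) \<Longrightarrow> P (tgt b)"
  shows "P y"
  using assms(2)
proof (induction "length (tpath x y)" arbitrary: y rule: less_induct)
  case less
  have w: "walk T x (tpath x y) y" "reduced (tpath x y)"
    using less.prems assms(1) walk_tpath reduced_tpath by auto
  show ?case
  proof (cases "tpath x y" rule: rev_cases)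
    case Nil
    then show ?thesis using w root by simp
  next
    case (snoc p b)
    then have b: "b \<in> E" "walk T x p (src b)" "y = tgt b" "reduced p"
      using w by (auto simp: walk_snoc[OF is_graph] reduced_append)
    then have "tpath x (src b) = p" by (intro tpath_eq)
    then show ?thesis using step[of b] less.hyps[of "src b"] b snoc by simp
  qed
qed

text \<open>Injectivity on stars sends reduced walks to reduced walks; two vertices with the same
  image would give a reduced closed walk, which must be empty. Surjectivity on stars lifts arcs one
  at a time, and connectedness does the rest. Automorphisms can therefore be built from local data
  without exhibiting an inverse.\<close>

lemma covering_bij:
  assumes hom: "\<And>x. x \<in> V \<Longrightarrow> g x \<in> V"
    "\<And>b. b \<in> E \<Longrightarrow> h b \<in> E \<and> src (h b) = g (src b) \<and> h (rv b) = rv (h b)"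
    and star: "\<And>x. x \<in> V \<Longrightarrow> bij_betw h (arcs_from T x) (arcs_from T (g x))"
  shows "bij_betw g V V"
proof -
  have tg: "b \<in> E \<Longrightarrow> tgt (h b) = g (tgt b)" for b
    using hom(2)[of b] hom(2)[of "rv b"] by (metis rv_arc src_rv)
  have w: "walk T u p v \<Longrightarrow> walk T (g u) (map h p) (g v)" for u p v
    by (induction p arbitrary: u) (auto simp: hom tg)
  have r: "reduced p \<Longrightarrow> walk T u p v \<Longrightarrow> reduced (map h p)" for p u v
  proof (induction p arbitrary: u)
    case (Cons a p)
    then have IH: "reduced (map h p)" by (auto simp: reduced_Cons)
    show ?case
    proof (cases p)
      case (Cons b q)
      have ab: "a \<in> E" "b \<in> E" "src b = tgt a" "b \<noteq> rv a" using Cons.prems Cons by auto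
      have "inj_on h (arcs_from T (tgt a))" using star ab by (auto simp: bij_betw_def)
      moreover have "b \<in> arcs_from T (tgt a)" "rv a \<in> arcs_from T (tgt a)"
        using ab by (auto simp: arcs_from_def)
      ultimately have "h b \<noteq> h (rv a)" using ab by (auto dest: inj_onD)
      then show ?thesis using Cons IH hom(2) ab by auto
    qed auto
  qed auto
  have "inj_on g V"
  proof (rule inj_onI)
    fix x y assume xy: "x \<in> V" "y \<in> V" "g x = g y"
    have "map h (tpath x y) = []"
      using xy w[OF walk_tpath[of x y]] r[OF reduced_tpath[of x y] walk_tpath[of x y]]
      by (intro reduced_closed_walk[of "g x"]) auto
    then have "tpath x y = []" by simp
    then show "x = y" using walk_tpath[of x y] xy by simp
  qed
  moreover have "g ` V = V"
  proof (rule connected_closed)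
    fix c assume c: "c \<in> E" "src c \<in> g ` V"
    then obtain x where x: "x \<in> V" "src c = g x" by auto
    then have "c \<in> h ` arcs_from T x" using star c by (auto simp: bij_betw_def arcs_from_def)
    then obtain b where "b \<in> E" "c = h b" by (auto simp: arcs_from_def)
    then show "tgt c \<in> g ` V" using tg by auto
  qed (use hom nonempty connected in auto)
  ultimately show ?thesis by (simp add: bij_betw_def)
qed

end

section \<open>Permutation groups\<close>

locale perm_subgroup =
  fixes \<Omega> :: "'p set" and H :: "('p \<Rightarrow> 'p) set"
  assumes subgroup: "subgroup H (BijGroup \<Omega>)"
begin

text \<open>Restricted to \<open>\<Omega>\<close> because elements of
  \<open>BijGroup \<Omega>\<close> are extensional, so that this is the inverse in the
  group.\<close>

definition pinv :: "('p \<Rightarrow> 'p) \<Rightarrow> 'p \<Rightarrow> 'p" where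
  "pinv g = restrict (inv_into \<Omega> g) \<Omega>"

lemma subset_Bij: "H \<subseteq> Bij \<Omega>"
  using subgroup by (auto simp: subgroup_def BijGroup_def)

lemma id_mem [simp]: "(\<lambda>x\<in>\<Omega>. x) \<in> H"
  using subgroup.one_closed[OF subgroup] by (simp add: BijGroup_def)

lemma compose_mem [simp]: "g \<in> H \<Longrightarrow> h \<in> H \<Longrightarrow> compose \<Omega> g h \<in> H"
  using subgroup.m_closed[OF subgroup, of g h] subset_Bij by (auto simp: BijGroup_def subset_iff)

lemma pinv_mem [simp]: "g \<in> H \<Longrightarrow> pinv g \<in> H"
  using subgroup.m_inv_closed[OF subgroup, of g] subset_Bij
  by (auto simp: inv_BijGroup pinv_def subset_iff)

lemma bij: "g \<in> H \<Longrightarrow> bij_betw g \<Omega> \<Omega>"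
  using subset_Bij by (auto simp: Bij_def)

lemma app_mem [simp]: "g \<in> H \<Longrightarrow> x \<in> \<Omega> \<Longrightarrow> g x \<in> \<Omega>"
  using bij by (auto simp: bij_betw_def)

lemma app_eq_iff [simp]: "g \<in> H \<Longrightarrow> x \<in> \<Omega> \<Longrightarrow> y \<in> \<Omega> \<Longrightarrow> g x = g y \<longleftrightarrow> x = y"
  using bij by (auto simp: bij_betw_def inj_on_def)

lemma pinv_app [simp]: "g \<in> H \<Longrightarrow> x \<in> \<Omega> \<Longrightarrow> pinv g (g x) = x"
  and app_pinv [simp]: "g \<in> H \<Longrightarrow> x \<in> \<Omega> \<Longrightarrow> g (pinv g x) = x"
  using bij[of g] by (auto simp: pinv_def bij_betw_inv_into_left bij_betw_inv_into_right bij_betw_apply)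

lemma pinv_eq_iff: "g \<in> H \<Longrightarrow> x \<in> \<Omega> \<Longrightarrow> y \<in> \<Omega> \<Longrightarrow> pinv g x = y \<longleftrightarrow> x = g y"
  by auto

lemma ext: "g \<in> H \<Longrightarrow> h \<in> H \<Longrightarrow> (\<And>x. x \<in> \<Omega> \<Longrightarrow> g x = h x) \<Longrightarrow> g = h"
  using subset_Bij by (intro extensionalityI[of _ \<Omega>]) (auto simp: Bij_def)

lemma group_perm_group: "group (perm_group \<Omega> H)"
  unfolding perm_group_def by (rule subgroup.subgroup_is_group[OF subgroup group_BijGroup])

lemma inv_perm_group: "g \<in> H \<Longrightarrow> inv\<^bsub>perm_group \<Omega> H\<^esub> g = pinv g"
  unfolding perm_group_def pinv_def
  using group.m_inv_consistent[OF group_BijGroup subgroup] subset_Bij by (auto simp: inv_BijGroup)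

lemma one_perm_group: "\<one>\<^bsub>perm_group \<Omega> H\<^esub> = (\<lambda>x\<in>\<Omega>. x)"
  by (simp add: perm_group_def BijGroup_def)

lemma mult_perm_group: "g \<in> H \<Longrightarrow> h \<in> H \<Longrightarrow> g \<otimes>\<^bsub>perm_group \<Omega> H\<^esub> h = compose \<Omega> g h"
  using subset_Bij by (auto simp: perm_group_def BijGroup_def)

lemma carrier_perm_group [simp]: "carrier (perm_group \<Omega> H) = H"
  by (simp add: perm_group_def)

lemma subgroup_generate:
  assumes "K \<subseteq> H" shows "perm_subgroup \<Omega> (generate (perm_group \<Omega> H) K)"
proof (rule perm_subgroup.intro)
  have "K \<subseteq> carrier (BijGroup \<Omega>)" using assms subset_Bij by (auto simp: BijGroup_def)
  then show "subgroup (generate (perm_group \<Omega> H) K) (BijGroup \<Omega>)"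
    unfolding perm_group_def
    using group.generate_consistent[OF group_BijGroup assms subgroup]
      group.generate_is_subgroup[OF group_BijGroup] by simp
qed

lemma generate_subset: "K \<subseteq> H \<Longrightarrow> generate (perm_group \<Omega> H) K \<subseteq> H"
  using group.generate_incl[OF group_perm_group] by simp

lemma generate_perm_induct [consumes 2, case_names one incl inv mult]:
  assumes "f \<in> generate (perm_group \<Omega> H) K" "K \<subseteq> H"
    and "P (\<lambda>x\<in>\<Omega>. x)" "\<And>k. k \<in> K \<Longrightarrow> P k" "\<And>k. k \<in> K \<Longrightarrow> P (pinv k)"
    and "\<And>g h. g \<in> H \<Longrightarrow> h \<in> H \<Longrightarrow> P g \<Longrightarrow> P h \<Longrightarrow> P (compose \<Omega> g h)"
  shows "P f"
proof -
  from assms(1) have "f \<in> H \<and> P f"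
  proof (induction rule: generate.induct)
    case one
    show ?case unfolding one_perm_group using assms(3) id_mem by blast
  next
    case (inv h)
    then show ?case using assms by (auto simp: inv_perm_group subset_iff)
  qed (use assms in \<open>auto simp: one_perm_group mult_perm_group\<close>)
  then show ?thesis ..
qed

end

lemma subdegree_finite_iff:
  "subdegree_finite \<Omega> H \<longleftrightarrow> (\<forall>x\<in>\<Omega>. \<forall>y\<in>\<Omega>. finite {g y | g. g \<in> H \<and> g x = x})"
  unfolding subdegree_finite_def orbits_def orbit_def stabilizer_def perm_group_def by auto

section \<open>The permutation topology\<close>

lemma openin_product_discrete:
  "openin (product_topology (\<lambda>_. discrete_topology A) I) S \<longleftrightarrow> S \<subseteq> I \<rightarrow>\<^sub>E A \<and>
    (\<forall>f\<in>S. \<exists>J. finite J \<and> J \<subseteq> I \<and> {h \<in> I \<rightarrow>\<^sub>E A. \<forall>j\<in>J. h j = f j} \<subseteq> S)"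
  (is "?L \<longleftrightarrow> ?R")
proof
  assume L: ?L
  then have sub: "S \<subseteq> I \<rightarrow>\<^sub>E A" using openin_subset by fastforce
  have ex: "\<exists>J. finite J \<and> J \<subseteq> I \<and> {h \<in> I \<rightarrow>\<^sub>E A. \<forall>j\<in>J. h j = f j} \<subseteq> S" if f: "f \<in> S" for f
  proof -
    obtain W where W: "finite {i \<in> I. W i \<noteq> A}" "f \<in> Pi\<^sub>E I W" "Pi\<^sub>E I W \<subseteq> S"
      using bspec[OF L[unfolded openin_product_topology_alt] f] by auto
    have "{h \<in> I \<rightarrow>\<^sub>E A. \<forall>j\<in>{i \<in> I. W i \<noteq> A}. h j = f j} \<subseteq> Pi\<^sub>E I W"
    proof
      fix h assume h: "h \<in> {h \<in> I \<rightarrow>\<^sub>E A. \<forall>j\<in>{i \<in> I. W i \<noteq> A}. h j = f j}"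
      have "h i \<in> W i" if "i \<in> I" for i
        using h that PiE_mem[OF W(2) that] by (cases "W i = A") auto
      then show "h \<in> Pi\<^sub>E I W" using h by (auto simp: PiE_iff)
    qed
    then have "{h \<in> I \<rightarrow>\<^sub>E A. \<forall>j\<in>{i \<in> I. W i \<noteq> A}. h j = f j} \<subseteq> S"
      using W(3) by (rule subset_trans)
    then show ?thesis using W(1) by (intro exI[of _ "{i \<in> I. W i \<noteq> A}"] conjI) simp_all
  qed
  show ?R by (intro conjI ballI ex sub)
next
  assume R: ?R
  show ?L unfolding openin_product_topology_alt
  proof
    fix f assume f: "f \<in> S"
    then obtain J where J: "finite J" "J \<subseteq> I" "{h \<in> I \<rightarrow>\<^sub>E A. \<forall>j\<in>J. h j = f j} \<subseteq> S" using bspec[OF conjunct2[OF R] f] by blast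
    have fA: "f \<in> I \<rightarrow>\<^sub>E A" using f conjunct1[OF R] by blast
    define W where "W i = (if i \<in> J then {f i} else A)" for i
    have "{i \<in> I. W i \<noteq> A} \<subseteq> J" by (auto simp: W_def)
    then have "finite {i \<in> I. W i \<noteq> A}" using J finite_subset by blast
    moreover have "f \<in> Pi\<^sub>E I W" "\<forall>i\<in>I. W i \<subseteq> A"
      using fA by (auto simp: W_def PiE_iff)
    moreover have "Pi\<^sub>E I W \<subseteq> S" using J(2) \<open>\<forall>i\<in>I. W i \<subseteq> A\<close>
      by (intro subset_trans[OF _ J(3)]) (auto simp: W_def PiE_iff subset_iff split: if_splits)
    ultimately show "\<exists>W. finite {i \<in> I. W i \<noteq> topspace (discrete_topology A)} \<and>
        (\<forall>i\<in>I. openin (discrete_topology A) (W i)) \<and> f \<in> Pi\<^sub>E I W \<and> Pi\<^sub>E I W \<subseteq> S"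
      by (intro exI[of _ W]) simp
  qed
qed

lemma closedin_perm_topology:
  "closedin (perm_topology \<Omega>) H \<longleftrightarrow> H \<subseteq> Bij \<Omega> \<and>
    (\<forall>g\<in>Bij \<Omega>. (\<forall>F. finite F \<and> F \<subseteq> \<Omega> \<longrightarrow> (\<exists>h\<in>H. \<forall>x\<in>F. h x = g x)) \<longrightarrow> g \<in> H)"
proof (cases "H \<subseteq> Bij \<Omega>")
  case True
  have eq: "(\<exists>F. finite F \<and> F \<subseteq> \<Omega> \<and> {h \<in> Bij \<Omega>. \<forall>x\<in>F. h x = g x} \<subseteq> Bij \<Omega> - H) \<longleftrightarrow>
     \<not> (\<forall>F. finite F \<and> F \<subseteq> \<Omega> \<longrightarrow> (\<exists>h\<in>H. \<forall>x\<in>F. h x = g x))" for g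
    using True by blast
  have swap: "(\<forall>g\<in>B - H. \<not> Q g) \<longleftrightarrow> (\<forall>g\<in>B. Q g \<longrightarrow> g \<in> H)" for B Q by blast
  have "closedin (perm_topology \<Omega>) H \<longleftrightarrow> (\<forall>g\<in>Bij \<Omega> - H. \<exists>F. finite F \<and> F \<subseteq> \<Omega> \<and>
      {h \<in> Bij \<Omega>. \<forall>x\<in>F. h x = g x} \<subseteq> Bij \<Omega> - H)"
    using True by (simp only: closedin_def openin_perm_topology perm_open_iff topspace_perm_topology Diff_subset simp_thms)
  then show ?thesis unfolding eq swap using True by simp
qed (auto simp: closedin_def)

lemma continuous_map_perm_eval:
  assumes "x \<in> \<Omega>"
  shows "continuous_map (perm_topology \<Omega>) (discrete_topology \<Omega>) (\<lambda>g. g x)"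
  unfolding continuous_map_def
proof (intro conjI allI impI)
  show "(\<lambda>g. g x) \<in> topspace (perm_topology \<Omega>) \<rightarrow> topspace (discrete_topology \<Omega>)"
    using assms by (auto simp: Bij_def bij_betw_def)
  fix U
  show "openin (perm_topology \<Omega>) {g \<in> topspace (perm_topology \<Omega>). g x \<in> U}"
    unfolding openin_perm_topology perm_open_iff
    using assms by (auto intro!: exI[of _ "{x}"])
qed

lemma continuous_map_perm_eval_inv:
  assumes "x \<in> \<Omega>"
  shows "continuous_map (perm_topology \<Omega>) (discrete_topology \<Omega>) (\<lambda>g. inv_into \<Omega> g x)"
  unfolding continuous_map_def
proof (intro conjI allI impI)
  show "(\<lambda>g. inv_into \<Omega> g x) \<in> topspace (perm_topology \<Omega>) \<rightarrow> topspace (discrete_topology \<Omega>)"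
    using assms by (auto simp: Bij_inv_into_mem)
  fix U
  have "\<exists>F. finite F \<and> F \<subseteq> \<Omega> \<and> {h \<in> Bij \<Omega>. \<forall>y\<in>F. h y = g y} \<subseteq> {g \<in> Bij \<Omega>. inv_into \<Omega> g x \<in> U}"
    if g: "g \<in> Bij \<Omega>" "inv_into \<Omega> g x \<in> U" for g
  proof (intro exI[of _ "{inv_into \<Omega> g x}"] conjI subsetI)
    fix h assume h: "h \<in> {h \<in> Bij \<Omega>. \<forall>y\<in>{inv_into \<Omega> g x}. h y = g y}"
    then have "h (inv_into \<Omega> g x) = x" using g assms
      by (auto simp: Bij_def bij_betw_inv_into_right)
    moreover have "inv_into \<Omega> g x \<in> \<Omega>" using g assms Bij_inv_into_mem by metis
    ultimately have "inv_into \<Omega> h x = inv_into \<Omega> g x"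
      using h by (auto simp: Bij_def bij_betw_def intro: inv_into_f_eq)
    then show "h \<in> {g \<in> Bij \<Omega>. inv_into \<Omega> g x \<in> U}" using h g by auto
  qed (use g assms Bij_inv_into_mem in \<open>auto\<close>)
  then show "openin (perm_topology \<Omega>) {g \<in> topspace (perm_topology \<Omega>). inv_into \<Omega> g x \<in> U}"
    unfolding openin_perm_topology perm_open_iff by auto
qed

text \<open>Evaluating a permutation or its inverse at a point is a continuous map to a discrete
  space, where compact sets are finite.\<close>

lemma compactin_perm_finite:
  assumes "compactin (perm_topology \<Omega>) K" "x \<in> \<Omega>"
  shows "finite ((\<lambda>k. k x) ` K)" "finite ((\<lambda>k. inv_into \<Omega> k x) ` K)"
  using image_compactin[OF assms(1) continuous_map_perm_eval[OF assms(2)]]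
    image_compactin[OF assms(1) continuous_map_perm_eval_inv[OF assms(2)]]
  by (auto simp: compactin_discrete_topology)

text \<open>
  Recording a permutation together with its inverse embeds the symmetric group as a closed
  subspace of a power of a discrete space; the permutation alone would not give a closed image.
\<close>

definition perm_graph :: "'p set \<Rightarrow> ('p \<Rightarrow> 'p) \<Rightarrow> 'p \<times> bool \<Rightarrow> 'p" where
  "perm_graph \<Omega> g = (\<lambda>(x, b)\<in>\<Omega> \<times> UNIV. if b then g x else inv_into \<Omega> g x)"

definition perm_graphs :: "'p set \<Rightarrow> ('p \<times> bool \<Rightarrow> 'p) set" where
  "perm_graphs \<Omega> = {f \<in> \<Omega> \<times> UNIV \<rightarrow>\<^sub>E \<Omega>. \<forall>x\<in>\<Omega>. f (f (x, True), False) = x \<and> f (f (x, False), True) = x}"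

abbreviation perm_graph_space :: "'p set \<Rightarrow> ('p \<times> bool \<Rightarrow> 'p) topology" where
  "perm_graph_space \<Omega> \<equiv> product_topology (\<lambda>_. discrete_topology \<Omega>) (\<Omega> \<times> UNIV)"

lemma closedin_perm_graphs: "closedin (perm_graph_space \<Omega>) (perm_graphs \<Omega>)"
proof -
  let ?X = "\<Omega> \<times> UNIV \<rightarrow>\<^sub>E \<Omega>"
  have "\<exists>J. finite J \<and> J \<subseteq> \<Omega> \<times> UNIV \<and> {h \<in> ?X. \<forall>j\<in>J. h j = f j} \<subseteq> ?X - perm_graphs \<Omega>"
    if f: "f \<in> ?X - perm_graphs \<Omega>" for f
  proof -
    obtain x where x: "x \<in> \<Omega>" "f (f (x, True), False) \<noteq> x \<or> f (f (x, False), True) \<noteq> x"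
      using f by (auto simp: perm_graphs_def)
    \<comment> \<open>The failure of the two inverse relations at \<open>x\<close> involves these
      four coordinates of \<open>f\<close>, so it persists for every function agreeing with
      \<open>f\<close> there.\<close>
    let ?J = "{(x, True), (f (x, True), False), (x, False), (f (x, False), True)}"
    have "{h \<in> ?X. \<forall>j\<in>?J. h j = f j} \<subseteq> ?X - perm_graphs \<Omega>"
      using x by (auto simp: perm_graphs_def)
    moreover have "?J \<subseteq> \<Omega> \<times> UNIV" using x f by auto
    ultimately show ?thesis by (intro exI[of _ ?J]) auto
  qed
  then have "openin (perm_graph_space \<Omega>) (?X - perm_graphs \<Omega>)"
    unfolding openin_product_discrete by blast
  then show ?thesis by (auto simp: closedin_def perm_graphs_def)
qed

lemma homeomorphic_maps_perm_graph:
  "homeomorphic_maps (perm_topology \<Omega>) (subtopology (perm_graph_space \<Omega>) (perm_graphs \<Omega>))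
     (perm_graph \<Omega>) (\<lambda>f. \<lambda>x\<in>\<Omega>. f (x, True))"
  unfolding homeomorphic_maps_def
proof (intro conjI ballI)
  have mem: "perm_graph \<Omega> g \<in> perm_graphs \<Omega>" if "g \<in> Bij \<Omega>" for g
    using that Bij_inv_into_mem[OF that]
    by (auto simp: perm_graph_def perm_graphs_def Bij_def bij_betw_inv_into_left
        bij_betw_inv_into_right bij_betw_apply PiE_iff)
  show "continuous_map (perm_topology \<Omega>) (subtopology (perm_graph_space \<Omega>) (perm_graphs \<Omega>)) (perm_graph \<Omega>)"
    unfolding continuous_map_in_subtopology continuous_map_componentwise
  proof (intro conjI ballI)
    fix k assume "k \<in> \<Omega> \<times> (UNIV :: bool set)"
    then obtain x b where k: "k = (x, b)" "x \<in> \<Omega>" by auto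
    then show "continuous_map (perm_topology \<Omega>) (discrete_topology \<Omega>) (\<lambda>g. perm_graph \<Omega> g k)"
      using continuous_map_perm_eval[of x \<Omega>] continuous_map_perm_eval_inv[of x \<Omega>]
      by (cases b) (auto simp: perm_graph_def)
  qed (use mem in \<open>auto simp: perm_graph_def\<close>)
  have bij: "(\<lambda>x\<in>\<Omega>. f (x, True)) \<in> Bij \<Omega>" if "f \<in> perm_graphs \<Omega>" for f
  proof -
    have "bij_betw (\<lambda>x. f (x, True)) \<Omega> \<Omega>"
      using that by (intro bij_betwI[where g = "\<lambda>x. f (x, False)"]) (auto simp: perm_graphs_def)
    then show ?thesis by (simp add: Bij_def)
  qed
  show "continuous_map (subtopology (perm_graph_space \<Omega>) (perm_graphs \<Omega>)) (perm_topology \<Omega>)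
          (\<lambda>f. \<lambda>x\<in>\<Omega>. f (x, True))"
    unfolding continuous_map_def
  proof (intro conjI allI impI)
    fix S assume S: "openin (perm_topology \<Omega>) S"
    \<comment> \<open>An open set of the whole product is required, so \<open>?N\<close> also admits
      functions outside \<open>perm_graphs \<Omega>\<close>: those whose \<open>True\<close>
      coordinates agree with some element of \<open>S\<close> on a finite set witnessing that
      \<open>S\<close> is open around it.\<close>
    let ?N = "{f \<in> \<Omega> \<times> UNIV \<rightarrow>\<^sub>E \<Omega>. \<exists>g\<in>S. \<exists>F. finite F \<and> F \<subseteq> \<Omega> \<and>
        {h \<in> Bij \<Omega>. \<forall>x\<in>F. h x = g x} \<subseteq> S \<and> (\<forall>x\<in>F. f (x, True) = g x)}"
    have "openin (perm_graph_space \<Omega>) ?N"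
      unfolding openin_product_discrete
    proof (intro conjI ballI)
      fix f assume "f \<in> ?N"
      then obtain g F where gF: "g \<in> S" "finite F" "F \<subseteq> \<Omega>" "{h \<in> Bij \<Omega>. \<forall>x\<in>F. h x = g x} \<subseteq> S"
          "\<forall>x\<in>F. f (x, True) = g x" by blast
      let ?J = "(\<lambda>x. (x, True)) ` F"
      have "finite ?J" "?J \<subseteq> \<Omega> \<times> UNIV" using gF by auto
      moreover have "{h \<in> \<Omega> \<times> UNIV \<rightarrow>\<^sub>E \<Omega>. \<forall>j\<in>?J. h j = f j} \<subseteq> ?N"
        using gF by auto
      ultimately show "\<exists>J. finite J \<and> J \<subseteq> \<Omega> \<times> UNIV \<and> {h \<in> \<Omega> \<times> UNIV \<rightarrow>\<^sub>E \<Omega>. \<forall>j\<in>J. h j = f j} \<subseteq> ?N"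
        by blast
    qed auto
    moreover have "{f \<in> topspace (subtopology (perm_graph_space \<Omega>) (perm_graphs \<Omega>)). (\<lambda>x\<in>\<Omega>. f (x, True)) \<in> S}
       = ?N \<inter> perm_graphs \<Omega>" (is "?A = ?B")
    proof (intro equalityI subsetI)
      fix f assume f: "f \<in> ?A"
      then obtain F where "finite F" "F \<subseteq> \<Omega>" "{h \<in> Bij \<Omega>. \<forall>x\<in>F. h x = (\<lambda>x\<in>\<Omega>. f (x, True)) x} \<subseteq> S"
        using S unfolding openin_perm_topology perm_open_iff by blast
      then show "f \<in> ?B" using f
        by (auto intro!: bexI[of _ "\<lambda>x\<in>\<Omega>. f (x, True)"] exI[of _ F])
    next
      fix f assume f: "f \<in> ?B"
      then obtain g F where "g \<in> S" "F \<subseteq> \<Omega>" "{h \<in> Bij \<Omega>. \<forall>x\<in>F. h x = g x} \<subseteq> S" "\<forall>x\<in>F. f (x, True) = g x"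
        by blast
      moreover have "f \<in> perm_graphs \<Omega>" using f by simp
      ultimately have "(\<lambda>x\<in>\<Omega>. f (x, True)) \<in> {h \<in> Bij \<Omega>. \<forall>x\<in>F. h x = g x}"
        using bij by (auto simp: subset_iff)
      then have "(\<lambda>x\<in>\<Omega>. f (x, True)) \<in> S" using \<open>_ \<subseteq> S\<close> by (rule rev_subsetD)
      then show "f \<in> ?A" using f by simp
    qed
    ultimately show "openin (subtopology (perm_graph_space \<Omega>) (perm_graphs \<Omega>))
      {f \<in> topspace (subtopology (perm_graph_space \<Omega>) (perm_graphs \<Omega>)). (\<lambda>x\<in>\<Omega>. f (x, True)) \<in> S}"
      by (auto simp: openin_subtopology)
  qed (use bij in \<open>auto\<close>)
  show "(\<lambda>x\<in>\<Omega>. perm_graph \<Omega> g (x, True)) = g" if "g \<in> topspace (perm_topology \<Omega>)" for g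
    using that by (intro extensionalityI[of _ \<Omega>]) (auto simp: perm_graph_def Bij_def)
  show "perm_graph \<Omega> (\<lambda>x\<in>\<Omega>. f (x, True)) = f"
    if "f \<in> topspace (subtopology (perm_graph_space \<Omega>) (perm_graphs \<Omega>))" for f
  proof (rule extensionalityI[of _ "\<Omega> \<times> UNIV"])
    have f: "f \<in> perm_graphs \<Omega>" using that by simp
    then show "f \<in> extensional (\<Omega> \<times> UNIV)" by (simp add: perm_graphs_def PiE_def)
    show "perm_graph \<Omega> (\<lambda>x\<in>\<Omega>. f (x, True)) \<in> extensional (\<Omega> \<times> UNIV)"
      by (simp add: perm_graph_def)
    fix k :: "'a \<times> bool" assume "k \<in> \<Omega> \<times> UNIV"
    then obtain x b where k: "k = (x, b)" "x \<in> \<Omega>" by auto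
    have "f (x, False) \<in> \<Omega>" using f k by (auto simp: perm_graphs_def)
    then have "inv_into \<Omega> (\<lambda>x\<in>\<Omega>. f (x, True)) x = f (x, False)"
      using bij[OF f] f k by (intro inv_into_f_eq) (auto simp: Bij_def bij_betw_def perm_graphs_def)
    then show "perm_graph \<Omega> (\<lambda>x\<in>\<Omega>. f (x, True)) k = f k" using k by (simp add: perm_graph_def)
  qed
qed

text \<open>The graphs of the elements of \<open>H\<close> form a closed subset of a product of
  finite sets, which is compact by Tychonoff. Images and preimages have separate hypotheses because
  \<open>H\<close> is an arbitrary closed set, for instance a coset.\<close>

lemma compactin_perm_topology:
  assumes H: "closedin (perm_topology \<Omega>) H"
    and fin: "\<And>x. x \<in> \<Omega> \<Longrightarrow> finite ((\<lambda>h. h x) ` H)" "\<And>x. x \<in> \<Omega> \<Longrightarrow> finite ((\<lambda>h. inv_into \<Omega> h x) ` H)"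
  shows "compactin (perm_topology \<Omega>) H"
proof -
  let ?Y = "subtopology (perm_graph_space \<Omega>) (perm_graphs \<Omega>)" and ?d = "\<lambda>f. \<lambda>x\<in>\<Omega>. f (x, True)"
  have hom: "continuous_map ?Y (perm_topology \<Omega>) ?d"
    "\<And>g. g \<in> Bij \<Omega> \<Longrightarrow> ?d (perm_graph \<Omega> g) = g"
    "\<And>g. g \<in> Bij \<Omega> \<Longrightarrow> perm_graph \<Omega> g \<in> topspace ?Y"
    "\<And>f. f \<in> topspace ?Y \<Longrightarrow> perm_graph \<Omega> (?d f) = f"
  proof -
    note m = homeomorphic_maps_perm_graph[of \<Omega>, unfolded homeomorphic_maps_def]
    show "continuous_map ?Y (perm_topology \<Omega>) ?d" using m by blast
    show "?d (perm_graph \<Omega> g) = g" if "g \<in> Bij \<Omega>" for g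
      using m that unfolding topspace_perm_topology by blast
    show "perm_graph \<Omega> g \<in> topspace ?Y" if "g \<in> Bij \<Omega>" for g
      using m that continuous_map_funspace[of "perm_topology \<Omega>" ?Y "perm_graph \<Omega>"]
      unfolding topspace_perm_topology by blast
    show "perm_graph \<Omega> (?d f) = f" if "f \<in> topspace ?Y" for f
      using m that by blast
  qed
  have sub: "H \<subseteq> Bij \<Omega>" using H closedin_subset by fastforce
  let ?e = "perm_graph \<Omega> ` H"
  have eq: "{f \<in> topspace ?Y. ?d f \<in> H} = ?e"
  proof (intro equalityI subsetI)
    fix f assume "f \<in> {f \<in> topspace ?Y. ?d f \<in> H}"
    then have "f = perm_graph \<Omega> (?d f)" "?d f \<in> H" using hom(4)[of f] by simp_all
    then show "f \<in> ?e" by (rule image_eqI)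
  next
    fix f assume "f \<in> ?e"
    then obtain h where h: "h \<in> H" "f = perm_graph \<Omega> h" by blast
    then have "h \<in> Bij \<Omega>" using sub by blast
    then show "f \<in> {f \<in> topspace ?Y. ?d f \<in> H}" using hom(2,3)[of h] h by simp
  qed
  have "closedin ?Y ?e"
    using closedin_continuous_map_preimage[OF hom(1) H] eq by simp
  then have clo: "closedin (perm_graph_space \<Omega>) ?e"
    using closedin_perm_graphs closedin_trans_full by blast
  let ?P = "Pi\<^sub>E (\<Omega> \<times> UNIV) (\<lambda>(x, b). if b then (\<lambda>h. h x) ` H else (\<lambda>h. inv_into \<Omega> h x) ` H)"
  have "(\<lambda>h. h x) ` H \<subseteq> \<Omega>" "(\<lambda>h. inv_into \<Omega> h x) ` H \<subseteq> \<Omega>" if "x \<in> \<Omega>" for x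
    using sub that Bij_imp_funcset Bij_inv_into_mem by fast+
  then have "compactin (perm_graph_space \<Omega>) ?P"
    using fin by (simp add: compactin_PiE compactin_discrete_topology)
  moreover have "?e \<subseteq> ?P" by (auto simp: perm_graph_def split: if_splits)
  ultimately have "compactin (perm_graph_space \<Omega>) ?e"
    using clo closed_compactin by blast
  moreover have "?e \<subseteq> perm_graphs \<Omega>" using eq by auto
  ultimately have "compactin ?Y ?e" by (simp add: compactin_subtopology)
  then have "compactin (perm_topology \<Omega>) (?d ` ?e)" using hom(1) by (rule image_compactin)
  moreover have "?d ` ?e = H"
    unfolding image_image using hom(2) sub by (simp add: subset_iff cong: image_cong)
  ultimately show ?thesis by simp
qed

text \<open>The ambient space of graphs is then a countable product of discrete spaces, and the
  closed subspace \<open>perm_graphs \<Omega>\<close> inherits complete metrizability.\<close>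

lemma completely_metrizable_perm_topology:
  assumes "countable \<Omega>" shows "completely_metrizable_space (perm_topology \<Omega>)"
proof -
  have "completely_metrizable_space (perm_graph_space \<Omega>)"
    using assms by (auto simp: completely_metrizable_space_product_topology completely_metrizable_space_discrete_topology
       intro: countable_subset[of _ "\<Omega> \<times> UNIV"])
  then have "completely_metrizable_space (subtopology (perm_graph_space \<Omega>) (perm_graphs \<Omega>))"
    using closedin_perm_graphs by (rule completely_metrizable_space_closedin)
  then show ?thesis
    using homeomorphic_maps_perm_graph[of \<Omega>] homeomorphic_completely_metrizable_space
    unfolding homeomorphic_space_def by blast
qed

text \<open>One element of \<open>H\<close> is chosen for each pair of finite lists, sending the
  first to the second where possible; such elements meet every basic neighbourhood. Intersecting
  with \<open>H\<close> discards the arbitrary choices made where no element fits.\<close>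

lemma separable_perm_subtopology:
  assumes "countable \<Omega>" "H \<subseteq> Bij \<Omega>"
  shows "separable_space (subtopology (perm_topology \<Omega>) H)"
proof -
  define c where "c = (\<lambda>(xs, ys). SOME h. h \<in> H \<and> map h xs = ys)"
  define C where "C = c ` (lists \<Omega> \<times> lists \<Omega>) \<inter> H"
  have "countable C" using assms by (auto simp: C_def)
  moreover have "subtopology (perm_topology \<Omega>) H closure_of C = H"
  proof (intro equalityI subsetI)
    fix g assume "g \<in> subtopology (perm_topology \<Omega>) H closure_of C"
    then show "g \<in> H" by (auto simp: in_closure_of)
  next
    fix g assume g: "g \<in> H"
    have "\<exists>y\<in>C. y \<in> S" if gS: "g \<in> S" and opS: "openin (subtopology (perm_topology \<Omega>) H) S" for S
    proof -
      obtain S' where S': "openin (perm_topology \<Omega>) S'" "S = S' \<inter> H"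
        using opS unfolding openin_subtopology by blast
      then obtain F where F: "finite F" "F \<subseteq> \<Omega>" "{h \<in> Bij \<Omega>. \<forall>x\<in>F. h x = g x} \<subseteq> S'"
        using gS unfolding openin_perm_topology perm_open_iff by blast
      obtain xs where xs: "set xs = F" using F finite_list by blast
      let ?h = "c (xs, map g xs)"
      have h: "?h \<in> H \<and> map ?h xs = map g xs"
        unfolding c_def split by (rule someI[of _ g]) (use g in auto)
      moreover have "map g xs \<in> lists \<Omega>" "xs \<in> lists \<Omega>"
        using xs F g assms(2) Bij_imp_funcset[of g \<Omega>] by (auto simp: subset_iff Pi_iff)
      ultimately have "?h \<in> C" by (auto simp: C_def)
      moreover have "?h \<in> S" using h F(3) xs S'(2) assms(2) by auto
      ultimately show ?thesis by blast
    qed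
    then show "g \<in> subtopology (perm_topology \<Omega>) H closure_of C"
      using g assms by (auto simp: in_closure_of)
  qed
  moreover have "C \<subseteq> H" by (auto simp: C_def)
  ultimately show ?thesis unfolding separable_space_def using assms
    by (intro exI[of _ C]) (auto simp: Int_absorb1)
qed

text \<open>A compact neighbourhood of the identity contains the fixator of some finite set, and
  compact sets move each point to finitely many places.\<close>

lemma locally_compact_perm_stabilizer:
  assumes "locally_compact_space (subgroup_topology \<Omega> H)" "H \<subseteq> Bij \<Omega>" "(\<lambda>x\<in>\<Omega>. x) \<in> H"
  obtains F where "finite F" "F \<subseteq> \<Omega>"
    "\<forall>y\<in>\<Omega>. finite {h y | h. h \<in> H \<and> (\<forall>x\<in>F. h x = x)}"
proof -
  let ?i = "\<lambda>x\<in>\<Omega>. x"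
  obtain S K where SK: "openin (subgroup_topology \<Omega> H) S" "compactin (subgroup_topology \<Omega> H) K"
      "?i \<in> S" "S \<subseteq> K"
  proof -
    have "?i \<in> topspace (subgroup_topology \<Omega> H)"
      using assms(3) by (simp add: subgroup_topology_def id_Bij)
    then show thesis using assms(1) that unfolding locally_compact_space_def by meson
  qed
  obtain S' where S': "openin (perm_topology \<Omega>) S'" "S = S' \<inter> H"
    using SK(1) unfolding openin_subtopology subgroup_topology_def by blast
  then obtain F where F: "finite F" "F \<subseteq> \<Omega>" "{h \<in> Bij \<Omega>. \<forall>x\<in>F. h x = ?i x} \<subseteq> S'"
    using SK(3) unfolding openin_perm_topology perm_open_iff by blast
  have K: "compactin (perm_topology \<Omega>) K"
    using SK(2) by (simp add: subgroup_topology_def compactin_subtopology)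
  have "finite {h y | h. h \<in> H \<and> (\<forall>x\<in>F. h x = x)}" if "y \<in> \<Omega>" for y
  proof (rule finite_subset)
    show "{h y | h. h \<in> H \<and> (\<forall>x\<in>F. h x = x)} \<subseteq> (\<lambda>k. k y) ` K"
    proof safe
      fix h assume h: "h \<in> H" "\<forall>x\<in>F. h x = x"
      then have "h \<in> {h \<in> Bij \<Omega>. \<forall>x\<in>F. h x = ?i x}" using F(2) assms(2) by auto
      then have "h \<in> K" using F(3) S'(2) SK(4) h(1) by blast
      then show "h y \<in> (\<lambda>k. k y) ` K" by blast
    qed
    show "finite ((\<lambda>k. k y) ` K)" using K \<open>y \<in> \<Omega>\<close> by (rule compactin_perm_finite)
  qed
  then have "\<forall>y\<in>\<Omega>. finite {h y | h. h \<in> H \<and> (\<forall>x\<in>F. h x = x)}" by simp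
  then show thesis by (rule that[OF F(1,2)])
qed

section \<open>The universal group\<close>

locale delta_tree_setup =
  fixes \<Delta> :: "('v, 'a, 'x) local_action_diagram"
    and T :: "('w, 'b) graph"
    and \<pi>V :: "'w \<Rightarrow> 'v" and \<pi>A :: "'b \<Rightarrow> 'a" and L :: "'b \<Rightarrow> 'x"
  assumes diagram: "is_local_action_diagram \<Delta>"
    and dtree: "delta_tree \<Delta> T \<pi>V \<pi>A L"

sublocale delta_tree_setup \<subseteq> tree_graph T
  using dtree by unfold_locales (simp add: delta_tree_def)

sublocale delta_tree_setup \<subseteq> \<Gamma>: arc_graph "lgraph \<Delta>"
  using diagram by unfold_locales (simp add: is_local_action_diagram_def)

context delta_tree_setup
begin

abbreviation "X \<equiv> vcolours \<Delta>"
abbreviation "G \<equiv> lgroup \<Delta>"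
abbreviation "U \<equiv> universal_group \<Delta> T \<pi>V \<pi>A L"

lemma connected_\<Gamma>: "connected_graph (lgraph \<Delta>)"
  using diagram by (simp add: is_local_action_diagram_def)

lemma colours_nonempty: "a \<in> \<Gamma>.E \<Longrightarrow> colours \<Delta> a \<noteq> {}"
  using diagram by (simp add: is_local_action_diagram_def)

lemma colours_disjoint:
  "a \<in> \<Gamma>.E \<Longrightarrow> a' \<in> \<Gamma>.E \<Longrightarrow> x \<in> colours \<Delta> a \<Longrightarrow> x \<in> colours \<Delta> a' \<Longrightarrow> a = a'"
  using diagram by (auto simp: is_local_action_diagram_def disjoint_family_on_def)

lemma colours_X: "a \<in> \<Gamma>.E \<Longrightarrow> x \<in> colours \<Delta> a \<Longrightarrow> x \<in> X (\<Gamma>.src a)"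
  by (auto simp: vcolours_def arcs_from_def)

lemma local_perm: "v \<in> \<Gamma>.V \<Longrightarrow> perm_subgroup (X v) (G v)"
  using diagram by (simp add: is_local_action_diagram_def perm_subgroup_def)

lemma local_closed: "v \<in> \<Gamma>.V \<Longrightarrow> closedin (perm_topology (X v)) (G v)"
  using diagram by (simp add: is_local_action_diagram_def)

lemma local_orbit:
  assumes "a \<in> \<Gamma>.E" "x \<in> colours \<Delta> a"
  shows "colours \<Delta> a = {\<tau> x | \<tau>. \<tau> \<in> G (\<Gamma>.src a)}"
proof -
  let ?v = "\<Gamma>.src a"
  interpret perm_subgroup "X ?v" "G ?v" using assms by (intro local_perm) auto
  have x: "x \<in> X ?v" using assms colours_X by auto
  let ?o = "{\<tau> x | \<tau>. \<tau> \<in> G ?v}"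
  have "?o \<in> orbits (perm_group (X ?v) (G ?v)) (X ?v) (\<lambda>g. g)"
    using x by (auto simp: orbits_def orbit_def)
  also have "\<dots> = colours \<Delta> ` arcs_from (lgraph \<Delta>) ?v"
    using diagram assms by (auto simp: is_local_action_diagram_def)
  finally obtain a' where a': "a' \<in> \<Gamma>.E" "?o = colours \<Delta> a'" by (auto simp: arcs_from_def)
  have "(\<lambda>x\<in>X ?v. x) x \<in> ?o" using id_mem by blast
  then have "x \<in> colours \<Delta> a'" using a' x by simp
  then show ?thesis using colours_disjoint assms a' by metis
qed

lemma local_colour:
  "a \<in> \<Gamma>.E \<Longrightarrow> \<tau> \<in> G (\<Gamma>.src a) \<Longrightarrow> x \<in> colours \<Delta> a \<Longrightarrow> \<tau> x \<in> colours \<Delta> a"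
  using local_orbit[of a x] by auto

lemma local_transitive:
  "a \<in> \<Gamma>.E \<Longrightarrow> x \<in> colours \<Delta> a \<Longrightarrow> y \<in> colours \<Delta> a \<Longrightarrow> \<exists>\<tau>\<in>G (\<Gamma>.src a). \<tau> x = y"
  using local_orbit[of a x] by auto

lemma \<pi>V_vert [simp]: "x \<in> V \<Longrightarrow> \<pi>V x \<in> \<Gamma>.V"
  and \<pi>A_arc [simp]: "b \<in> E \<Longrightarrow> \<pi>A b \<in> \<Gamma>.E"
  and src_\<pi>A [simp]: "b \<in> E \<Longrightarrow> \<Gamma>.src (\<pi>A b) = \<pi>V (src b)"
  and \<pi>A_rv [simp]: "b \<in> E \<Longrightarrow> \<pi>A (rv b) = \<Gamma>.rv (\<pi>A b)"
  using dtree by (auto simp: delta_tree_def graph_hom_def)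

lemma tgt_\<pi>A [simp]: "b \<in> E \<Longrightarrow> \<Gamma>.tgt (\<pi>A b) = \<pi>V (tgt b)"
  using src_\<pi>A[of "rv b"] by simp

lemma \<pi>_images: "\<pi>V ` V = \<Gamma>.V" "\<pi>A ` E = \<Gamma>.E"
  using dtree by (simp_all add: delta_tree_def)

lemma \<pi>V_surj: "v \<in> \<Gamma>.V \<Longrightarrow> \<exists>x\<in>V. \<pi>V x = v"
  and \<pi>A_surj: "a \<in> \<Gamma>.E \<Longrightarrow> \<exists>b\<in>E. \<pi>A b = a"
  by (metis \<pi>_images imageE)+

lemma L_bij_arc:
  assumes "x \<in> V" "a \<in> \<Gamma>.E" "\<Gamma>.src a = \<pi>V x"
  shows "bij_betw L {b \<in> arcs_from T x. \<pi>A b = a} (colours \<Delta> a)"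
proof -
  have "\<forall>v\<in>V. \<forall>a\<in>arcs_from (lgraph \<Delta>) (\<pi>V v).
        bij_betw L {b \<in> arcs_from T v. \<pi>A b = a} (colours \<Delta> a)"
    using dtree unfolding delta_tree_def by blast
  then show ?thesis using assms by (simp add: arcs_from_def)
qed

lemma L_colour: "b \<in> E \<Longrightarrow> L b \<in> colours \<Delta> (\<pi>A b)"
  using L_bij_arc[of "src b" "\<pi>A b"] by (auto simp: bij_betw_def arcs_from_def)

lemma L_X: "b \<in> E \<Longrightarrow> L b \<in> X (\<pi>V (src b))"
  using L_colour[of b] colours_X[of "\<pi>A b"] by simp

lemma L_inj:
  assumes "b \<in> E" "c \<in> E" "src b = src c" "L b = L c" shows "b = c"
proof -
  have "\<pi>A b = \<pi>A c" using L_colour[of b] L_colour[of c] colours_disjoint assms by auto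
  moreover have "inj_on L {b' \<in> arcs_from T (src b). \<pi>A b' = \<pi>A b}"
    using L_bij_arc[of "src b" "\<pi>A b"] assms by (auto simp: bij_betw_def)
  ultimately show ?thesis using assms by (auto simp: arcs_from_def dest: inj_onD)
qed

lemma L_ex:
  assumes "x \<in> V" "a \<in> \<Gamma>.E" "\<Gamma>.src a = \<pi>V x" "y \<in> colours \<Delta> a"
  shows "\<exists>b. b \<in> E \<and> src b = x \<and> \<pi>A b = a \<and> L b = y"
proof -
  have "y \<in> L ` {b \<in> arcs_from T x. \<pi>A b = a}"
    using L_bij_arc[OF assms(1-3)] assms(4) by (simp add: bij_betw_def)
  then show ?thesis by (auto simp: arcs_from_def)
qed

lemma L_star: "x \<in> V \<Longrightarrow> bij_betw L (arcs_from T x) (X (\<pi>V x))"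
  unfolding bij_betw_def
proof (intro conjI equalityI subsetI)
  fix y assume "x \<in> V" "y \<in> X (\<pi>V x)"
  then obtain a where "a \<in> \<Gamma>.E" "\<Gamma>.src a = \<pi>V x" "y \<in> colours \<Delta> a"
    by (auto simp: vcolours_def arcs_from_def)
  then show "y \<in> L ` arcs_from T x" using L_ex[of x a y] \<open>x \<in> V\<close> by (auto simp: arcs_from_def)
qed (auto simp: arcs_from_def L_X intro!: inj_onI intro: L_inj)

text \<open>The local permutations make \<open>h\<close> bijective on every star, so bijectivity of
  \<open>g\<close> and \<open>h\<close> comes from \<open>covering_bij\<close>. The restriction to
  \<open>V\<close> supplies extensionality, which functions defined by recursion or by cases do not
  have.\<close>

lemma universal_group_intro:
  assumes g: "\<And>x. x \<in> V \<Longrightarrow> g x \<in> V" "\<And>x. x \<in> V \<Longrightarrow> \<pi>V (g x) = \<pi>V x"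
    and h: "\<And>b. b \<in> E \<Longrightarrow> h b \<in> E" "\<And>b. b \<in> E \<Longrightarrow> src (h b) = g (src b)"
      "\<And>b. b \<in> E \<Longrightarrow> h (rv b) = rv (h b)" "\<And>b. b \<in> E \<Longrightarrow> \<pi>A (h b) = \<pi>A b"
    and loc: "\<And>x. x \<in> V \<Longrightarrow> \<exists>\<tau>\<in>G (\<pi>V x). \<forall>b\<in>E. src b = x \<longrightarrow> L (h b) = \<tau> (L b)"
  shows "restrict g V \<in> U" "\<And>b. b \<in> E \<Longrightarrow> arc_map T (restrict g V) b = h b"
proof -
  have star: "bij_betw h (arcs_from T x) (arcs_from T (g x))" if x: "x \<in> V" for x
  proof -
    obtain \<tau> where \<tau>: "\<tau> \<in> G (\<pi>V x)" "\<And>b. b \<in> E \<Longrightarrow> src b = x \<Longrightarrow> L (h b) = \<tau> (L b)"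
      using loc x by blast
    interpret perm_subgroup "X (\<pi>V x)" "G (\<pi>V x)" using x by (intro local_perm) auto
    have "bij_betw (\<tau> \<circ> L) (arcs_from T x) (X (\<pi>V (g x)))"
      using bij_betw_trans[OF L_star[OF x] bij[OF \<tau>(1)]] g x by simp
    then have "bij_betw (L \<circ> h) (arcs_from T x) (X (\<pi>V (g x)))"
      by (rule bij_betw_cong[THEN iffD1, rotated]) (auto simp: arcs_from_def \<tau>)
    moreover have "h ` arcs_from T x \<subseteq> arcs_from T (g x)" using h by (auto simp: arcs_from_def)
    ultimately show ?thesis
      using bij_betw_comp_iff2[OF L_star[of "g x"]] g x by blast
  qed
  have gb: "bij_betw g V V" by (rule covering_bij[of g h]) (use g h star in auto)
  have "bij_betw h E E"
    unfolding bij_betw_def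
  proof (intro conjI equalityI subsetI)
    show "inj_on h E"
    proof (rule inj_onI)
      fix b c assume bc: "b \<in> E" "c \<in> E" "h b = h c"
      then have "src b = src c" using h gb by (metis bij_betw_def inj_onD src_vert)
      then show "b = c" using star[of "src b"] bc
        by (auto simp: bij_betw_def arcs_from_def dest: inj_onD)
    qed
  next
    fix c assume c: "c \<in> E"
    then obtain x where x: "x \<in> V" "src c = g x" using gb by (metis bij_betw_def imageE src_vert)
    then have "c \<in> h ` arcs_from T x" using star c by (auto simp: bij_betw_def arcs_from_def)
    then show "c \<in> h ` E" by (auto simp: arcs_from_def)
  qed (use h in auto)
  then have aut: "graph_aut T (restrict g V) (restrict h E)"
    using gb g h by (auto simp: graph_aut_def graph_hom_def Bij_def)
  then have am: "arc_map T (restrict g V) = restrict h E" by (rule arc_map_eq[OF tree])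
  then show "arc_map T (restrict g V) b = h b" if "b \<in> E" for b using that by simp
  have "local_action \<Delta> T \<pi>V L x (restrict g V) \<in> G (\<pi>V x)" if x: "x \<in> V" for x
  proof -
    obtain \<tau> where \<tau>: "\<tau> \<in> G (\<pi>V x)" "\<And>b. b \<in> E \<Longrightarrow> src b = x \<Longrightarrow> L (h b) = \<tau> (L b)"
      using loc x by blast
    interpret perm_subgroup "X (\<pi>V x)" "G (\<pi>V x)" using x by (intro local_perm) auto
    have "local_action \<Delta> T \<pi>V L x (restrict g V) = \<tau>"
    proof (rule extensionalityI[of _ "X (\<pi>V x)"])
      fix y assume y: "y \<in> X (\<pi>V x)"
      let ?b = "inv_into (arcs_from T x) L y"
      have "?b \<in> arcs_from T x" "L ?b = y"
        using L_star[OF x] y by (auto simp: bij_betw_def f_inv_into_f inv_into_into)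
      then show "local_action \<Delta> T \<pi>V L x (restrict g V) y = \<tau> y"
        using y \<tau>(2)[of ?b] by (simp add: local_action_def am arcs_from_def)
    qed (use \<tau> subset_Bij in \<open>auto simp: local_action_def Bij_def\<close>)
    then show ?thesis using \<tau> by simp
  qed
  then show "restrict g V \<in> U"
    using aut g h by (auto simp: universal_group_def Aut_def am)
qed

section \<open>Elements of the universal group and their local actions\<close>

lemma U_aut: "g \<in> U \<Longrightarrow> graph_aut T g (arc_map T g)"
  using arc_map_eq[OF tree] by (auto simp: universal_group_def Aut_def)

lemma U_arc [simp]: "g \<in> U \<Longrightarrow> b \<in> E \<Longrightarrow> arc_map T g b \<in> E"
  and U_src [simp]: "g \<in> U \<Longrightarrow> b \<in> E \<Longrightarrow> src (arc_map T g b) = g (src b)"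
  and U_rv [simp]: "g \<in> U \<Longrightarrow> b \<in> E \<Longrightarrow> arc_map T g (rv b) = rv (arc_map T g b)"
  using U_aut[of g] by (auto simp: graph_aut_def graph_hom_def)

lemma U_tgt [simp]: "g \<in> U \<Longrightarrow> b \<in> E \<Longrightarrow> tgt (arc_map T g b) = g (tgt b)"
  using U_src[of g "rv b"] by simp

lemma U_\<pi>V [simp]: "g \<in> U \<Longrightarrow> x \<in> V \<Longrightarrow> \<pi>V (g x) = \<pi>V x"
  and U_\<pi>A [simp]: "g \<in> U \<Longrightarrow> b \<in> E \<Longrightarrow> \<pi>A (arc_map T g b) = \<pi>A b"
  by (auto simp: universal_group_def)

lemma U_arc_eqI:
  "g \<in> U \<Longrightarrow> b \<in> E \<Longrightarrow> c \<in> E \<Longrightarrow> src c = g (src b) \<Longrightarrow> tgt c = g (tgt b) \<Longrightarrow> arc_map T g b = c"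
  by (rule arc_unique) auto

abbreviation loc :: "('w \<Rightarrow> 'w) \<Rightarrow> 'w \<Rightarrow> 'x \<Rightarrow> 'x" where
  "loc g x \<equiv> local_action \<Delta> T \<pi>V L x g"

lemma loc_mem [simp]: "g \<in> U \<Longrightarrow> x \<in> V \<Longrightarrow> loc g x \<in> G (\<pi>V x)"
  unfolding universal_group_def by blast

lemma loc_L: assumes "b \<in> E" shows "loc g (src b) (L b) = L (arc_map T g b)"
proof -
  have "inj_on L (arcs_from T (src b))" using L_star[of "src b"] assms by (simp add: bij_betw_def)
  then have "inv_into (arcs_from T (src b)) L (L b) = b"
    by (rule inv_into_f_f) (simp add: arcs_from_def assms)
  then show ?thesis using L_X[OF assms] by (simp add: local_action_def)
qed

lemma U_bij: "g \<in> U \<Longrightarrow> bij_betw g V V" and U_bij_arcs: "g \<in> U \<Longrightarrow> bij_betw (arc_map T g) E E"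
  and U_ext: "g \<in> U \<Longrightarrow> g \<in> extensional V"
  using U_aut[of g] by (auto simp: graph_aut_def Bij_def)

lemma U_vert: "g \<in> U \<Longrightarrow> x \<in> V \<Longrightarrow> g x \<in> V"
  using U_bij by (auto simp: bij_betw_def)

lemma subgroup_U: "perm_subgroup V U"
proof (rule perm_subgroup.intro, rule subgroup.intro)
  show "U \<subseteq> carrier (BijGroup V)"
    using U_bij U_ext by (auto simp: BijGroup_def Bij_def)
  have id: "(\<lambda>x\<in>X v. x) \<in> G v" if "v \<in> \<Gamma>.V" for v
    using perm_subgroup.id_mem[OF local_perm[OF that]] .
  have "restrict (\<lambda>x. x) V \<in> U"
    by (rule universal_group_intro[where h = "\<lambda>b. b"])
       (auto intro!: bexI[OF _ id] simp: L_X)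
  then show "\<one>\<^bsub>BijGroup V\<^esub> \<in> U" by (simp add: BijGroup_def)
  fix g assume g: "g \<in> U"
  {
    fix k assume k: "k \<in> U"
    have "restrict (\<lambda>x. g (k x)) V \<in> U"
    proof (rule universal_group_intro[where h = "\<lambda>b. arc_map T g (arc_map T k b)"])
      fix x assume x: "x \<in> V"
      interpret perm_subgroup "X (\<pi>V x)" "G (\<pi>V x)" using x by (intro local_perm) auto
      have m: "loc g (k x) \<in> G (\<pi>V x)" "loc k x \<in> G (\<pi>V x)"
        using loc_mem[of g "k x"] loc_mem[of k x] U_vert[OF k x] U_\<pi>V[OF k x] g k x by auto
      \<comment> \<open>The cocycle rule: a product acts at \<open>x\<close> by the local action of
        \<open>g\<close> at \<open>k x\<close> after that of \<open>k\<close> at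
        \<open>x\<close>.\<close>
      have "L (arc_map T g (arc_map T k b)) = compose (X (\<pi>V x)) (loc g (k x)) (loc k x) (L b)"
        if "b \<in> E" "src b = x" for b
        using that loc_L[of "arc_map T k b" g] loc_L[of b k] L_X[of b] k by (simp add: compose_eq)
      then show "\<exists>\<tau>\<in>G (\<pi>V x). \<forall>b\<in>E. src b = x \<longrightarrow> L (arc_map T g (arc_map T k b)) = \<tau> (L b)"
        using m compose_mem by blast
    qed (use g k U_vert in auto)
    moreover have "g \<otimes>\<^bsub>BijGroup V\<^esub> k = restrict (\<lambda>x. g (k x)) V"
      using g k U_bij U_ext by (auto simp: BijGroup_def Bij_def compose_def)
    ultimately show "g \<otimes>\<^bsub>BijGroup V\<^esub> k \<in> U" by simp
  }
  let ?g = "inv_into V g" and ?h = "inv_into E (arc_map T g)"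
  have gi: "x \<in> V \<Longrightarrow> ?g x \<in> V" "x \<in> V \<Longrightarrow> g (?g x) = x" "x \<in> V \<Longrightarrow> ?g (g x) = x" for x
    using U_bij[OF g] by (auto simp: bij_betw_def inv_into_into f_inv_into_f)
  have hi: "b \<in> E \<Longrightarrow> ?h b \<in> E" "b \<in> E \<Longrightarrow> arc_map T g (?h b) = b"
       "b \<in> E \<Longrightarrow> ?h (arc_map T g b) = b" for b
    using U_bij_arcs[OF g] by (auto simp: bij_betw_def inv_into_into f_inv_into_f)
  have "restrict ?g V \<in> U"
  proof (rule universal_group_intro[where h = ?h])
    show "\<pi>V (?g x) = \<pi>V x" if "x \<in> V" for x using U_\<pi>V[OF g, of "?g x"] gi that by simp
    show "src (?h b) = ?g (src b)" if "b \<in> E" for b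
      using U_src[OF g, of "?h b"] hi that gi(3)[of "src (?h b)"] by simp
    show "?h (rv b) = rv (?h b)" if "b \<in> E" for b
      using U_rv[OF g, of "?h b"] hi that hi(3)[of "rv (?h b)"] by simp
    show "\<pi>A (?h b) = \<pi>A b" if "b \<in> E" for b using U_\<pi>A[OF g, of "?h b"] hi that by simp
    fix x assume x: "x \<in> V"
    interpret perm_subgroup "X (\<pi>V x)" "G (\<pi>V x)" using x by (intro local_perm) auto
    \<comment> \<open>By the cocycle rule the inverse must act at \<open>x\<close> through the
      inverse of the local action of \<open>g\<close> at the preimage of \<open>x\<close>.\<close>
    have m: "loc g (?g x) \<in> G (\<pi>V x)"
      using loc_mem[OF g, of "?g x"] gi x U_\<pi>V[OF g, of "?g x"] by simp
    have "L (?h b) = pinv (loc g (?g x)) (L b)" if b: "b \<in> E" "src b = x" for b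
    proof -
      have "src (?h b) = ?g x" using U_src[OF g, of "?h b"] hi b gi(3)[of "src (?h b)"] by simp
      then have "loc g (?g x) (L (?h b)) = L b" using loc_L[of "?h b" g] hi b by simp
      moreover have "L (?h b) \<in> X (\<pi>V x)"
        using L_X[of "?h b"] hi b \<open>src (?h b) = ?g x\<close> U_\<pi>V[OF g, of "?g x"] gi x by simp
      ultimately show ?thesis using m by (metis pinv_app)
    qed
    then show "\<exists>\<tau>\<in>G (\<pi>V x). \<forall>b\<in>E. src b = x \<longrightarrow> L (?h b) = \<tau> (L b)"
      using m pinv_mem by blast
  qed (use gi hi in auto)
  moreover have "inv\<^bsub>BijGroup V\<^esub> g = restrict ?g V"
    using g U_bij U_ext by (intro inv_BijGroup) (auto simp: Bij_def)
  ultimately show "inv\<^bsub>BijGroup V\<^esub> g \<in> U" by simp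
qed

end

sublocale delta_tree_setup \<subseteq> U: perm_subgroup "verts T" "universal_group \<Delta> T \<pi>V \<pi>A L"
  by (rule subgroup_U)

context delta_tree_setup
begin

lemma arc_map_id [simp]: "b \<in> E \<Longrightarrow> arc_map T (\<lambda>x\<in>V. x) b = b"
  by (rule U_arc_eqI) auto

lemma arc_map_compose [simp]:
  "g \<in> U \<Longrightarrow> k \<in> U \<Longrightarrow> b \<in> E \<Longrightarrow> arc_map T (compose V g k) b = arc_map T g (arc_map T k b)"
  by (rule U_arc_eqI) (auto simp: compose_eq)

lemma arc_map_pinv [simp]:
  "g \<in> U \<Longrightarrow> b \<in> E \<Longrightarrow> arc_map T (U.pinv g) (arc_map T g b) = b"
  "g \<in> U \<Longrightarrow> b \<in> E \<Longrightarrow> arc_map T g (arc_map T (U.pinv g) b) = b"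
  by (rule U_arc_eqI; auto)+

lemma arc_map_eq_iff [simp]:
  "g \<in> U \<Longrightarrow> b \<in> E \<Longrightarrow> c \<in> E \<Longrightarrow> arc_map T g b = arc_map T g c \<longleftrightarrow> b = c"
  using arc_map_pinv(1) by metis

lemma tpath_U:
  assumes g: "g \<in> U" and "x \<in> V" "y \<in> V"
  shows "tpath (g x) (g y) = map (arc_map T g) (tpath x y)"
proof (rule tpath_eq)
  have w: "walk T u p v \<Longrightarrow> walk T (g u) (map (arc_map T g) p) (g v)" for u p v
    by (induction p arbitrary: u) (auto simp: g U_vert)
  then show "walk T (g x) (map (arc_map T g) (tpath x y)) (g y)" using assms walk_tpath by blast
  have "set p \<subseteq> E \<Longrightarrow> reduced p \<Longrightarrow> reduced (map (arc_map T g) p)" for p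
  proof (induction p)
    case (Cons b p)
    then have "hd p \<in> E" if "p \<noteq> []" using that by (cases p) auto
    then show ?case using Cons g U_rv[OF g, of b] arc_map_eq_iff[OF g, of "hd p" "rv b"]
      by (auto simp: reduced_Cons hd_map)
  qed auto
  then show "reduced (map (arc_map T g) (tpath x y))"
    using assms reduced_tpath walk_tpath walk_arcs by metis
qed

lemma half_U:
  assumes "g \<in> U" "b \<in> E" "x \<in> V"
  shows "g x \<in> half (arc_map T g b) \<longleftrightarrow> x \<in> half b"
proof -
  have "x \<in> half b \<Longrightarrow> g x \<in> half (arc_map T g b)" if "g \<in> U" "b \<in> E" "x \<in> V" for g b x
    using that tpath_U[of g "src b" x] by (auto simp: half_iff)
  from this[of g b x] this[of "U.pinv g" "arc_map T g b" "g x"] show ?thesis using assms by auto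
qed

text \<open>
  The automorphism is built outward from \<open>x\<close>: the local action at each new vertex only has to
  match the image of the arc leading back, which is possible as the colours of an arc form an orbit.
\<close>

lemma extension:
  assumes x: "x \<in> V" "x' \<in> V" "\<pi>V x' = \<pi>V x" and \<tau>: "\<tau> \<in> G (\<pi>V x)"
  obtains g where "g \<in> U" "g x = x'" "\<forall>b\<in>E. src b = x \<longrightarrow> L (arc_map T g b) = \<tau> (L b)"
proof -
  \<comment> \<open>A state \<open>s\<close> holds the image of a vertex and the local permutation
    there. \<open>N b s\<close> is the arc to which \<open>b\<close> must then go, and
    \<open>F b s\<close> is the state at the far end, whose permutation has to match the image of
    the arc leading back. The invariant \<open>I\<close> below guarantees that both choices
    exist.\<close>
  define N where "N b s = (SOME c. c \<in> E \<and> src c = fst s \<and> \<pi>A c = \<pi>A b \<and> L c = snd s (L b))" for b s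
  define F where "F b s = (tgt (N b s),
      SOME \<rho>. \<rho> \<in> G (\<pi>V (tgt b)) \<and> \<rho> (L (rv b)) = L (rv (N b s)))" for b s
  obtain f :: "'w \<Rightarrow> 'w \<times> ('x \<Rightarrow> 'x)" where f: "f x = (x', \<tau>)"
    "\<And>b. b \<in> E \<Longrightarrow> tpath x (tgt b) = tpath x (src b) @ [b] \<Longrightarrow> f (tgt b) = F b (f (src b))"
    using tree_recursion[OF x(1), of "(x', \<tau>)" F] by metis
  define I where "I y \<longleftrightarrow> fst (f y) \<in> V \<and> \<pi>V (fst (f y)) = \<pi>V y \<and> snd (f y) \<in> G (\<pi>V y)" for y
  define h where "h b = N b (f (src b))" for b
  have N: "h b \<in> E \<and> src (h b) = fst (f (src b)) \<and> \<pi>A (h b) = \<pi>A b \<and> L (h b) = snd (f (src b)) (L b)"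
    if "b \<in> E" "I (src b)" for b
  proof -
    have "snd (f (src b)) (L b) \<in> colours \<Delta> (\<pi>A b)"
      using that local_colour[of "\<pi>A b"] L_colour[of b] by (simp add: I_def)
    then show ?thesis unfolding h_def N_def
      by (rule_tac someI_ex, rule_tac L_ex) (use that in \<open>auto simp: I_def\<close>)
  qed
  have F: "I (tgt b) \<and> fst (f (tgt b)) = tgt (h b) \<and> snd (f (tgt b)) (L (rv b)) = L (rv (h b))"
    if b: "b \<in> E" "tpath x (tgt b) = tpath x (src b) @ [b]" "I (src b)" for b
  proof -
    note n = N[OF b(1,3)]
    have "L (rv (h b)) \<in> colours \<Delta> (\<Gamma>.rv (\<pi>A b))" "L (rv b) \<in> colours \<Delta> (\<Gamma>.rv (\<pi>A b))"
      using n L_colour[of "rv (h b)"] L_colour[of "rv b"] b by auto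
    then have "\<exists>\<rho>. \<rho> \<in> G (\<pi>V (tgt b)) \<and> \<rho> (L (rv b)) = L (rv (h b))"
      using local_transitive[of "\<Gamma>.rv (\<pi>A b)" "L (rv b)" "L (rv (h b))"] b by auto
    from someI_ex[OF this] show ?thesis
      using f(2)[OF b(1,2)] n b tgt_\<pi>A[of "h b"] tgt_\<pi>A[of b] unfolding F_def I_def h_def by auto
  qed
  have I: "I y" if "y \<in> V" for y
    using x(1) that
  proof (induction rule: tree_induct)
    case root
    show ?case using x \<tau> f(1) by (simp add: I_def)
  qed (use F in blast)
  have hE: "h b \<in> E" "src (h b) = fst (f (src b))" "\<pi>A (h b) = \<pi>A b" "L (h b) = snd (f (src b)) (L b)"
    if "b \<in> E" for b using N[OF that] I that by auto
  \<comment> \<open>For an outward arc the permutation at \<open>tgt b\<close> was chosen to send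
    \<open>L (rv b)\<close> to \<open>L (rv (h b))\<close>. An inward arc is the reversal of an
    outward one.\<close>
  have rv': "h (rv b) = rv (h b)" if b: "b \<in> E" "tpath x (tgt b) = tpath x (src b) @ [b]" for b
  proof (rule L_inj)
    show "src (h (rv b)) = src (rv (h b))" "L (h (rv b)) = L (rv (h b))"
      using F[OF b] I b hE(2,4)[of "rv b"] by auto
  qed (use hE b in auto)
  have rv: "h (rv b) = rv (h b)" if b: "b \<in> E" for b
    using x(1) b
  proof (cases rule: tpath_step)
    case 2
    then have "h (rv (rv b)) = rv (h (rv b))" using b by (intro rv') auto
    then show ?thesis using b hE(1)[of "rv b"] by auto
  qed (use b rv' in auto)
  let ?g = "\<lambda>y. fst (f y)"
  have gU: "restrict ?g V \<in> U" "\<And>b. b \<in> E \<Longrightarrow> arc_map T (restrict ?g V) b = h b"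
  proof -
    show "restrict ?g V \<in> U"
      by (rule universal_group_intro[where h = h]) (use hE rv I in \<open>auto simp: I_def\<close>)
    show "\<And>b. b \<in> E \<Longrightarrow> arc_map T (restrict ?g V) b = h b"
      by (rule universal_group_intro[where h = h]) (use hE rv I in \<open>auto simp: I_def\<close>)
  qed
  show thesis
    by (rule that[of "restrict ?g V"]) (use gU x f(1) hE in auto)
qed

text \<open>Transitivity of the local group on the colours of an arc extends to \<open>U\<close>:
  the fibres of \<open>\<pi>A\<close> are exactly its arc orbits, so the graph of
  \<open>\<Delta>\<close> is the quotient of \<open>T\<close>.\<close>

lemma arc_transitive:
  assumes "b \<in> E" "c \<in> E" "\<pi>A b = \<pi>A c"
  obtains g where "g \<in> U" "arc_map T g b = c"
proof -
  have pv: "\<pi>V (src c) = \<pi>V (src b)" using assms src_\<pi>A by metis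
  obtain \<tau> where \<tau>: "\<tau> \<in> G (\<pi>V (src b))" "\<tau> (L b) = L c"
    using local_transitive[of "\<pi>A b" "L b" "L c"] L_colour[of b] L_colour[of c] assms pv by auto
  obtain g where g: "g \<in> U" "g (src b) = src c"
      "\<forall>b'\<in>E. src b' = src b \<longrightarrow> L (arc_map T g b') = \<tau> (L b')"
    by (rule extension[OF _ _ pv \<tau>(1)]) (use assms in auto)
  have "arc_map T g b = c" by (rule L_inj) (use g assms \<tau> in auto)
  then show thesis using g that by blast
qed

lemma vertex_transitive:
  assumes "x \<in> V" "y \<in> V" "\<pi>V x = \<pi>V y"
  obtains g where "g \<in> U" "g x = y"
  using extension[of x y "\<lambda>z\<in>X (\<pi>V x). z"] assms perm_subgroup.id_mem[OF local_perm] by auto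

text \<open>Membership in \<open>U\<close> is tested vertex by vertex. Gluing \<open>u\<close> on
  \<open>half b\<close> to the identity elsewhere leaves at each vertex either the local action of
  \<open>u\<close> or the identity, and the pieces fit because \<open>u\<close> fixes
  \<open>b\<close>, the only arc entering \<open>half b\<close>.\<close>

lemma tits_independence:
  assumes u: "u \<in> U" and b: "b \<in> E" "arc_map T u b = b"
  obtains k where "k \<in> U" "\<forall>y\<in>half b. k y = u y" "\<forall>y\<in>V. y \<notin> half b \<longrightarrow> k y = y"
proof -
  let ?g = "\<lambda>y. if y \<in> half b then u y else y"
  let ?h = "\<lambda>c. if src c \<in> half b \<or> tgt c \<in> half b then arc_map T u c else c"
  have ends: "u (src b) = src b" "u (tgt b) = tgt b" using U_src U_tgt u b by metis+
  have cross: "c = b" if "c \<in> E" "src c \<notin> half b" "tgt c \<in> half b" for c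
    using half_leave[of b "rv c"] b that by (auto simp: rv_eq_iff)
  have "restrict ?g V \<in> U"
  proof (rule universal_group_intro[where h = ?h])
    show "src (?h c) = ?g (src c)" if "c \<in> E" for c
      using that cross[of c] ends u by auto
    fix x assume x: "x \<in> V"
    show "\<exists>\<tau>\<in>G (\<pi>V x). \<forall>c\<in>E. src c = x \<longrightarrow> L (?h c) = \<tau> (L c)"
    proof (cases "x \<in> half b")
      case True
      then show ?thesis using loc_L u x by (intro bexI[of _ "loc u x"]) auto
    next
      case False
      then have "?h c = c" if "c \<in> E" "src c = x" for c using cross[of c] that b(2) by auto
      then show ?thesis using x perm_subgroup.id_mem[OF local_perm[of "\<pi>V x"]]
        by (intro bexI[of _ "\<lambda>y\<in>X (\<pi>V x). y"]) (auto simp: L_X)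
    qed
  qed (use u in auto)
  then show thesis by (rule that) (auto dest: half_verts)
qed

end

section \<open>Rays and half-trees\<close>

lemma terminus_subgraph [simp]: "terminus (\<Gamma>\<lparr>verts := W, arcs := B\<rparr>) = terminus \<Gamma>"
  by (rule ext) (simp add: terminus_def)

context tree_graph
begin

lemma half_enter:
  assumes "c \<in> E" "d \<in> E" "src d \<notin> half c" "tgt d \<in> half c" shows "d = c"
  using half_leave[of c "rv d"] assms by (metis rv_arc rv_rv src_rv tgt_rv)

lemma reduced_sequence_inj:
  assumes c: "\<And>n. c n \<in> E" "\<And>n. src (c (Suc n)) = tgt (c n)" "\<And>n. c (Suc n) \<noteq> rv (c n)"
  shows "inj (\<lambda>n. src (c n))"
proof -
  have w: "walk T (src (c n)) (map c [n..<n+k]) (src (c (n + k)))" for n k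
    by (induction k) (auto simp: walk_snoc[OF is_graph] c)
  have r: "reduced (map c [n..<n+k])" for n k
  proof (induction k)
    case (Suc k)
    then show ?case using c(3) by (cases k) (auto simp: reduced_append)
  qed auto
  have ne: "src (c n) \<noteq> src (c m)" if "n < m" for n m
  proof
    assume "src (c n) = src (c m)"
    then have "map c [n..<m] = []"
      using w[of n "m - n"] r[of n "m - n"] that by (intro reduced_closed_walk) auto
    then show False using that by simp
  qed
  show ?thesis by (rule linorder_injI) (use ne in auto)
qed

text \<open>To leave \<open>half b\<close> the ray would have to traverse \<open>rv b\<close> and so
  return to \<open>r 0\<close>, against injectivity.\<close>

lemma ray_half:
  assumes "r \<in> rays T" "b \<in> E" "src b = r 0" "tgt b = r 1"
  shows "r (Suc n) \<in> half b"
proof (induction n)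
  case (Suc n)
  obtain a where a: "a \<in> E" "src a = r (Suc n)" "tgt a = r (Suc (Suc n))"
    using assms(1) unfolding rays_def by blast
  have "inj r" using assms(1) by (simp add: rays_def)
  then have "r (Suc (Suc n)) \<noteq> r 0" by (simp add: inj_eq)
  then have "a \<noteq> rv b" using a assms by auto
  then show ?case using half_leave[of b a] Suc a assms by auto
qed (use assms tgt_in_half[of b] in auto)

end

section \<open>Irreducible diagrams and geometrically dense actions\<close>

context delta_tree_setup
begin

text \<open>Turning straight back downstairs is possible when the reverse arc has a second colour,
  since a lift can then continue along a different arc over it. As \<open>card\<close> is 0 on
  infinite sets and colour sets are nonempty, \<open>card ... \<noteq> 1\<close> means at least two
  colours, finite or not.\<close>

definition next_arc :: "'a \<Rightarrow> 'a \<Rightarrow> bool" where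
  "next_arc a a' \<longleftrightarrow> a \<in> \<Gamma>.E \<and> a' \<in> \<Gamma>.E \<and> \<Gamma>.src a' = \<Gamma>.tgt a \<and>
     (a' \<noteq> \<Gamma>.rv a \<or> card (colours \<Delta> a') \<noteq> 1)"

text \<open>
  A scopo is a set of arcs that is closed under predecessors of \<open>next_arc\<close>. If \<open>a\<close> does not reach its
  reversal, then the arcs whose reversal, but not themselves, are reached from \<open>a\<close> form a scopo;
  if it does, the unreached arcs form a scopo.
\<close>

lemma irreducible_reach:
  assumes irr: "irreducible_diagram \<Delta>" and a: "a \<in> \<Gamma>.E" and a': "a' \<in> \<Gamma>.E"
  shows "next_arc\<^sup>*\<^sup>* a a'"
proof -
  define R where "R = {c. next_arc\<^sup>*\<^sup>* a c}"
  have step: "c \<in> R" if "b \<in> R" "next_arc b c" for b c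
    using that by (auto simp: R_def)
  have aR: "a \<in> R" by (simp add: R_def)
  have RE: "b \<in> \<Gamma>.E" if "b \<in> R" for b
    using that a unfolding R_def by (auto elim: rtranclp.cases simp: next_arc_def)
  have rvR: "\<Gamma>.rv a \<in> R"
  proof (rule ccontr)
    assume n: "\<Gamma>.rv a \<notin> R"
    define S where "S = {c \<in> \<Gamma>.E. c \<notin> R \<and> \<Gamma>.rv c \<in> R}"
    have "scopo \<Delta> S"
      unfolding scopo_def
    proof (intro conjI ballI impI subsetI)
      fix c assume c: "c \<in> S"
      then show "\<Gamma>.rv c \<notin> S" by (auto simp: S_def)
      show "card (colours \<Delta> c) = 1"
        using c step[of "\<Gamma>.rv c" c] by (auto simp: S_def next_arc_def)
    next
      fix v c b assume c: "c \<in> S" "\<Gamma>.src c = v"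
        and b: "b \<in> {b \<in> \<Gamma>.E. \<Gamma>.tgt b = v} - {\<Gamma>.rv c}"
      have "c \<in> \<Gamma>.E" "b \<in> \<Gamma>.E" "b \<noteq> \<Gamma>.rv c" using b c by (auto simp: S_def)
      moreover from this have "c \<noteq> \<Gamma>.rv b" by auto
      \<comment> \<open>The first relation carries reachability from \<open>\<Gamma>.rv c\<close> to
        \<open>\<Gamma>.rv b\<close>; by the second, reaching \<open>b\<close> would mean reaching
        \<open>c\<close>, so \<open>b\<close> is unreached.\<close>
      ultimately have "next_arc (\<Gamma>.rv c) (\<Gamma>.rv b)" "next_arc b c"
        using b c by (simp_all add: next_arc_def)
      then show "b \<in> S" using b c step by (auto simp: S_def)
    qed (auto simp: S_def)
    then have "S = {}" using irr by (simp add: irreducible_diagram_def)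
    moreover have "\<Gamma>.rv a \<in> S" using n a aR by (simp add: S_def)
    ultimately show False by simp
  qed
  define C where "C = \<Gamma>.E - R"
  \<comment> \<open>Once this is known, every unreached arc starts where some reached arc ends, so
    it can only be the reversal of that arc and has a single colour.\<close>
  have surj: "\<Gamma>.tgt ` R = \<Gamma>.V"
  proof (rule \<Gamma>.connected_closed[OF connected_\<Gamma>])
    fix d assume d: "d \<in> \<Gamma>.E" "\<Gamma>.src d \<in> \<Gamma>.tgt ` R"
    then obtain b where b: "b \<in> R" "\<Gamma>.src d = \<Gamma>.tgt b" by auto
    show "\<Gamma>.tgt d \<in> \<Gamma>.tgt ` R"
    proof (cases "d \<in> R")
      case False
      \<comment> \<open>If \<open>b\<close> is \<open>a\<close> itself, then \<open>d\<close> is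
        \<open>\<Gamma>.rv a\<close>, already reached. Otherwise the arc \<open>b'\<close> preceding
        \<open>b\<close> on the chain is reached and ends where \<open>d\<close> does.\<close>
      then have db: "d = \<Gamma>.rv b" using step[OF b(1), of d] b d RE[of b] by (auto simp: next_arc_def)
      from b(1) have "next_arc\<^sup>*\<^sup>* a b" by (simp add: R_def)
      then show ?thesis
      proof (cases rule: rtranclp.cases)
        case rtrancl_refl
        then show ?thesis using db rvR a by (metis image_eqI)
      next
        case (rtrancl_into_rtrancl b')
        then have "\<Gamma>.tgt d = \<Gamma>.tgt b'" using db by (simp add: next_arc_def)
        then show ?thesis using rtrancl_into_rtrancl by (simp add: R_def)
      qed
    qed auto
  qed (use aR RE in auto)
  have C: "\<exists>b\<in>R. c = \<Gamma>.rv b \<and> card (colours \<Delta> c) = 1" if "c \<in> C" for c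
  proof -
    have "\<Gamma>.src c \<in> \<Gamma>.tgt ` R" using that surj by (simp add: C_def)
    then obtain b where "b \<in> R" "\<Gamma>.src c = \<Gamma>.tgt b" by auto
    then show ?thesis using step[of b c] RE[of b] that by (auto simp: C_def next_arc_def)
  qed
  have "scopo \<Delta> C"
    unfolding scopo_def
  proof (intro conjI ballI impI subsetI)
    fix c assume c: "c \<in> C"
    then show "\<Gamma>.rv c \<notin> C" "card (colours \<Delta> c) = 1" using C[of c] RE by (auto simp: C_def)
  next
    fix v c b assume c: "c \<in> C" "\<Gamma>.src c = v"
      and b: "b \<in> {b \<in> \<Gamma>.E. \<Gamma>.tgt b = v} - {\<Gamma>.rv c}"
    then have "c \<in> \<Gamma>.E" "b \<in> \<Gamma>.E" "b \<noteq> \<Gamma>.rv c" by (auto simp: C_def)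
    moreover from this have "c \<noteq> \<Gamma>.rv b" by auto
    ultimately have "next_arc b c" using b c by (simp add: next_arc_def)
    then show "b \<in> C" using b c step by (auto simp: C_def)
  qed (auto simp: C_def)
  then have "C = {}" using irr by (simp add: irreducible_diagram_def)
  then show ?thesis using a' by (auto simp: C_def R_def)
qed

text \<open>Either \<open>a\<close> differs from the reversal of \<open>\<pi>A b\<close>, or it has
  a colour other than \<open>L (rv b)\<close>; in both cases some arc over \<open>a\<close> at
  \<open>tgt b\<close> is not \<open>rv b\<close>.\<close>

lemma lift_next_arc:
  assumes "b \<in> E" "next_arc (\<pi>A b) a"
  obtains c where "c \<in> E" "\<pi>A c = a" "src c = tgt b" "c \<noteq> rv b"
proof -
  have a: "a \<in> \<Gamma>.E" "\<Gamma>.src a = \<pi>V (tgt b)" "a \<noteq> \<Gamma>.rv (\<pi>A b) \<or> card (colours \<Delta> a) \<noteq> 1"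
    using assms by (auto simp: next_arc_def)
  have "\<exists>y\<in>colours \<Delta> a. a \<noteq> \<Gamma>.rv (\<pi>A b) \<or> y \<noteq> L (rv b)"
  proof (rule ccontr)
    assume "\<not> ?thesis"
    then have n: "y = L (rv b)" "a = \<Gamma>.rv (\<pi>A b)" if "y \<in> colours \<Delta> a" for y
      using that by auto
    obtain y where y: "y \<in> colours \<Delta> a" using colours_nonempty a(1) by blast
    have "colours \<Delta> a = {L (rv b)}" using n(1) y by auto
    moreover have "a = \<Gamma>.rv (\<pi>A b)" using n(2) y .
    ultimately show False using a(3) by simp
  qed
  then obtain y where y: "y \<in> colours \<Delta> a" "a \<noteq> \<Gamma>.rv (\<pi>A b) \<or> y \<noteq> L (rv b)" by auto
  obtain c where c: "c \<in> E" "src c = tgt b" "\<pi>A c = a" "L c = y"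
    using L_ex[OF _ a(1,2) y(1)] assms by auto
  then have "c \<noteq> rv b" using y assms by auto
  then show thesis using c that by blast
qed

lemma lift_reach:
  assumes "next_arc\<^sup>*\<^sup>* (\<pi>A b) a" "b \<in> E"
  obtains c where "c \<in> E" "\<pi>A c = a" "half c \<subseteq> half b"
proof -
  have "\<exists>c. c \<in> E \<and> \<pi>A c = a \<and> half c \<subseteq> half b"
    using assms(1)
  proof (induction rule: rtranclp_induct)
    case base
    then show ?case using assms by auto
  next
    case (step a a')
    then obtain c where c: "c \<in> E" "\<pi>A c = a" "half c \<subseteq> half b" by auto
    obtain d where "d \<in> E" "\<pi>A d = a'" "src d = tgt c" "d \<noteq> rv c"
      using lift_next_arc[of c a'] c step by auto
    then show ?case using half_succ[of c d] c by (intro exI[of _ d]) auto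
  qed
  then show thesis using that by blast
qed

lemma irreducible_half:
  assumes "irreducible_diagram \<Delta>" "b \<in> E" "c \<in> E"
  obtains g where "g \<in> U" "half (arc_map T g c) \<subseteq> half b"
proof -
  have "next_arc\<^sup>*\<^sup>* (\<pi>A b) (\<pi>A c)" using assms irreducible_reach by auto
  then obtain d where d: "d \<in> E" "\<pi>A d = \<pi>A c" "half d \<subseteq> half b" using lift_reach assms(2) by blast
  obtain g where "g \<in> U" "arc_map T g c = d" using arc_transitive[of c d] d assms by auto
  then show thesis using d that by blast
qed

lemma U_image_verts:
  assumes "\<And>g x. g \<in> U \<Longrightarrow> x \<in> W \<Longrightarrow> g x \<in> W" "W \<subseteq> V" "g \<in> U" shows "g ` W = W"
proof (intro equalityI subsetI)
  fix x assume "x \<in> W"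
  then have "x = g (U.pinv g x)" "U.pinv g x \<in> W" using assms U.app_pinv[of g x] by auto
  then show "x \<in> g ` W" by (rule image_eqI)
qed (use assms in auto)

lemma U_image_arcs:
  assumes "\<And>g b. g \<in> U \<Longrightarrow> b \<in> B \<Longrightarrow> arc_map T g b \<in> B" "B \<subseteq> E" "g \<in> U"
  shows "arc_map T g ` B = B"
proof (intro equalityI subsetI)
  fix b assume "b \<in> B"
  then have "b = arc_map T g (arc_map T (U.pinv g) b)" "arc_map T (U.pinv g) b \<in> B"
    using assms arc_map_pinv(2)[of g b] by auto
  then show "b \<in> arc_map T g ` B" by (rule image_eqI)
qed (use assms in auto)

lemma rays_U:
  assumes "g \<in> U" "r \<in> rays T" shows "g \<circ> r \<in> rays T"
proof -
  have r: "inj r" "range r \<subseteq> V" "\<And>n. \<exists>a\<in>E. src a = r n \<and> tgt a = r (Suc n)"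
    using assms(2) by (auto simp: rays_def)
  have "inj (g \<circ> r)" using r(1,2) U_bij[OF assms(1)]
    by (intro comp_inj_on) (auto simp: bij_betw_def intro: inj_on_subset)
  moreover have "\<exists>a\<in>E. src a = (g \<circ> r) n \<and> tgt a = (g \<circ> r) (Suc n)" for n
  proof -
    obtain a where "a \<in> E" "src a = r n" "tgt a = r (Suc n)" using r(3) by blast
    then show ?thesis using assms by (intro bexI[of _ "arc_map T g a"]) auto
  qed
  moreover have "range (g \<circ> r) \<subseteq> V" using r(2) assms(1) U_vert by auto
  ultimately show ?thesis by (simp add: rays_def)
qed

lemma irreducible_imp_dense:
  assumes irr: "irreducible_diagram \<Delta>"
  shows "geometrically_dense T U"
  unfolding geometrically_dense_def
proof (intro conjI allI impI)
  fix W B assume "subtree T W B \<and> (\<forall>g\<in>U. g ` W = W \<and> arc_map T g ` B = B)"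
  then have sub: "subtree T W B" and inv: "\<And>g. g \<in> U \<Longrightarrow> g ` W = W" by auto
  let ?T' = "T\<lparr>verts := W, arcs := B\<rparr>"
  have W: "W \<noteq> {}" "W \<subseteq> V" "B \<subseteq> E" "is_graph ?T'" "connected_graph ?T'"
    using sub by (auto simp: subtree_def)
  note tgt' = terminus_subgraph
  \<comment> \<open>If an arc \<open>c\<close> at a vertex of \<open>W\<close> were missing from
    \<open>B\<close>, all of \<open>W\<close> would lie outside \<open>half c\<close>. But the
    half-tree behind \<open>c\<close> has a translate inside \<open>half c\<close>, and that
    translate contains \<open>g (src c)\<close>, a vertex of \<open>W\<close>.\<close>
  have full: "c \<in> B" if c: "c \<in> E" "src c \<in> W" for c
  proof (rule ccontr)
    assume cB: "c \<notin> B"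
    have stay: "walk ?T' u p w \<Longrightarrow> u \<notin> half c \<Longrightarrow> w \<notin> half c" for u p w
    proof (induction p arbitrary: u)
      case (Cons d p)
      then have "d \<in> B" "tgt d \<notin> half c"
        using half_enter[of c d] c cB W(3) tgt' by auto
      then show ?case using Cons tgt' by auto
    qed auto
    obtain g where g: "g \<in> U" "half (arc_map T g (rv c)) \<subseteq> half c"
      using irreducible_half[OF irr, of c "rv c"] c by auto
    have "tgt (arc_map T g (rv c)) \<in> half c" using g c tgt_in_half[of "arc_map T g (rv c)"] by auto
    then have "g (src c) \<in> half c" using g c U_tgt[of g "rv c"] by simp
    moreover have "g (src c) \<in> W" using inv[OF g(1)] c by blast
    then obtain p where "walk ?T' (src c) p (g (src c))"
      using W(5) c unfolding connected_graph_def by auto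
    then have "g (src c) \<notin> half c" using stay c by simp
    ultimately show False by simp
  qed
  have "W = V"
  proof (rule connected_closed[OF connected])
    fix b assume "b \<in> E" "src b \<in> W"
    then have "b \<in> B" by (rule full)
    then have "rv b \<in> B" using W(4) by (simp add: is_graph_def)
    then have "src (rv b) \<in> W" using W(4) by (simp add: is_graph_def del: src_rv)
    then show "tgt b \<in> W" by simp
  qed (use W in auto)
  then show "W = V" "B = E" using W full by auto
next
  show "\<not> (\<exists>e\<in>ends T. \<forall>g\<in>U. (\<lambda>r. g \<circ> r) ` e = e)"
  proof (intro notI, elim bexE)
    fix e assume e: "e \<in> ends T" and fixed: "\<forall>g\<in>U. (\<lambda>r. g \<circ> r) ` e = e"
    then obtain r where r: "r \<in> rays T" "e = ray_equiv T `` {r}"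
      by (auto simp: ends_def elim: quotientE)
    have inj: "inj r" using r(1) by (simp add: rays_def)
    have "r \<in> e" using r range_inj_infinite[OF inj] by (auto simp: ray_equiv_def)
    obtain b where b: "b \<in> E" "src b = r 0" "tgt b = r 1"
      using r(1) unfolding rays_def by fastforce
    \<comment> \<open>\<open>half b\<close> contains the ray from its second vertex on. Moving it
      into the opposite half-tree leaves the ray and its image no common vertices except possibly
      their two starting points.\<close>
    obtain g where g: "g \<in> U" "half (arc_map T g b) \<subseteq> half (rv b)"
      using irreducible_half[OF irr, of "rv b" b] b by auto
    have "g \<circ> r \<in> e" using fixed g(1) \<open>r \<in> e\<close> by blast
    then have "infinite (range r \<inter> range (g \<circ> r))" using r by (simp add: ray_equiv_def)
    moreover have "range r \<inter> range (g \<circ> r) \<subseteq> {r 0, g (r 0)}"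
    proof
      fix y assume y': "y \<in> range r \<inter> range (g \<circ> r)"
      obtain n where n: "y = r n" using y' by blast
      obtain m where "y = (g \<circ> r) m" using y' by blast
      with n have y: "y = r n" "y = g (r m)" by simp_all
      show "y \<in> {r 0, g (r 0)}"
      proof (rule ccontr)
        assume "y \<notin> {r 0, g (r 0)}"
        then obtain n' m' where "n = Suc n'" "m = Suc m'" using y by (cases n; cases m) auto
        then have h: "y \<in> half b" "r m \<in> half b" using ray_half[OF r(1) b] y by auto
        then have "y \<in> half (arc_map T g b)" using half_U[OF g(1) b(1), of "r m"] half_verts y by auto
        then show False using g(2) h(1) half_rv[OF b(1), of y] half_verts by blast
      qed
    qed
    ultimately show False using finite_subset by blast
  qed
qed

section \<open>From geometric density to irreducibility\<close>

lemma scopo_pred: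
  assumes "scopo \<Delta> S" "a \<in> S" "b \<in> \<Gamma>.E" "\<Gamma>.tgt b = \<Gamma>.src a" "b \<noteq> \<Gamma>.rv a"
  shows "b \<in> S"
proof -
  have "\<Gamma>.src a \<in> \<Gamma>.V" using assms by (auto simp: scopo_def)
  then show ?thesis using assms unfolding scopo_def by blast
qed

text \<open>The lift \<open>Q\<close> of a nonempty scopo has at most one arc leaving each vertex,
  and every other edge at such a vertex points into it. The vertices that no arc of \<open>Q\<close>
  leaves form an invariant proper subtree; if there are none, following \<open>Q\<close> from any
  vertex leads to one common end, which \<open>U\<close> fixes.\<close>

lemma dense_imp_irreducible:
  assumes dense: "geometrically_dense T U"
  shows "irreducible_diagram \<Delta>"
  unfolding irreducible_diagram_def
proof (intro allI iffI)
  fix S :: "'a set" assume "S = {}"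
  then show "scopo \<Delta> S" by (auto simp: scopo_def)
next
  fix S assume S: "scopo \<Delta> S"
  show "S = {}"
  proof (rule ccontr)
    assume ne: "S \<noteq> {}"
    define Q where "Q = {b \<in> E. \<pi>A b \<in> S}"
    have QE: "b \<in> E" if "b \<in> Q" for b using that by (simp add: Q_def)
    have Q_rv: "rv b \<notin> Q" if "b \<in> Q" for b
      using that S by (auto simp: Q_def scopo_def)
    have Q_pred: "d \<in> Q" if b: "b \<in> Q" and d: "d \<in> E" "tgt d = src b" "d \<noteq> rv b" for b d
    proof -
      \<comment> \<open>Arcs of a scopo have one colour, so there is only one arc over
        \<open>\<pi>A b\<close> at \<open>src b\<close>. An arc \<open>d\<close> over the reversal
        would thus be \<open>rv b\<close>.\<close>
      have "\<pi>A d \<noteq> \<Gamma>.rv (\<pi>A b)"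
      proof
        assume eq: "\<pi>A d = \<Gamma>.rv (\<pi>A b)"
        have "card (colours \<Delta> (\<pi>A b)) = 1" using S b by (auto simp: Q_def scopo_def)
        then obtain y where "colours \<Delta> (\<pi>A b) = {y}" by (auto simp: card_1_singleton_iff)
        moreover have "\<pi>A (rv d) = \<pi>A b" using eq d QE[OF b] by simp
        ultimately have "L (rv d) = L b" using L_colour[of "rv d"] L_colour[of b] d QE[OF b] by auto
        then have "rv d = b" using d QE[OF b] by (intro L_inj) auto
        then show False using d by auto
      qed
      moreover have "\<Gamma>.tgt (\<pi>A d) = \<Gamma>.src (\<pi>A b)" using d QE[OF b] by simp
      moreover have "\<pi>A b \<in> S" using b by (simp add: Q_def)
      ultimately have "\<pi>A d \<in> S" using scopo_pred[OF S] \<pi>A_arc[OF d(1)] by blast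
      then show ?thesis using d by (simp add: Q_def)
    qed
    have Q_U: "arc_map T g b \<in> Q" if "g \<in> U" "b \<in> Q" for g b
      using that by (auto simp: Q_def)
    have Q_unique: "b = b'" if "b \<in> Q" "b' \<in> Q" "src b = src b'" for b b'
    proof (rule ccontr)
      assume "b \<noteq> b'"
      then have "rv b' \<noteq> rv b" using that QE by (metis rv_rv)
      then have "rv b' \<in> Q" using Q_pred[OF that(1), of "rv b'"] QE[OF that(2)] that(3) by simp
      then show False using Q_rv that by blast
    qed
    obtain a where "a \<in> S" using ne by auto
    moreover from this have "a \<in> \<Gamma>.E" using S by (auto simp: scopo_def)
    ultimately obtain b0 where "b0 \<in> E" "\<pi>A b0 \<in> S" using \<pi>A_surj by blast
    then have b0: "b0 \<in> Q" by (simp add: Q_def)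
    define W where "W = {x \<in> V. \<forall>b\<in>Q. src b \<noteq> x}"
    define B where "B = {b \<in> E. src b \<in> W \<and> tgt b \<in> W}"
    show False
    proof (cases "W = {}")
      case False
      let ?T' = "T\<lparr>verts := W, arcs := B\<rparr>"
      \<comment> \<open>A reduced walk that runs once against an arc of \<open>Q\<close> does so
        from then on, hence cannot end in \<open>W\<close>. This keeps paths between vertices of
        \<open>W\<close> inside \<open>W\<close>.\<close>
      have aux: "y \<notin> W" if "walk T x (d # q) y" "reduced (d # q)" "rv d \<in> Q" for x d q y
        using that
      proof (induction q arbitrary: x d)
        case Nil
        then have "src (rv d) = y" by simp
        then show ?case using Nil.prems(3) unfolding W_def by blast
      next
        case (Cons d' q)
        then have d: "d \<in> E" "d' \<in> E" "src d' = tgt d" "d' \<noteq> rv d" by simp_all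
        then have "rv d' \<noteq> d" by auto
        then have "rv d' \<in> Q" using Q_pred[OF Cons.prems(3), of "rv d'"] d by simp
        then show ?case using Cons.IH[of "tgt d" d'] Cons.prems(1,2) d by simp
      qed
      have walk': "walk ?T' x p y" if "walk T x p y" "reduced p" "x \<in> W" "y \<in> W" for x p y
        using that
      proof (induction p arbitrary: x)
        case (Cons d q)
        then have d: "d \<in> E" "src d = x" "walk T (tgt d) q y" by auto
        have "tgt d \<in> W"
        proof (rule ccontr)
          assume "tgt d \<notin> W"
          then obtain e where e: "e \<in> Q" "src e = tgt d" using d by (auto simp: W_def)
          have "d \<notin> Q" using d Cons.prems(3) unfolding W_def by blast
          then have "d = rv e" using Q_pred[OF e(1) d(1)] e by metis
          then have "rv d \<in> Q" using e QE by simp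
          then show False using aux[OF Cons.prems(1,2)] Cons.prems(4) by simp
        qed
        then show ?case using Cons d by (auto simp: B_def reduced_Cons)
      qed auto
      have "connected_graph ?T'"
        unfolding connected_graph_def
      proof (intro ballI)
        fix x y assume "x \<in> verts ?T'" "y \<in> verts ?T'"
        then have "x \<in> W" "y \<in> W" "x \<in> V" "y \<in> V" by (auto simp: W_def)
        then show "\<exists>p. walk ?T' x p y" using walk' walk_tpath reduced_tpath by blast
      qed
      then have sub: "subtree T W B" using False
        by (auto simp: subtree_def is_graph_def B_def W_def simp flip: src_rv)
      have gW: "g x \<in> W" if "g \<in> U" "x \<in> W" for g x
      proof -
        have False if b: "b \<in> Q" "src b = g x" for b
        proof -
          have "src (arc_map T (U.pinv g) b) = x" using b \<open>g \<in> U\<close> \<open>x \<in> W\<close> QE by (simp add: W_def)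
          moreover have "arc_map T (U.pinv g) b \<in> Q" using b \<open>g \<in> U\<close> Q_U by simp
          ultimately show False using \<open>x \<in> W\<close> by (auto simp: W_def)
        qed
        then show ?thesis using that U_vert by (auto simp: W_def)
      qed
      have gB: "arc_map T g b \<in> B" if "g \<in> U" "b \<in> B" for g b
        using that gW by (auto simp: B_def)
      have "W \<subseteq> V" "B \<subseteq> E" by (auto simp: W_def B_def)
      then have "g ` W = W \<and> arc_map T g ` B = B" if "g \<in> U" for g
        using U_image_verts[of W g] U_image_arcs[of B g] gW gB that by simp
      with sub have "W = V" using dense unfolding geometrically_dense_def by meson
      then have "src b0 \<in> W" using QE[OF b0] by simp
      then show False using b0 unfolding W_def by blast
    next
      case True
      define out where "out x = (SOME b. b \<in> Q \<and> src b = x)" for x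
      have out: "out x \<in> Q" "src (out x) = x" if "x \<in> V" for x
      proof -
        have "x \<notin> W" using True by simp
        then have "\<exists>b. b \<in> Q \<and> src b = x" using that unfolding W_def by blast
        from someI_ex[OF this] show "out x \<in> Q" "src (out x) = x" by (auto simp: out_def)
      qed
      have out_eq: "out (src b) = b" if "b \<in> Q" for b
        using Q_unique[OF out(1) that out(2)] QE[OF that] by simp
      define nx where "nx x = tgt (out x)" for x
      have nx: "nx x \<in> V" if "x \<in> V" for x using QE[OF out(1)[OF that]] by (simp add: nx_def)
      define r where "r x n = (nx ^^ n) x" for x n
      have rV: "r x n \<in> V" if "x \<in> V" for x n
        unfolding r_def by (induction n) (use that nx in simp_all)
      have r_Suc: "r x (Suc n) = r (nx x) n" for x n by (simp add: r_def funpow_swap1)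
      have ray: "r x \<in> rays T" if x: "x \<in> V" for x
      proof -
        have "inj (\<lambda>n. src (out (r x n)))"
        proof (rule reduced_sequence_inj)
          fix n
          have Q: "out (r x n) \<in> Q" "out (r x (Suc n)) \<in> Q" using out(1)[OF rV[OF x]] by simp_all
          then show "out (r x n) \<in> E" using QE by simp
          show "src (out (r x (Suc n))) = tgt (out (r x n))"
            using out(2)[OF rV[OF x, of "Suc n"]] by (simp add: r_def nx_def)
          show "out (r x (Suc n)) \<noteq> rv (out (r x n))" using Q_rv[OF Q(1)] Q(2) by metis
        qed
        moreover have "(\<lambda>n. src (out (r x n))) = r x" using out(2)[OF rV[OF x]] by (simp add: fun_eq_iff)
        ultimately have "inj (r x)" by simp
        moreover have "\<exists>a\<in>E. src a = r x n \<and> tgt a = r x (Suc n)" for n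
          using out[OF rV[OF x, of n]] QE[OF out(1)[OF rV[OF x, of n]]]
          by (intro bexI[of _ "out (r x n)"]) (simp_all add: r_def nx_def)
        ultimately show ?thesis using rV[OF x] by (auto simp: rays_def)
      qed
      have range: "range (r x) = insert x (range (r (nx x)))" for x
      proof (intro equalityI subsetI)
        fix y assume "y \<in> range (r x)"
        then obtain n where "y = r x n" by auto
        then show "y \<in> insert x (range (r (nx x)))" using r_Suc by (cases n) (auto simp: r_def)
      next
        fix y assume "y \<in> insert x (range (r (nx x)))"
        moreover have "x = r x 0" by (simp add: r_def)
        ultimately show "y \<in> range (r x)" using r_Suc[of x] by (metis insertE rangeE rangeI)
      qed
      \<comment> \<open>For adjacent starting vertices one ray is the other with its first vertex
        removed, so the ranges differ by at most one vertex. Finite difference then spreads over the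
        tree by connectedness.\<close>
      have merge: "finite (range (r y) - range (r x))" if "x \<in> V" "y \<in> V" for x y
      proof -
        let ?A = "{y \<in> V. finite (range (r x) - range (r y)) \<and> finite (range (r y) - range (r x))}"
        have "?A = V"
        proof (rule connected_closed[OF connected])
          fix d assume d: "d \<in> E" "src d \<in> ?A"
          have "nx (src d) = tgt d \<or> nx (tgt d) = src d"
          proof (cases "d = out (src d)")
            case False
            then have "rv (out (src d)) \<noteq> rv d" using d out QE by (metis rv_rv src_vert)
            moreover have "src d \<in> V" using d by simp
            ultimately have "rv d \<in> Q" using Q_pred[OF out(1), of "src d" "rv d"] out(2)[of "src d"] d
              by simp
            then show ?thesis using out_eq[of "rv d"] d(1) by (simp add: nx_def)
          qed (simp add: nx_def)
          moreover have "range (r y) - range (r (nx y)) \<subseteq> {y}" "range (r (nx y)) - range (r y) = {}" for y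
            unfolding range[of y] by auto
          then have "finite (range (r y) - range (r (nx y)))" "finite (range (r (nx y)) - range (r y))" for y
            by (metis finite.emptyI finite_insert finite_subset)+
          ultimately have fin: "finite (range (r (src d)) - range (r (tgt d)))"
             "finite (range (r (tgt d)) - range (r (src d)))" by metis+
          have sub: "range (r x) - range (r (tgt d)) \<subseteq>
              (range (r x) - range (r (src d))) \<union> (range (r (src d)) - range (r (tgt d)))"
            "range (r (tgt d)) - range (r x) \<subseteq>
              (range (r (tgt d)) - range (r (src d))) \<union> (range (r (src d)) - range (r x))" by auto
          then have "finite (range (r x) - range (r (tgt d)))" "finite (range (r (tgt d)) - range (r x))"
            using finite_subset[OF sub(1)] finite_subset[OF sub(2)] fin d(2) by simp_all
          then show "tgt d \<in> ?A" using d(1) by simp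
        next
          have "x \<in> ?A" using that by simp
          then show "?A \<noteq> {}" by blast
        qed auto
        then have "y \<in> ?A" using that(2) by simp
        then show ?thesis by simp
      qed
      have nx_U: "nx (g y) = g (nx y)" if "g \<in> U" "y \<in> V" for g y
      proof -
        have o: "out y \<in> Q" "src (out y) = y" "out y \<in> E" using out[OF that(2)] QE by auto
        then have "out (g y) = arc_map T g (out y)"
          using out_eq[OF Q_U[OF that(1) o(1)]] U_src[OF that(1) o(3)] by simp
        then show ?thesis using U_tgt[OF that(1) o(3)] by (simp add: nx_def)
      qed
      have r_U: "r (g y) n = g (r y n)" if "g \<in> U" "y \<in> V" for g y n
      proof (induction n)
        case (Suc n)
        then show ?case using nx_U[OF that(1) rV[OF that(2), of n]] by (simp add: r_def)
      qed (simp add: r_def)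
      obtain x where x: "x \<in> V" using nonempty by auto
      let ?e = "ray_equiv T `` {r x}"
      \<comment> \<open>The image of \<open>s\<close> meets the \<open>Q\<close>-ray from
        \<open>g x\<close> infinitely often, and by \<open>merge\<close> that ray has all but
        finitely many vertices on the ray from \<open>x\<close>.\<close>
      have eU: "g \<circ> s \<in> ?e" if g: "g \<in> U" and s: "s \<in> ?e" for g s
      proof -
        have s': "s \<in> rays T" "infinite (range (r x) \<inter> range s)" using s by (auto simp: ray_equiv_def)
        then have sV: "range s \<subseteq> V" by (simp add: rays_def)
        have "inj_on g (range (r x) \<inter> range s)"
          using U_bij[OF g] sV by (meson bij_betw_def inf.coboundedI2 inj_on_subset)
        then have "infinite (g ` (range (r x) \<inter> range s))" using s'(2) finite_imageD by blast
        moreover have "g ` (range (r x) \<inter> range s) \<subseteq> range (r (g x)) \<inter> range (g \<circ> s)"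
          using r_U[OF g x, symmetric] by auto
        ultimately have "infinite (range (r (g x)) \<inter> range (g \<circ> s))" using finite_subset by blast
        moreover have "range (r (g x)) \<inter> range (g \<circ> s) \<subseteq>
            (range (r x) \<inter> range (g \<circ> s)) \<union> (range (r (g x)) - range (r x))" by auto
        ultimately have "infinite (range (r x) \<inter> range (g \<circ> s))"
          using merge[OF x U_vert[OF g x]] by (metis finite_Un finite_subset)
        then show ?thesis using ray[OF x] rays_U[OF g s'(1)] by (simp add: ray_equiv_def)
      qed
      have "(\<lambda>s. g \<circ> s) ` ?e = ?e" if g: "g \<in> U" for g
      proof (intro equalityI subsetI)
        fix s assume s: "s \<in> ?e"
        then have "range s \<subseteq> V" by (simp add: ray_equiv_def rays_def)
        then have "s n \<in> V" for n by blast
        then have "s = g \<circ> (U.pinv g \<circ> s)" using g by (simp add: fun_eq_iff)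
        moreover have "U.pinv g \<circ> s \<in> ?e" using eU[OF _ s] g by simp
        ultimately show "s \<in> (\<lambda>s. g \<circ> s) ` ?e" by (rule image_eqI)
      qed (use eU[OF g] in auto)
      moreover have "?e \<in> ends T" unfolding ends_def using ray[OF x] by (rule quotientI)
      ultimately show False using dense unfolding geometrically_dense_def by meson
    qed
  qed
qed

end

section \<open>Compact stabilisers and blocks\<close>

context perm_subgroup
begin

text \<open>Cosets are needed because local compactness asks for a compact neighbourhood of every
  element. For \<open>h\<close> in the coset, both \<open>pinv g\<close> after \<open>h\<close> and
  \<open>pinv h\<close> after \<open>g\<close> fix \<open>S\<close> pointwise, which reduces images
  and preimages to orbits of the fixator.\<close>

lemma compactin_coset:
  assumes clo: "closedin (perm_topology \<Omega>) H" and S: "S \<subseteq> \<Omega>" and g: "g \<in> H"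
    and fin: "\<And>y. y \<in> \<Omega> \<Longrightarrow> finite {h y | h. h \<in> H \<and> (\<forall>x\<in>S. h x = x)}"
  shows "compactin (perm_topology \<Omega>) {h \<in> H. \<forall>x\<in>S. h x = g x}"
proof (rule compactin_perm_topology)
  have SV: "x \<in> \<Omega>" if "x \<in> S" for x using S that by blast
  have "k \<in> {h \<in> H. \<forall>x\<in>S. h x = g x}"
    if k: "k \<in> Bij \<Omega>" and approx: "\<And>F. finite F \<Longrightarrow> F \<subseteq> \<Omega> \<Longrightarrow> \<exists>h\<in>{h \<in> H. \<forall>x\<in>S. h x = g x}. \<forall>x\<in>F. h x = k x" for k
  proof -
    have "\<exists>h\<in>H. \<forall>x\<in>F. h x = k x" if "finite F" "F \<subseteq> \<Omega>" for F using approx[OF that] by blast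
    then have "k \<in> H" using clo k unfolding closedin_perm_topology by simp
    moreover have "k x = g x" if x: "x \<in> S" for x
    proof -
      obtain h where "\<forall>x\<in>S. h x = g x" "h x = k x" using approx[of "{x}"] SV[OF x] by auto
      then show ?thesis using x by simp
    qed
    ultimately show ?thesis by simp
  qed
  then show "closedin (perm_topology \<Omega>) {h \<in> H. \<forall>x\<in>S. h x = g x}"
    using subset_Bij unfolding closedin_perm_topology by auto
  fix y assume y: "y \<in> \<Omega>"
  have "(\<lambda>h. h y) ` {h \<in> H. \<forall>x\<in>S. h x = g x} \<subseteq> g ` {h y | h. h \<in> H \<and> (\<forall>x\<in>S. h x = x)}"
  proof safe
    fix h assume h: "h \<in> H" "\<forall>x\<in>S. h x = g x"
    let ?k = "compose \<Omega> (pinv g) h"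
    have "?k \<in> H" "\<forall>x\<in>S. ?k x = x" "h y = g (?k y)"
      using h g y SV by (simp_all add: compose_eq)
    then show "h y \<in> g ` {h y | h. h \<in> H \<and> (\<forall>x\<in>S. h x = x)}" by blast
  qed
  then show "finite ((\<lambda>h. h y) ` {h \<in> H. \<forall>x\<in>S. h x = g x})"
    using fin[OF y] finite_subset by blast
  have "(\<lambda>h. inv_into \<Omega> h y) ` {h \<in> H. \<forall>x\<in>S. h x = g x} \<subseteq>
      {h (pinv g y) | h. h \<in> H \<and> (\<forall>x\<in>S. h x = x)}"
  proof safe
    fix h assume h: "h \<in> H" "\<forall>x\<in>S. h x = g x"
    let ?k = "compose \<Omega> (pinv h) g"
    have "?k x = x" if "x \<in> S" for x
      using h g SV[OF that] that by (simp add: compose_eq pinv_eq_iff)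
    moreover have "inv_into \<Omega> h y = ?k (pinv g y)"
      using h g y by (simp add: compose_eq) (simp add: pinv_def)
    ultimately show "\<exists>k. inv_into \<Omega> h y = k (pinv g y) \<and> k \<in> H \<and> (\<forall>x\<in>S. k x = x)"
      using h g by (intro exI[of _ ?k]) simp
  qed
  then show "finite ((\<lambda>h. inv_into \<Omega> h y) ` {h \<in> H. \<forall>x\<in>S. h x = g x})"
    using fin[of "pinv g y"] y g by (simp add: finite_subset)
qed

lemma compactin_stabilizer:
  assumes "closedin (perm_topology \<Omega>) H" "S \<subseteq> \<Omega>"
    and "\<And>y. y \<in> \<Omega> \<Longrightarrow> finite {h y | h. h \<in> H \<and> (\<forall>x\<in>S. h x = x)}"
  shows "compactin (perm_topology \<Omega>) {h \<in> H. \<forall>x\<in>S. h x = x}"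
proof -
  have "{h \<in> H. \<forall>x\<in>S. h x = (\<lambda>x\<in>\<Omega>. x) x} = {h \<in> H. \<forall>x\<in>S. h x = x}"
    using assms(2) by (auto simp: subset_iff)
  then show ?thesis using compactin_coset[OF assms(1,2) id_mem assms(3)] by simp
qed

text \<open>
  Let \<open>R\<close> represent the orbits of \<open>H\<close>. If \<open>K\<close> contains the stabilisers of all points of \<open>R\<close>, then the
  translates of \<open>\<Union>r\<in>R. K r\<close> partition \<open>\<Omega>\<close> into blocks of imprimitivity meeting all orbits.
\<close>

definition same_block :: "'p set \<Rightarrow> ('p \<Rightarrow> 'p) set \<Rightarrow> 'p \<Rightarrow> 'p \<Rightarrow> bool" where
  "same_block R K x y \<longleftrightarrow> (\<exists>\<tau>\<in>H. \<exists>k\<in>K. \<exists>r\<in>R. \<exists>r'\<in>R. x = \<tau> r \<and> y = \<tau> (k r'))"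

lemma same_block_mono: "same_block R K x y \<Longrightarrow> K \<subseteq> K' \<Longrightarrow> same_block R K' x y"
  unfolding same_block_def by blast

lemma same_block_translate:
  assumes "same_block R K x y" "\<sigma> \<in> H" "K \<subseteq> H" "R \<subseteq> \<Omega>"
  shows "same_block R K (\<sigma> x) (\<sigma> y)"
proof -
  obtain \<tau> k r r' where t: "\<tau> \<in> H" "k \<in> K" "r \<in> R" "r' \<in> R" "x = \<tau> r" "y = \<tau> (k r')"
    using assms(1) unfolding same_block_def by blast
  have "k \<in> H" "r \<in> \<Omega>" "r' \<in> \<Omega>" using t assms by auto
  then have "\<sigma> x = compose \<Omega> \<sigma> \<tau> r" "\<sigma> y = compose \<Omega> \<sigma> \<tau> (k r')"
    using t by (simp_all add: compose_eq)
  then show ?thesis using t assms(2) compose_mem unfolding same_block_def by blast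
qed

end

locale block_system = perm_subgroup +
  fixes R :: "'a set" and K :: "('a \<Rightarrow> 'a) set"
  assumes K_group: "perm_subgroup \<Omega> K" and K_sub: "K \<subseteq> H" and R_sub: "R \<subseteq> \<Omega>"
    and R_cover: "\<And>x. x \<in> \<Omega> \<Longrightarrow> \<exists>g\<in>H. \<exists>r\<in>R. x = g r"
    and R_distinct: "\<And>g r r'. g \<in> H \<Longrightarrow> r \<in> R \<Longrightarrow> r' \<in> R \<Longrightarrow> g r = r' \<Longrightarrow> r = r'"
    and K_stab: "\<And>g r. g \<in> H \<Longrightarrow> r \<in> R \<Longrightarrow> g r = r \<Longrightarrow> g \<in> K"

sublocale block_system \<subseteq> K: perm_subgroup \<Omega> K
  by (rule K_group)

context block_system
begin

lemma KH [simp]: "k \<in> K \<Longrightarrow> k \<in> H" using K_sub by blast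
lemma R\<Omega> [simp]: "r \<in> R \<Longrightarrow> r \<in> \<Omega>" using R_sub by blast

lemma K_coset:
  assumes "\<tau> \<in> H" "\<rho> \<in> H" "r \<in> R" "\<tau> r = \<rho> r"
  shows "compose \<Omega> (pinv \<tau>) \<rho> \<in> K"
  using assms by (intro K_stab[of _ r]) (simp_all add: compose_eq pinv_eq_iff)

lemma same_block_refl:
  assumes "x \<in> \<Omega>" shows "same_block R K x x"
proof -
  obtain g r where "g \<in> H" "r \<in> R" "x = g r" using R_cover assms by blast
  then show ?thesis unfolding same_block_def
    by (intro bexI[of _ g] bexI[of _ "\<lambda>x\<in>\<Omega>. x"] bexI[of _ r]) simp_all
qed

lemma same_block_sym:
  assumes "same_block R K x y" shows "same_block R K y x"
proof -
  obtain \<tau> k r r' where t: "\<tau> \<in> H" "k \<in> K" "r \<in> R" "r' \<in> R" "x = \<tau> r" "y = \<tau> (k r')"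
    using assms unfolding same_block_def by blast
  then have "y = compose \<Omega> \<tau> k r'" "x = compose \<Omega> \<tau> k (K.pinv k r)"
    by (simp_all add: compose_eq)
  then show ?thesis using t compose_mem[OF t(1) KH[OF t(2)]] K.pinv_mem unfolding same_block_def by blast
qed

text \<open>The common point is written as \<open>m r'\<close> and as \<open>\<rho> s\<close>.
  Representatives of distinct orbits being inequivalent, \<open>r' = s\<close>, and then
  \<open>m\<close> and \<open>\<rho>\<close> differ by a stabiliser element, which \<open>K\<close>
  absorbs.\<close>

lemma same_block_trans:
  assumes "same_block R K x y" "same_block R K y z" shows "same_block R K x z"
proof -
  obtain \<tau> k r r' where t: "\<tau> \<in> H" "k \<in> K" "r \<in> R" "r' \<in> R" "x = \<tau> r" "y = \<tau> (k r')"
    using assms unfolding same_block_def by blast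
  obtain \<rho> l s s' where u: "\<rho> \<in> H" "l \<in> K" "s \<in> R" "s' \<in> R" "y = \<rho> s" "z = \<rho> (l s')"
    using assms unfolding same_block_def by blast
  define m where "m = compose \<Omega> \<tau> k"
  have app: "m x = \<tau> (k x)" if "x \<in> \<Omega>" for x using that by (simp add: m_def compose_eq)
  have m: "m \<in> H" "m r' = \<rho> s" using t u app by (simp_all add: m_def)
  then have "compose \<Omega> (pinv \<rho>) m r' = s" using t(4) u(1,3) by (simp add: compose_eq)
  then have "r' = s" using m(1) t(4) u(1,3) by (rule_tac R_distinct[of "compose \<Omega> (pinv \<rho>) m"]) simp_all
  then have n: "compose \<Omega> (pinv m) \<rho> \<in> K" using m t(4) u(1) by (intro K_coset) auto
  let ?n = "compose \<Omega> k (compose \<Omega> (compose \<Omega> (pinv m) \<rho>) l)"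
  have "?n \<in> K" using n t(2) u(2) by simp
  moreover have "z = \<tau> (?n s')"
  proof -
    have \<rho>l: "\<rho> (l s') \<in> \<Omega>" using u by simp
    have "?n s' = k (pinv m (\<rho> (l s')))" using u by (simp add: compose_eq)
    then have "\<tau> (?n s') = m (pinv m (\<rho> (l s')))" using app[of "pinv m (\<rho> (l s'))"] m(1) \<rho>l by simp
    also have "\<dots> = \<rho> (l s')" using m(1) \<rho>l by (rule app_pinv)
    finally show ?thesis using u(6) by simp
  qed
  ultimately show ?thesis using t(1,3,5) u(4) unfolding same_block_def by blast
qed

text \<open>This turns a statement on blocks back into one on groups: the block of a representative
  meets the orbit of that representative only in translates by \<open>K\<close>. If all of an orbit
  lies in one block, \<open>K\<close> is therefore the whole group.\<close>

lemma same_block_orbit: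
  assumes "same_block R K r (\<sigma> r)" "\<sigma> \<in> H" "r \<in> R" shows "\<sigma> \<in> K"
proof -
  obtain \<tau> k s s' where t: "\<tau> \<in> H" "k \<in> K" "s \<in> R" "s' \<in> R" "r = \<tau> s" "\<sigma> r = \<tau> (k s')"
    using assms unfolding same_block_def by blast
  have "s = r" using R_distinct[OF t(1,3) assms(3)] t(5) by metis
  then have "\<tau> \<in> K" using K_stab[OF t(1) assms(3)] t(5) by metis
  then have m: "compose \<Omega> \<tau> k \<in> K" (is "?m \<in> K") using t(2) by simp
  have ms: "?m s' = \<sigma> r" using t(4,6) by (simp add: compose_eq)
  then have "compose \<Omega> (pinv ?m) \<sigma> r = s'"
    using m t(4) assms(2,3) KH[OF m] by (simp add: compose_eq pinv_eq_iff del: KH)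
  then have "r = s'" using m t(4) assms(2,3) by (rule_tac R_distinct[of "compose \<Omega> (pinv ?m) \<sigma>"]) simp_all
  then have "compose \<Omega> (pinv ?m) \<sigma> \<in> K" using ms m assms by (intro K_coset) simp_all
  then have "compose \<Omega> ?m (compose \<Omega> (pinv ?m) \<sigma>) \<in> K" using m K.compose_mem by blast
  moreover have "compose \<Omega> ?m (compose \<Omega> (pinv ?m) \<sigma>) = \<sigma>"
    using m assms(2) by (intro ext) (simp_all add: compose_eq)
  ultimately show ?thesis by simp
qed

end

context delta_tree_setup
begin

section \<open>Consequences of compact generation and local compactness\<close>

lemma walk_U: "g \<in> U \<Longrightarrow> walk T u p v \<Longrightarrow> walk T (g u) (map (arc_map T g) p) (g v)"
  by (induction p arbitrary: u) (auto simp: U_vert)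

lemma finite_verts_of_finite_arcs:
  assumes "finite \<Gamma>.E" shows "finite_graph (lgraph \<Delta>)"
proof -
  obtain x0 where x0: "x0 \<in> V" using nonempty by auto
  \<comment> \<open>The extra vertex accounts for a graph without arcs.\<close>
  let ?S = "insert (\<pi>V x0) (\<Gamma>.src ` \<Gamma>.E)"
  have "{x \<in> V. \<pi>V x \<in> ?S} = V"
  proof (rule connected_closed[OF connected])
    fix b assume "b \<in> E"
    then have "\<pi>V (tgt b) = \<Gamma>.src (\<pi>A (rv b))" "\<pi>A (rv b) \<in> \<Gamma>.E" "tgt b \<in> V"
      using \<pi>A_arc[of "rv b"] by simp_all
    then show "tgt b \<in> {x \<in> V. \<pi>V x \<in> ?S}" by blast
  qed (use x0 in auto)
  then have S: "\<pi>V x \<in> ?S" if "x \<in> V" for x using that by blast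
  have "\<Gamma>.V \<subseteq> ?S"
  proof
    fix v assume "v \<in> \<Gamma>.V"
    then obtain x where "x \<in> V" "\<pi>V x = v" using \<pi>V_surj by blast
    then show "v \<in> ?S" using S[of x] by simp
  qed
  then have "finite \<Gamma>.V" using assms finite_subset by blast
  then show ?thesis using assms by (simp add: finite_graph_def)
qed

lemma compactly_generated_imp_finite_graph:
  assumes cg: "compactly_generated (perm_group V U) (subgroup_topology V U)"
    and dense: "geometrically_dense T U"
  shows "finite_graph (lgraph \<Delta>)"
proof -
  obtain K where K: "K \<subseteq> U" "compactin (perm_topology V) K" "generate (perm_group V U) K = U"
    using cg by (auto simp: compactly_generated_def subgroup_topology_def compactin_subtopology)
  obtain x0 where x0: "x0 \<in> V" using nonempty by auto
  \<comment> \<open>Finitely many finite paths, since the compact generating set moves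
    \<open>x0\<close> to finitely many vertices.\<close>
  define C where "C = (\<Union>y\<in>(\<lambda>k. k x0) ` K. set (tpath x0 y))"
  have "finite C" unfolding C_def using compactin_perm_finite(1)[OF K(2) x0] by blast
  have CE: "C \<subseteq> E"
    unfolding C_def using K(1) x0 U_vert walk_tpath walk_arcs by blast
  \<comment> \<open>Closing under reversal makes connectedness through arcs over \<open>A\<close>
    symmetric.\<close>
  define A where "A = \<pi>A ` C \<union> \<Gamma>.rv ` \<pi>A ` C"
  have A: "finite A" "A \<subseteq> \<Gamma>.E" "\<And>a. a \<in> A \<Longrightarrow> \<Gamma>.rv a \<in> A"
    unfolding A_def using \<open>finite C\<close> CE by auto
  define B where "B = {b \<in> E. \<pi>A b \<in> A}"
  have B_rv: "rv b \<in> B" if "b \<in> B" for b using that A(3) by (simp add: B_def)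
  have BE: "B \<subseteq> E" by (auto simp: B_def)
  have B_U: "arc_map T g b \<in> B" if "g \<in> U" "b \<in> B" for g b using that by (simp add: B_def)
  define conn where "conn x y \<longleftrightarrow> (\<exists>p. walk T x p y \<and> set p \<subseteq> B)" for x y
  have conn_sym: "conn y x" if "conn x y" for x y
  proof -
    obtain p where p: "walk T x p y" "set p \<subseteq> B" using \<open>conn x y\<close> by (auto simp: conn_def)
    have "set (map rv (rev p)) \<subseteq> B" using p(2) B_rv by auto
    then show ?thesis using walk_revwalk[OF p(1)] unfolding conn_def by blast
  qed
  have conn_trans: "conn x z" if xy: "conn x y" and yz: "conn y z" for x y z
  proof -
    obtain p q where "walk T x p y" "walk T y q z" "set p \<subseteq> B" "set q \<subseteq> B"
      using xy yz unfolding conn_def by blast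
    then have "walk T x (p @ q) z" "set (p @ q) \<subseteq> B" by (auto simp: walk_append)
    then show ?thesis unfolding conn_def by blast
  qed
  have conn_U: "conn (g x) (g y)" if "g \<in> U" "conn x y" for g x y
  proof -
    obtain p where p: "walk T x p y" "set p \<subseteq> B" using \<open>conn x y\<close> by (auto simp: conn_def)
    have "set (map (arc_map T g) p) \<subseteq> B" using p(2) B_U[OF \<open>g \<in> U\<close>] by auto
    then show ?thesis using walk_U[OF \<open>g \<in> U\<close> p(1)] unfolding conn_def by blast
  qed
  have conn_gen: "conn x0 (k x0)" if "k \<in> K" for k
  proof -
    have "set (tpath x0 (k x0)) \<subseteq> C" using that by (auto simp: C_def)
    then have "set (tpath x0 (k x0)) \<subseteq> B" using CE by (auto simp: B_def A_def)
    moreover have "k x0 \<in> V" using that K(1) U_vert x0 by blast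
    ultimately show ?thesis using walk_tpath[OF x0] unfolding conn_def by blast
  qed
  have conn_orbit: "conn x0 (g x0)" if "g \<in> U" for g
  proof -
    have "g \<in> generate (perm_group V U) K" using that K(3) by simp
    then show ?thesis using K(1)
    proof (induction rule: U.generate_perm_induct)
      case one
      have "walk T x0 [] x0" using x0 by simp
      then show ?case using x0 unfolding conn_def by (intro exI[of _ "[]"]) simp
    next
      case (incl k) then show ?case by (rule conn_gen)
    next
      case (inv k)
      then have k: "k \<in> U" using K(1) by blast
      have "conn (U.pinv k x0) (U.pinv k (k x0))"
        using conn_U[OF U.pinv_mem[OF k] conn_gen[OF inv]] .
      then show ?case using conn_sym k x0 by simp
    next
      case (mult g h)
      then have "conn (g x0) (g (h x0))" using conn_U by blast
      then show ?case using conn_trans[OF mult(3)] x0 by (simp add: compose_eq)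
    qed
  qed
  \<comment> \<open>The component of \<open>x0\<close> in the invariant forest of arcs over
    \<open>A\<close>. Since every element of \<open>U\<close> keeps \<open>x0\<close> in it, the
    component itself is invariant, and density forces it to be all of \<open>T\<close>.\<close>
  define W where "W = {x. conn x0 x}"
  define B' where "B' = {b \<in> B. src b \<in> W}"
  have x0W: "x0 \<in> W" using conn_orbit[OF U.id_mem] x0 by (simp add: W_def)
  have WV: "W \<subseteq> V" using walk_verts by (auto simp: W_def conn_def)
  have W_step: "tgt b \<in> W" if "b \<in> B'" for b
  proof -
    have b: "b \<in> B" "conn x0 (src b)" using that by (simp_all add: B'_def W_def)
    have "walk T (src b) [b] (tgt b)" using b(1) BE by auto
    then have "conn (src b) (tgt b)" using b(1) unfolding conn_def by (intro exI[of _ "[b]"]) simp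
    then show ?thesis using conn_trans[OF b(2)] by (simp add: W_def)
  qed
  let ?T' = "T\<lparr>verts := W, arcs := B'\<rparr>"
  have walk': "walk ?T' x p y" if "walk T x p y" "set p \<subseteq> B" "x \<in> W" for x p y
    using that
  proof (induction p arbitrary: x)
    case (Cons b p)
    then have "b \<in> B'" by (simp add: B'_def)
    then show ?case using Cons W_step by simp
  qed simp
  have "connected_graph ?T'"
    unfolding connected_graph_def
  proof (intro ballI)
    fix x y assume xy: "x \<in> verts ?T'" "y \<in> verts ?T'"
    then have "conn x0 x" "conn x0 y" by (simp_all add: W_def)
    then have "conn x y" using conn_sym conn_trans by blast
    then show "\<exists>p. walk ?T' x p y" using walk' xy unfolding conn_def by auto
  qed
  moreover have "is_graph ?T'"
    unfolding is_graph_def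
  proof (intro ballI conjI)
    fix b assume "b \<in> arcs ?T'"
    then have b: "b \<in> B'" by simp
    then have "b \<in> E" using BE by (auto simp: B'_def)
    then show "reversal ?T' (reversal ?T' b) = b" by simp
    show "origin ?T' b \<in> verts ?T'" using b by (simp add: B'_def)
    show "reversal ?T' b \<in> arcs ?T'" using b W_step[OF b] B_rv by (simp add: B'_def)
  qed
  ultimately have "subtree T W B'" using x0W WV BE by (auto simp: subtree_def B'_def)
  moreover have W_U: "g x \<in> W" if g: "g \<in> U" "x \<in> W" for g x
    using conn_trans[OF conn_orbit[OF g(1)] conn_U[OF g(1)]] g(2) by (simp add: W_def)
  then have "g ` W = W" if "g \<in> U" for g using U_image_verts[OF _ WV that] by simp
  moreover have "arc_map T g ` B' = B'" if "g \<in> U" for g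
  proof (rule U_image_arcs[OF _ _ that])
    show "arc_map T k b \<in> B'" if "k \<in> U" "b \<in> B'" for k b
      using that B_U W_U BE by (auto simp: B'_def)
  qed (use BE in \<open>auto simp: B'_def\<close>)
  ultimately have "B' = E" using dense unfolding geometrically_dense_def by metis
  then have "E \<subseteq> B" by (auto simp: B'_def)
  then have "\<pi>A ` E \<subseteq> A" by (auto simp: B_def)
  then have "\<Gamma>.E \<subseteq> A" by (simp only: \<pi>_images)
  then have "finite \<Gamma>.E" using A(1) finite_subset by blast
  then show ?thesis by (rule finite_verts_of_finite_arcs)
qed

lemma finite_arc_images:
  assumes "P \<subseteq> U" "b \<in> E" "finite ((\<lambda>g. g (src b)) ` P)" "finite ((\<lambda>g. g (tgt b)) ` P)"
  shows "finite ((\<lambda>g. arc_map T g b) ` P)"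
proof (rule finite_imageD)
  have "(\<lambda>c. (src c, tgt c)) ` (\<lambda>g. arc_map T g b) ` P \<subseteq> ((\<lambda>g. g (src b)) ` P) \<times> ((\<lambda>g. g (tgt b)) ` P)"
    using assms by auto
  then show "finite ((\<lambda>c. (src c, tgt c)) ` (\<lambda>g. arc_map T g b) ` P)"
    using assms(3,4) finite_subset by blast
  show "inj_on (\<lambda>c. (src c, tgt c)) ((\<lambda>g. arc_map T g b) ` P)"
  proof (rule inj_onI)
    fix c d assume "c \<in> (\<lambda>g. arc_map T g b) ` P" "d \<in> (\<lambda>g. arc_map T g b) ` P"
      "(src c, tgt c) = (src d, tgt d)"
    then show "c = d" using assms(1,2) by (intro arc_unique) auto
  qed
qed

text \<open>A walk going forward from \<open>src b\<close> for more steps than the distance to any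
  point of \<open>F\<close> leaves \<open>F\<close> behind: the half-tree looking back across its
  last arc contains \<open>F\<close>.\<close>

lemma half_containing_finite_set:
  assumes succ: "\<And>b. b \<in> E \<Longrightarrow> \<exists>c\<in>E. src c = tgt b \<and> c \<noteq> rv b" and "b \<in> E"
    and F: "finite F" "F \<subseteq> V"
  obtains c where "c \<in> E" "F \<subseteq> half c"
proof -
  let ?x = "src b"
  have long: "\<exists>p c. walk T ?x (p @ [c]) (tgt c) \<and> c \<in> E \<and> reduced (p @ [c]) \<and> length p = n" for n
  proof (induction n)
    case 0
    show ?case using assms(2) by (intro exI[of _ "[]"] exI[of _ b]) auto
  next
    case (Suc n)
    then obtain p c where pc: "walk T ?x (p @ [c]) (tgt c)" "c \<in> E" "reduced (p @ [c])" "length p = n"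
      by blast
    obtain d where d: "d \<in> E" "src d = tgt c" "d \<noteq> rv c" using succ pc by blast
    have "walk T ?x ((p @ [c]) @ [d]) (tgt d)" using pc(1) d walk_snoc[OF is_graph] by metis
    moreover have "reduced ((p @ [c]) @ [d])" using pc(3) d(3) by (subst reduced_append) simp
    ultimately show ?case using d(1) pc(4) by (intro exI[of _ "p @ [c]"] exI[of _ d]) simp
  qed
  obtain n where n: "\<And>x. x \<in> F \<Longrightarrow> length (tpath ?x x) < n"
    using finite_nat_set_iff_bounded[of "(\<lambda>x. length (tpath ?x x)) ` F"] F(1) by auto
  obtain p c where pc: "walk T ?x (p @ [c]) (tgt c)" "c \<in> E" "reduced (p @ [c])" "length p = n"
    using long by blast
  have "x \<in> half (rv c)" if x: "x \<in> F" for x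
  proof (rule ccontr)
    assume "x \<notin> half (rv c)"
    then have "x \<in> half c" using half_rv pc(2) x F(2) by blast
    then obtain q where q: "tpath (src c) x = c # q" using half_iff pc(2) by blast
    have "walk T (src c) (c # q) x" "reduced (c # q)"
      using walk_tpath[of "src c" x] reduced_tpath[of "src c" x] q pc(2) x F(2) by auto
    moreover have "walk T ?x p (src c)" "reduced p" "p \<noteq> [] \<Longrightarrow> c \<noteq> rv (last p)"
      using pc(1,3) by (auto simp: walk_snoc[OF is_graph] reduced_append)
    ultimately have "walk T ?x (p @ c # q) x" "reduced (p @ c # q)"
      by (auto simp: walk_append reduced_append simp del: walk.simps)
    then have "tpath ?x x = p @ c # q" by (rule tpath_eq)
    then show False using n[OF x] pc(4) by simp
  qed
  then show thesis using that[of "rv c"] pc(2) by auto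
qed

text \<open>The image of \<open>b\<close> reaches nothing but itself, so irreducibility makes it
  equal to its own reversal. Some element of \<open>U\<close> then inverts \<open>b\<close>, both
  ends are leaves, and the tree is a single edge. This is the case in which walks cannot be
  prolonged.\<close>

lemma arc_without_successor_imp_finite:
  assumes irr: "irreducible_diagram \<Delta>" and b: "b \<in> E"
    and no_succ: "\<And>c. c \<in> E \<Longrightarrow> src c = tgt b \<Longrightarrow> c = rv b"
  shows "finite V"
proof -
  have none: "\<not> next_arc (\<pi>A b) a" for a
    using lift_next_arc[OF b] no_succ by metis
  have "next_arc\<^sup>*\<^sup>* (\<pi>A b) (\<pi>A (rv b))" using irreducible_reach[OF irr] b by auto
  then have "\<pi>A b = \<pi>A (rv b)" using none by (meson converse_rtranclpE)
  then obtain g where g: "g \<in> U" "arc_map T g b = rv b" using arc_transitive[of b "rv b"] b by auto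
  have ends: "g (src b) = tgt b" "g (tgt b) = src b"
    using U_src[OF g(1) b] U_tgt[OF g(1) b] g(2) b by simp_all
  have "{src b, tgt b} = V"
  proof (rule connected_closed[OF connected])
    fix c assume c: "c \<in> E" "src c \<in> {src b, tgt b}"
    show "tgt c \<in> {src b, tgt b}"
    proof (cases "src c = tgt b")
      case True
      then show ?thesis using no_succ[OF c(1)] b by simp
    next
      case False
      then have "g (src c) = tgt b" using c ends by auto
      then have "arc_map T g c = rv b" using no_succ[of "arc_map T g c"] g(1) c(1) by simp
      then have "g (tgt c) = src b" using U_tgt[OF g(1) c(1)] b by simp
      then have "tgt c = tgt b" using ends g(1) b c(1) by (metis U.app_eq_iff tgt_vert)
      then show ?thesis by simp
    qed
  qed (use b in auto)
  then show ?thesis by (metis finite.emptyI finite_insert)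
qed

text \<open>
  Some compact subgroup fixes a finite set \<open>F\<close> pointwise, and \<open>F\<close> can be moved into every half-tree;
  by independence the stabiliser of an arc acts on either half-tree like a group fixing the other half.
\<close>

lemma locally_compact_imp_finite_orbits:
  assumes irr: "irreducible_diagram \<Delta>"
    and lc: "locally_compact_space (subgroup_topology V U)"
    and b: "b \<in> E" and y: "y \<in> V"
  shows "finite {u y | u. u \<in> U \<and> arc_map T u b = b}"
proof (cases "\<forall>b\<in>E. \<exists>c\<in>E. src c = tgt b \<and> c \<noteq> rv b")
  case False
  then obtain b' where "b' \<in> E" "\<And>c. c \<in> E \<Longrightarrow> src c = tgt b' \<Longrightarrow> c = rv b'" by blast
  then have "finite V" using arc_without_successor_imp_finite[OF irr] by blast
  moreover have "{u y | u. u \<in> U \<and> arc_map T u b = b} \<subseteq> V" using U_vert y by auto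
  ultimately show ?thesis using finite_subset by blast
next
  case True
  obtain F where F: "finite F" "F \<subseteq> V"
    "\<forall>y\<in>V. finite {h y | h. h \<in> U \<and> (\<forall>x\<in>F. h x = x)}"
    by (rule locally_compact_perm_stabilizer[OF lc U.subset_Bij U.id_mem])
  have "\<exists>c\<in>E. src c = tgt b \<and> c \<noteq> rv b" if "b \<in> E" for b using True that by blast
  then obtain c where c: "c \<in> E" "F \<subseteq> half c"
    by (rule half_containing_finite_set[OF _ b F(1,2)])
  \<comment> \<open>Conjugation by \<open>g\<close>, which carries \<open>F\<close> into
    \<open>half d\<close>, takes the fixator of \<open>half d\<close> into the fixator of
    \<open>F\<close>.\<close>
  have rigid: "finite {u y | u. u \<in> U \<and> (\<forall>z\<in>half d. u z = z)}" if d: "d \<in> E" and y: "y \<in> V" for d y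
  proof -
    obtain g where g: "g \<in> U" "half (arc_map T g c) \<subseteq> half d"
      by (rule irreducible_half[OF irr d c(1)])
    have gF: "g x \<in> half d" if "x \<in> F" for x
      using half_U[OF g(1) c(1)] c(2) that F(2) g(2) by blast
    have "{u y | u. u \<in> U \<and> (\<forall>z\<in>half d. u z = z)} \<subseteq>
        g ` {h (U.pinv g y) | h. h \<in> U \<and> (\<forall>x\<in>F. h x = x)}"
    proof safe
      fix u assume u: "u \<in> U" "\<forall>z\<in>half d. u z = z"
      let ?h = "compose V (U.pinv g) (compose V u g)"
      have h: "?h \<in> U" using u g by simp
      have "?h x = x" if "x \<in> F" for x
        using gF[OF that] u(2) F(2) that g(1) u(1) by (auto simp: compose_eq subset_iff)
      moreover have "u y = g (?h (U.pinv g y))"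
        using g(1) u(1) y by (simp add: compose_eq)
      ultimately show "u y \<in> g ` {h (U.pinv g y) | h. h \<in> U \<and> (\<forall>x\<in>F. h x = x)}"
        using h by blast
    qed
    moreover have "finite {h (U.pinv g y) | h. h \<in> U \<and> (\<forall>x\<in>F. h x = x)}"
      using F(3) g(1) y by simp
    ultimately show ?thesis using finite_subset by blast
  qed
  \<comment> \<open>Independence replaces \<open>u\<close> by an element with the same value at
    \<open>y\<close> that is trivial on the other half-tree.\<close>
  have side: "finite {u y | u. u \<in> U \<and> arc_map T u d = d}" if d: "d \<in> E" "y \<in> half d" for d
  proof -
    have "{u y | u. u \<in> U \<and> arc_map T u d = d} \<subseteq> {u y | u. u \<in> U \<and> (\<forall>z\<in>half (rv d). u z = z)}"
    proof safe
      fix u assume u: "u \<in> U" "arc_map T u d = d"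
      obtain k where k: "k \<in> U" "\<forall>y\<in>half d. k y = u y" "\<forall>y\<in>V. y \<notin> half d \<longrightarrow> k y = y"
        by (rule tits_independence[OF u(1) d(1) u(2)])
      have "k z = z" if "z \<in> half (rv d)" for z
        using k(3) half_rv[OF d(1), of z] half_verts[OF that] that by simp
      moreover have "u y = k y" using k(2) d(2) by simp
      ultimately show "\<exists>k. u y = k y \<and> k \<in> U \<and> (\<forall>z\<in>half (rv d). k z = z)" using k(1) by blast
    qed
    then show ?thesis using rigid[of "rv d" y] d(1) y by (simp add: finite_subset)
  qed
  show ?thesis
  proof (cases "y \<in> half b")
    case True
    then show ?thesis using side b by blast
  next
    case False
    then have "finite {u y | u. u \<in> U \<and> arc_map T u (rv b) = rv b}"
      using side[of "rv b"] half_rv b y by simp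
    moreover have "{u y | u. u \<in> U \<and> arc_map T u b = b} \<subseteq> {u y | u. u \<in> U \<and> arc_map T u (rv b) = rv b}"
      using b by auto
    ultimately show ?thesis using finite_subset by blast
  qed
qed

text \<open>A local permutation fixing the label of \<open>b\<close> extends to an element of
  \<open>U\<close> fixing \<open>b\<close>, so a suborbit of \<open>G v\<close> can be read off from
  the arcs to which an arc stabiliser moves \<open>c\<close>.\<close>

lemma finite_orbits_imp_subdegree_finite:
  assumes fin: "\<And>b y. b \<in> E \<Longrightarrow> y \<in> V \<Longrightarrow> finite {u y | u. u \<in> U \<and> arc_map T u b = b}"
    and v: "v \<in> \<Gamma>.V"
  shows "subdegree_finite (X v) (G v)"
  unfolding subdegree_finite_iff
proof (intro ballI)
  fix x y assume xy: "x \<in> X v" "y \<in> X v"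
  obtain w where w: "w \<in> V" "\<pi>V w = v" using \<pi>V_surj v by blast
  have "x \<in> L ` arcs_from T w" "y \<in> L ` arcs_from T w"
    using L_star[OF w(1)] w(2) xy by (simp_all add: bij_betw_def)
  then obtain b c where b: "b \<in> E" "src b = w" "L b = x" and c: "c \<in> E" "src c = w" "L c = y"
    by (auto simp: arcs_from_def)
  let ?P = "{u. u \<in> U \<and> arc_map T u b = b}"
  have "finite ((\<lambda>u. arc_map T u c) ` ?P)"
    using fin[OF b(1), of "src c"] fin[OF b(1), of "tgt c"] c(1)
    by (intro finite_arc_images) (auto simp: image_Collect)
  moreover have "{\<tau> y | \<tau>. \<tau> \<in> G v \<and> \<tau> x = x} \<subseteq> L ` (\<lambda>u. arc_map T u c) ` ?P"
  proof safe
    fix \<tau> assume \<tau>: "\<tau> \<in> G v" "\<tau> x = x"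
    have "\<tau> \<in> G (\<pi>V w)" using \<tau> w by simp
    then obtain u where u: "u \<in> U" "u w = w" "\<forall>b\<in>E. src b = w \<longrightarrow> L (arc_map T u b) = \<tau> (L b)"
      by (rule extension[OF w(1) w(1) refl])
    have "arc_map T u b = b" using u b \<tau> by (intro L_inj) simp_all
    moreover have "\<tau> y = L (arc_map T u c)" using u c by simp
    ultimately show "\<tau> y \<in> L ` (\<lambda>u. arc_map T u c) ` ?P" using u(1) by blast
  qed
  ultimately show "finite {\<tau> y | \<tau>. \<tau> \<in> G v \<and> \<tau> x = x}" using finite_subset by blast
qed

lemma local_stabilizer_compact:
  assumes "subdegree_finite (X v) (G v)" "v \<in> \<Gamma>.V" "x \<in> X v"
  shows "compactin (perm_topology (X v)) {\<tau> \<in> G v. \<tau> x = x}"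
proof -
  interpret perm_subgroup "X v" "G v" using assms(2) by (rule local_perm)
  have "compactin (perm_topology (X v)) {\<tau> \<in> G v. \<forall>x\<in>{x}. \<tau> x = x}"
    by (rule compactin_stabilizer) (use assms local_closed in \<open>auto simp: subdegree_finite_iff\<close>)
  then show ?thesis by simp
qed

end

section \<open>Compact generation of the local groups\<close>

context delta_tree_setup
begin

text \<open>
  Cutting every vertex of \<open>T\<close> over \<open>v\<close> into the blocks of a compactly generated subgroup \<open>K\<close> of \<open>G v\<close>
  leaves a forest that \<open>U\<close> preserves. If \<open>K\<close> is large enough, a generating set of \<open>U\<close> keeps an arc
  inside its component, so all of \<open>U\<close> does, whence the blocks are trivial and \<open>K = G v\<close>.
\<close>

lemma local_compactly_generated:
  assumes cg: "compactly_generated (perm_group V U) (subgroup_topology V U)"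
    and fin: "finite_graph (lgraph \<Delta>)"
    and sf: "subdegree_finite (X v) (G v)" and v: "v \<in> \<Gamma>.V"
  shows "compactly_generated (perm_group (X v) (G v)) (subgroup_topology (X v) (G v))"
proof (cases "arcs_from (lgraph \<Delta>) v = {}")
  \<comment> \<open>Without arcs at \<open>v\<close> there is no colour to choose as a
    representative, but then \<open>G v\<close> is trivial.\<close>
  case True
  interpret P: perm_subgroup "X v" "G v" using v by (rule local_perm)
  have "X v = {}" using True by (simp add: vcolours_def)
  then have "Bij (X v) \<subseteq> {\<lambda>_. undefined}" by (auto simp: Bij_def extensional_def)
  then have "finite (G v)" 
    using P.subset_Bij by (meson finite.emptyI finite_insert finite_subset subset_trans)
  then have "compactin (subgroup_topology (X v) (G v)) (G v)"
    using P.subset_Bij by (intro finite_imp_compactin) (auto simp: subgroup_topology_def)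
  moreover have "generate (perm_group (X v) (G v)) (G v) = G v"
    by (rule equalityI[OF P.generate_subset[OF subset_refl] subsetI[OF generate.incl]])
  ultimately show ?thesis unfolding compactly_generated_def by auto
next
  case False
  interpret P: perm_subgroup "X v" "G v" using v by (rule local_perm)
  let ?A = "arcs_from (lgraph \<Delta>) v"
  define xr where "xr a = (SOME x. x \<in> colours \<Delta> a)" for a
  have A: "a \<in> \<Gamma>.E" "\<Gamma>.src a = v" if "a \<in> ?A" for a using that by (simp_all add: arcs_from_def)
  have xr: "xr a \<in> colours \<Delta> a" if "a \<in> ?A" for a
    unfolding xr_def using colours_nonempty[OF A(1)[OF that]] by (rule some_in_eq[THEN iffD2])
  define R where "R = xr ` ?A"
  have RX: "R \<subseteq> X v" using xr A by (auto simp: R_def vcolours_def)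
  \<comment> \<open>A block system requires these stabilisers in the subgroup. As they are compact
    and finite in number, only a finite set \<open>S\<close> of further generators has to be
    found.\<close>
  define St where "St = (\<Union>r\<in>R. {\<tau> \<in> G v. \<tau> r = r})"
  have "finite ?A" using fin by (auto simp: finite_graph_def arcs_from_def)
  then have St: "compactin (perm_topology (X v)) St" "St \<subseteq> G v"
    unfolding St_def R_def using local_stabilizer_compact[OF sf v] RX[unfolded R_def]
    by (auto intro!: compactin_Union)
  define KK where "KK S = generate (perm_group (X v) (G v)) (St \<union> S)" for S
  have KK_mono: "KK S \<subseteq> KK S'" if "S \<subseteq> S'" for S S'
    unfolding KK_def using that by (intro group.mono_generate[OF P.group_perm_group]) auto
  have bs: "block_system (X v) (G v) R (KK S)" if "S \<subseteq> G v" for S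
  proof (intro block_system.intro block_system_axioms.intro)
    show "perm_subgroup (X v) (KK S)" unfolding KK_def using St(2) that by (intro P.subgroup_generate) auto
    show "KK S \<subseteq> G v" unfolding KK_def using St(2) that by (intro P.generate_subset) auto
    show "\<exists>g\<in>G v. \<exists>r\<in>R. x = g r" if "x \<in> X v" for x
    proof -
      obtain a where a: "a \<in> ?A" "x \<in> colours \<Delta> a" using \<open>x \<in> X v\<close> by (auto simp: vcolours_def)
      then obtain \<tau> where "\<tau> \<in> G v" "\<tau> (xr a) = x" using local_transitive[of a "xr a" x] A xr by auto
      then show ?thesis using a(1) unfolding R_def by blast
    qed
    show "r = r'" if g: "g \<in> G v" "r \<in> R" "r' \<in> R" "g r = r'" for g r r'
    proof -
      obtain a a' where a: "a \<in> ?A" "a' \<in> ?A" "r = xr a" "r' = xr a'" using g unfolding R_def by blast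
      then have "r' \<in> colours \<Delta> a" using local_colour[of a g r] A xr g by auto
      then show ?thesis using colours_disjoint[of a a' r'] a A xr by auto
    qed
    show "g \<in> KK S" if "g \<in> G v" "r \<in> R" "g r = r" for g r
      unfolding KK_def using that by (intro generate.incl) (auto simp: St_def)
  qed (rule P.perm_subgroup_axioms, rule RX)
  define sb where "sb S = P.same_block R (KK S)" for S
  \<comment> \<open>Links between arcs of one piece of the cut tree: across an edge, and around a
    vertex, where over \<open>v\<close> the labels must lie in the same block.\<close>
  define step where "step S d d' \<longleftrightarrow> d \<in> E \<and> d' \<in> E \<and>
    (d' = rv d \<or> src d = src d' \<and> (\<pi>V (src d) = v \<longrightarrow> sb S (L d) (L d')))" for S d d'
  have step_mono: "step S' d d'" if "step S d d'" "S \<subseteq> S'" for S S' d d'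
    using that P.same_block_mono[OF _ KK_mono[OF that(2)]] unfolding step_def sb_def by blast
  have reach_mono: "(step S')\<^sup>*\<^sup>* d d'" if "(step S)\<^sup>*\<^sup>* d d'" "S \<subseteq> S'" for S S' d d'
    using that(1) by (rule rtranclp_mono[THEN predicate2D, rotated]) (use step_mono that(2) in blast)
  have step_U: "step S (arc_map T g d) (arc_map T g d')" if S: "S \<subseteq> G v" and "g \<in> U" "step S d d'" for S g d d'
  proof -
    interpret B: block_system "X v" "G v" R "KK S" using S by (rule bs)
    have d: "d \<in> E" "d' \<in> E" using that by (auto simp: step_def)
    have "sb S (L (arc_map T g d)) (L (arc_map T g d'))"
      if "src d = src d'" "\<pi>V (src d) = v" "sb S (L d) (L d')"
    proof -
      have "loc g (src d) \<in> G v" using loc_mem[OF \<open>g \<in> U\<close>, of "src d"] d that by simp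
      then have "sb S (loc g (src d) (L d)) (loc g (src d) (L d'))"
        unfolding sb_def by (rule P.same_block_translate[OF that(3)[unfolded sb_def] _ B.K_sub RX])
      then show ?thesis using loc_L[OF d(1), of g] loc_L[OF d(2), of g] that(1) by simp
    qed
    then show ?thesis using that d unfolding step_def by auto
  qed
  have reach_U: "(step S)\<^sup>*\<^sup>* (arc_map T g d) (arc_map T g d')"
    if "S \<subseteq> G v" "g \<in> U" "(step S)\<^sup>*\<^sup>* d d'" for S g d d'
    using that(3)
  proof (induction rule: rtranclp_induct)
    case (step d' d'')
    then show ?case using step_U[OF that(1,2)] by (meson rtranclp.rtrancl_into_rtrancl)
  qed simp
  have reach_sym: "(step S)\<^sup>*\<^sup>* d' d" if S: "S \<subseteq> G v" and "(step S)\<^sup>*\<^sup>* d d'" for S d d'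
  proof -
    interpret B: block_system "X v" "G v" R "KK S" using S by (rule bs)
    have "step S d' d" if "step S d d'" for d d'
      using that B.same_block_sym unfolding step_def sb_def by auto
    then have "symp (step S)" by (rule sympI)
    then have "symp (step S)\<^sup>*\<^sup>*" by (rule symp_rtranclp)
    then show ?thesis using that(2) by (rule sympD)
  qed
  obtain w where w: "w \<in> V" "\<pi>V w = v" using \<pi>V_surj v by blast
  obtain a where a: "a \<in> ?A" using False by blast
  obtain c where c: "c \<in> E" "src c = w" "\<pi>A c = a" "L c = xr a"
    using L_ex[OF w(1) A(1)[OF a] _ xr[OF a]] A(2)[OF a] w(2) by auto
  \<comment> \<open>Over \<open>v\<close> the element carrying one representative's translate to the
    other, taken relative to \<open>g\<close>, puts both labels into one block. Adding one generator
    thus links any two given arcs at a vertex, and finitely many additions link \<open>c\<close> to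
    any arc.\<close>
  have connect: "\<exists>s\<in>G v. \<forall>S. s \<in> S \<longrightarrow> S \<subseteq> G v \<longrightarrow> step S d d'"
    if d: "d \<in> E" "d' \<in> E" "src d = src d'" for d d'
  proof (cases "\<pi>V (src d) = v")
    case True
    then have LX: "L d \<in> X v" "L d' \<in> X v" using L_X[OF d(1)] L_X[OF d(2)] d(3) by simp_all
    interpret B: block_system "X v" "G v" R "KK {}" by (rule bs) simp
    obtain g r where g: "g \<in> G v" "r \<in> R" "L d = g r" using B.R_cover[OF LX(1)] by blast
    obtain h r' where h: "h \<in> G v" "r' \<in> R" "L d' = h r'" using B.R_cover[OF LX(2)] by blast
    let ?s = "compose (X v) (P.pinv g) h"
    have s: "?s \<in> G v" "L d' = g (?s r')" using g h by (simp_all add: compose_eq)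
    have "step S d d'" if "?s \<in> S" "S \<subseteq> G v" for S
    proof -
      have "?s \<in> KK S" unfolding KK_def using that(1) by (intro generate.incl) simp
      then have "sb S (L d) (L d')" unfolding sb_def P.same_block_def using g h(2) s(2) by blast
      then show ?thesis using d by (simp add: step_def)
    qed
    then show ?thesis using s(1) by blast
  next
    case False
    then have "step S d d'" for S using d by (simp add: step_def)
    then show ?thesis using P.id_mem by blast
  qed
  have reachable: "\<exists>S. finite S \<and> S \<subseteq> G v \<and> (step S)\<^sup>*\<^sup>* c d" if "d \<in> E" for d
  proof -
    let ?reach = "\<lambda>d. \<exists>S. finite S \<and> S \<subseteq> G v \<and> (step S)\<^sup>*\<^sup>* c d"
    have extend: "?reach d'" if d': "?reach d" "d \<in> E" "d' \<in> E" "src d = src d'" for d d'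
    proof -
      obtain S where S: "finite S" "S \<subseteq> G v" "(step S)\<^sup>*\<^sup>* c d" using d'(1) by blast
      obtain s where s: "s \<in> G v" "\<forall>S. s \<in> S \<longrightarrow> S \<subseteq> G v \<longrightarrow> step S d d'"
        using connect[OF d'(2-4)] by blast
      have "step (insert s S) d d'" using s S(2) by blast
      moreover have "(step (insert s S))\<^sup>*\<^sup>* c d" using S(3) by (rule reach_mono) blast
      ultimately have "(step (insert s S))\<^sup>*\<^sup>* c d'" by (meson rtranclp.rtrancl_into_rtrancl)
      then show ?thesis using S s(1) by (intro exI[of _ "insert s S"]) simp
    qed
    let ?W = "{x \<in> V. \<forall>d\<in>E. src d = x \<longrightarrow> ?reach d}"
    have "?W = V"
    proof (rule connected_closed[OF connected])
      have "?reach d" if "d \<in> E" "src d = w" for d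
      proof (rule extend[OF _ c(1) that(1)])
        show "?reach c" by (intro exI[of _ "{}"]) simp
      qed (use c that in simp)
      then show "?W \<noteq> {}" using w(1) by blast
    next
      fix b assume b: "b \<in> E" "src b \<in> ?W"
      then obtain S where S: "finite S" "S \<subseteq> G v" "(step S)\<^sup>*\<^sup>* c b" by blast
      have "step S b (rv b)" using b(1) by (simp add: step_def)
      then have "(step S)\<^sup>*\<^sup>* c (rv b)" using S(3) by (meson rtranclp.rtrancl_into_rtrancl)
      then have rb: "?reach (rv b)" using S(1,2) by blast
      have "?reach d" if "d \<in> E" "src d = tgt b" for d
        using that b(1) by (intro extend[OF rb]) simp_all
      then show "tgt b \<in> ?W" using b(1) by simp
    qed auto
    then have "src d \<in> ?W" using that by simp
    then show ?thesis using that by blast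
  qed
  obtain K where K: "K \<subseteq> U" "compactin (perm_topology V) K" "generate (perm_group V U) K = U"
    using cg by (auto simp: compactly_generated_def subgroup_topology_def compactin_subtopology)
  \<comment> \<open>The compact generating set moves \<open>c\<close> to finitely many arcs. Each is
    linked to \<open>c\<close> after finitely many additions, so their union \<open>S\<close> serves
    all generators at once.\<close>
  let ?D = "(\<lambda>k. arc_map T k c) ` K"
  have "finite ?D"
    using K(1) c(1) compactin_perm_finite(1)[OF K(2)] by (intro finite_arc_images) simp_all
  have "\<forall>d\<in>?D. \<exists>S. finite S \<and> S \<subseteq> G v \<and> (step S)\<^sup>*\<^sup>* c d"
    using reachable K(1) c(1) by (auto simp: subset_iff)
  then obtain f where f: "\<And>d. d \<in> ?D \<Longrightarrow> finite (f d) \<and> f d \<subseteq> G v \<and> (step (f d))\<^sup>*\<^sup>* c d"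
    by metis
  define S where "S = (\<Union>d\<in>?D. f d)"
  have "finite S" unfolding S_def using f by (intro finite_UN_I[OF \<open>finite ?D\<close>]) simp
  moreover have "S \<subseteq> G v" unfolding S_def using f by blast
  ultimately have S: "finite S" "S \<subseteq> G v" by simp_all
  have gens: "(step S)\<^sup>*\<^sup>* c (arc_map T k c)" if "k \<in> K" for k
    by (rule reach_mono[of "f (arc_map T k c)"]) (use f that in \<open>auto simp: S_def\<close>)
  have all: "(step S)\<^sup>*\<^sup>* c (arc_map T g c)" if "g \<in> U" for g
  proof -
    have "g \<in> generate (perm_group V U) K" using that K(3) by simp
    then show ?thesis using K(1)
    proof (induction rule: U.generate_perm_induct)
      case one
      then show ?case unfolding arc_map_id[OF c(1)] by simp
    next
      case (incl k)
      then show ?case by (rule gens)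
    next
      case (inv k)
      then have k: "k \<in> U" using K(1) by blast
      have "(step S)\<^sup>*\<^sup>* (arc_map T (U.pinv k) c) (arc_map T (U.pinv k) (arc_map T k c))"
        by (rule reach_U[OF S(2) U.pinv_mem[OF k] gens[OF inv]])
      then show ?case using reach_sym[OF S(2)] k c(1) by simp
    next
      case (mult g h)
      have "(step S)\<^sup>*\<^sup>* (arc_map T g c) (arc_map T g (arc_map T h c))"
        by (rule reach_U[OF S(2) mult(1,4)])
      then show ?case using mult c(1) by simp
    qed
  qed
  interpret B: block_system "X v" "G v" R "KK S" using S(2) by (rule bs)
  \<comment> \<open>Projection to the star of \<open>w\<close>: the arc at \<open>w\<close> through
    which \<open>d\<close> is seen. Links away from \<open>w\<close> do not change it and links at
    \<open>w\<close> stay within a block, so linked arcs at \<open>w\<close> have labels in one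
    block even if the chain leaves the star.\<close>
  define pr where "pr d = (if src d = w then d else hd (tpath w (src d)))" for d
  have pr_mem: "pr d \<in> E \<and> src (pr d) = w" if "d \<in> E" for d
  proof (cases "src d = w")
    case False
    then show ?thesis using walk_tpath[OF w(1), of "src d"] that
      by (cases "tpath w (src d)") (auto simp: pr_def)
  qed (use that in \<open>simp add: pr_def\<close>)
  have pr_L: "L (pr d) \<in> X v" if "d \<in> E" for d using pr_mem[OF that] L_X[of "pr d"] w(2) by simp
  have pr_rv: "pr (rv d) = pr d" if d: "d \<in> E" for d
  proof -
    consider "src d = w" | "tgt d = w" | "src d \<noteq> w" "tgt d \<noteq> w" by blast
    then show ?thesis
    proof cases
      case 1
      then show ?thesis using loopless[OF d] tpath_arc[OF d] by (simp add: pr_def)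
    next
      case 2
      then show ?thesis using loopless[OF d] tpath_arc[of "rv d"] d by (simp add: pr_def)
    next
      case 3
      have ne: "tpath w (src d) \<noteq> []" "tpath w (tgt d) \<noteq> []"
        using 3 walk_tpath[OF w(1), of "src d"] walk_tpath[OF w(1), of "tgt d"] d by auto
      from w(1) d have "hd (tpath w (tgt d)) = hd (tpath w (src d))"
        by (cases rule: tpath_step) (use ne in simp_all)
      then show ?thesis using 3 by (simp add: pr_def)
    qed
  qed
  have project: "sb S (L (pr d)) (L (pr d'))" if "step S d d'" for d d'
  proof -
    have d: "d \<in> E" "d' \<in> E" using that by (auto simp: step_def)
    show ?thesis
    proof (cases "d' = rv d")
      case True
      then show ?thesis using B.same_block_refl[OF pr_L[OF d(1)]] pr_rv[OF d(1)] by (simp add: sb_def)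
    next
      case False
      then have s: "src d = src d'" "\<pi>V (src d) = v \<longrightarrow> sb S (L d) (L d')"
        using that unfolding step_def by blast+
      show ?thesis
      proof (cases "src d = w")
        case True
        then show ?thesis using s w(2) by (simp add: pr_def)
      next
        case False
        then have "pr d = pr d'" using s(1) by (simp add: pr_def)
        then show ?thesis using B.same_block_refl[OF pr_L[OF d(1)]] by (simp add: sb_def)
      qed
    qed
  qed
  have project_all: "sb S (L (pr c)) (L (pr d))" if "(step S)\<^sup>*\<^sup>* c d" for d
    using that
  proof (induction rule: rtranclp_induct)
    case base
    show ?case using B.same_block_refl[OF pr_L[OF c(1)]] by (simp add: sb_def)
  next
    case (step d d')
    then show ?case using project[of d d'] B.same_block_trans unfolding sb_def by blast
  qed
  \<comment> \<open>Extending \<open>\<sigma>\<close> to an element of \<open>U\<close> that fixes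
    \<open>w\<close> links \<open>c\<close> to its image there; projected to the star, this puts
    \<open>xr a\<close> and \<open>\<sigma> (xr a)\<close> in one block.\<close>
  have "\<sigma> \<in> KK S" if \<sigma>: "\<sigma> \<in> G v" for \<sigma>
  proof -
    have "\<sigma> \<in> G (\<pi>V w)" using \<sigma> w(2) by simp
    then obtain g where g: "g \<in> U" "g w = w" "\<forall>b\<in>E. src b = w \<longrightarrow> L (arc_map T g b) = \<sigma> (L b)"
      by (rule extension[OF w(1) w(1) refl])
    have "pr c = c" "pr (arc_map T g c) = arc_map T g c" using g c by (simp_all add: pr_def)
    then have "sb S (xr a) (\<sigma> (xr a))"
      using project_all[OF all[OF g(1)]] g(3) c by simp
    moreover have "xr a \<in> R" using a by (simp add: R_def)
    ultimately show ?thesis using B.same_block_orbit \<sigma> unfolding sb_def by blast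
  qed
  then have "KK S = G v" by (intro equalityI[OF B.K_sub] subsetI)
  moreover have "compactin (perm_topology (X v)) S"
    using S P.subset_Bij by (intro finite_imp_compactin) auto
  then have "compactin (subgroup_topology (X v) (G v)) (St \<union> S)"
    using St S(2) by (simp add: subgroup_topology_def compactin_subtopology compactin_Un)
  ultimately show ?thesis
    unfolding compactly_generated_def KK_def using St(2) S(2) by (intro exI[of _ "St \<union> S"]) simp
qed

end

section \<open>Countable orbits of compactly generated groups\<close>

context perm_subgroup
begin

text \<open>The points obtained from \<open>x\<close> by at most \<open>n\<close> applications of
  elements of \<open>K\<close> or their inverses form a finite set, as \<open>K\<close> is compact,
  and these sets exhaust the orbit.\<close>

lemma compactly_generated_countable_orbit:
  assumes K: "K \<subseteq> H" "compactin (perm_topology \<Omega>) K" "generate (perm_group \<Omega> H) K = H"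
    and x: "x \<in> \<Omega>"
  shows "countable {h x | h. h \<in> H}"
proof -
  define N where "N A = A \<union> (\<Union>y\<in>A. (\<lambda>k. k y) ` K \<union> (\<lambda>k. inv_into \<Omega> k y) ` K)" for A
  define R where "R n = (N ^^ n) {x}" for n
  have KH: "k \<in> H" if "k \<in> K" for k using K(1) that by blast
  have R_fin: "finite (R n) \<and> R n \<subseteq> \<Omega>" for n
  proof (induction n)
    case (Suc n)
    have "inv_into \<Omega> k y \<in> \<Omega>" if "k \<in> K" "y \<in> \<Omega>" for k y
      using pinv_mem[OF KH[OF that(1)]] that(2) app_mem by (fastforce simp: pinv_def)
    then show ?case using Suc compactin_perm_finite[OF K(2)] KH
      by (auto simp: R_def N_def subset_iff)
  qed (use x in \<open>simp add: R_def\<close>)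
  let ?C = "\<Union>n. R n"
  have closed: "k y \<in> ?C" "pinv k y \<in> ?C" if ky: "k \<in> K" "y \<in> ?C" for k y
  proof -
    obtain n where n: "y \<in> R n" using ky by blast
    then have "k y \<in> R (Suc n)" using ky(1) by (auto simp: R_def N_def)
    then show "k y \<in> ?C" by blast
    have "y \<in> \<Omega>" using n R_fin by blast
    then have "pinv k y \<in> R (Suc n)" using n ky(1) by (auto simp: R_def N_def pinv_def)
    then show "pinv k y \<in> ?C" by blast
  qed
  have C\<Omega>: "y \<in> \<Omega>" if "y \<in> ?C" for y using that R_fin by blast
  have "\<forall>y\<in>?C. h y \<in> ?C" if "h \<in> H" for h
  proof -
    have "h \<in> generate (perm_group \<Omega> H) K" using that K(3) by simp
    then show ?thesis using K(1)
    proof (induction rule: generate_perm_induct)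
      case (mult g h)
      show ?case
      proof
        fix y assume y: "y \<in> ?C"
        have "g (h y) \<in> ?C" using bspec[OF mult(4) y] by (rule bspec[OF mult(3)])
        then show "compose \<Omega> g h y \<in> ?C" using C\<Omega>[OF y] by (simp add: compose_eq)
      qed
    qed (use closed C\<Omega> in simp_all)
  qed
  moreover have "x \<in> ?C" using UN_I[of 0 UNIV x R] by (simp add: R_def)
  ultimately have "{h x | h. h \<in> H} \<subseteq> ?C" by blast
  moreover have "countable ?C" using R_fin by (simp add: countable_finite)
  ultimately show ?thesis by (rule countable_subset)
qed

end

context delta_tree_setup
begin

section \<open>Universal groups of finite diagrams with subdegree-finite local groups\<close>

text \<open>Approximation at the two ends of an arc determines its image, so a limit of elements of
  \<open>U\<close> acts on arcs. Its local action agrees with those of the approximants on finite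
  sets of labels and lies in \<open>G\<close> by closedness of the local groups.\<close>

lemma closedin_U: "closedin (perm_topology V) U"
  unfolding closedin_perm_topology
proof (intro conjI ballI impI)
  show "U \<subseteq> Bij V" by (rule U.subset_Bij)
  fix g assume g: "g \<in> Bij V"
    and approx: "\<forall>F. finite F \<and> F \<subseteq> V \<longrightarrow> (\<exists>h\<in>U. \<forall>x\<in>F. h x = g x)"
  have gV: "g x \<in> V" if "x \<in> V" for x using g that by (auto simp: Bij_def bij_betw_def)
  have g_inj: "x = y" if "g x = g y" "x \<in> V" "y \<in> V" for x y
    using g that by (auto simp: Bij_def bij_betw_def dest: inj_onD)
  \<comment> \<open>The approximant depends on \<open>b\<close>, but the resulting arc does not
    depend on the choice, being determined by its ends; \<open>k_eq\<close> records this.\<close>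
  define k where "k b = arc_map T (SOME h. h \<in> U \<and> h (src b) = g (src b) \<and> h (tgt b) = g (tgt b)) b" for b
  have k: "k b \<in> E" "src (k b) = g (src b)" "tgt (k b) = g (tgt b)" "\<pi>A (k b) = \<pi>A b" if "b \<in> E" for b
  proof -
    have "\<exists>h. h \<in> U \<and> h (src b) = g (src b) \<and> h (tgt b) = g (tgt b)"
      using approx[rule_format, of "{src b, tgt b}"] that by auto
    from someI_ex[OF this] show "k b \<in> E" "src (k b) = g (src b)" "tgt (k b) = g (tgt b)" "\<pi>A (k b) = \<pi>A b"
      using that by (simp_all add: k_def)
  qed
  have k_eq: "arc_map T h b = k b" if "h \<in> U" "b \<in> E" "h (src b) = g (src b)" "h (tgt b) = g (tgt b)" for h b
    using that k by (intro U_arc_eqI) auto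
  have k_rv: "k (rv b) = rv (k b)" if "b \<in> E" for b
    using k[OF that] k[of "rv b"] that by (intro arc_unique) simp_all
  have g\<pi>: "\<pi>V (g x) = \<pi>V x" if "x \<in> V" for x
  proof -
    obtain h where "h \<in> U" "h x = g x" using approx[rule_format, of "{x}"] \<open>x \<in> V\<close> by auto
    then show ?thesis using U_\<pi>V[of h x] \<open>x \<in> V\<close> by simp
  qed
  have local: "\<exists>\<tau>\<in>G (\<pi>V x). \<forall>b\<in>E. src b = x \<longrightarrow> L (k b) = \<tau> (L b)" if x: "x \<in> V" for x
  proof -
    let ?X = "X (\<pi>V x)" and ?s = "inv_into (arcs_from T x) L"
    interpret P: perm_subgroup ?X "G (\<pi>V x)" using x by (intro local_perm) simp
    have s: "?s y \<in> E" "src (?s y) = x" "L (?s y) = y" if "y \<in> ?X" for y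
      using L_star[OF x] that f_inv_into_f[of y L "arcs_from T x"] inv_into_into[of y L "arcs_from T x"]
      by (auto simp: bij_betw_def arcs_from_def)
    have sL: "?s (L b) = b" if "b \<in> E" "src b = x" for b
      using s[of "L b"] L_X[of b] that by (intro L_inj) auto
    define \<tau> where "\<tau> = (\<lambda>y\<in>?X. L (k (?s y)))"
    have \<tau>L: "\<tau> (L b) = L (k b)" if "b \<in> E" "src b = x" for b
      using that sL[OF that] L_X[of b] by (simp add: \<tau>_def)
    have "bij_betw \<tau> ?X ?X"
      unfolding bij_betw_def
    proof (intro conjI equalityI subsetI)
      show "inj_on \<tau> ?X"
      proof (rule inj_onI)
        fix y z assume yz: "y \<in> ?X" "z \<in> ?X" "\<tau> y = \<tau> z"
        let ?b = "?s y" and ?c = "?s z"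
        note b = s[OF yz(1)] and c = s[OF yz(2)]
        have "k ?b = k ?c" using yz k[OF b(1)] k[OF c(1)] b c by (intro L_inj) (simp_all add: \<tau>_def)
        then have "g (tgt ?b) = g (tgt ?c)" using k(3)[OF b(1)] k(3)[OF c(1)] by simp
        then have "tgt ?b = tgt ?c" using b(1) c(1) by (rule_tac g_inj) simp_all
        then have "?b = ?c" using b c by (intro arc_unique) simp_all
        then show "y = z" using b(3) c(3) by metis
      qed
    next
      fix y assume "y \<in> \<tau> ` ?X"
      then obtain z where z: "z \<in> ?X" "y = L (k (?s z))" by (auto simp: \<tau>_def)
      then show "y \<in> ?X" using L_X[of "k (?s z)"] k s[of z] g\<pi>[OF x] by simp
    next
      fix y assume "y \<in> ?X"
      then have "y \<in> L ` arcs_from T (g x)"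
        using L_star[OF gV[OF x]] g\<pi>[OF x] by (simp add: bij_betw_def)
      then obtain c where c: "c \<in> E" "src c = g x" "L c = y" by (auto simp: arcs_from_def)
      \<comment> \<open>Surjectivity of the local action uses that \<open>g\<close> itself is a
        permutation: the far end of \<open>c\<close> has a preimage \<open>z\<close>, and one
        approximant is taken for \<open>x\<close> and \<open>z\<close> together.\<close>
      have "tgt c \<in> g ` V" using g c(1) by (simp add: Bij_def bij_betw_def)
      then obtain z where z: "z \<in> V" "tgt c = g z" by blast
      obtain h where h: "h \<in> U" "h x = g x" "h z = g z"
        using approx[rule_format, of "{x, z}"] x z(1) by auto
      let ?b = "arc_map T (U.pinv h) c"
      have b: "?b \<in> E" "src ?b = x" "tgt ?b = z"
        using h c z x U.pinv_app[OF h(1) x] U.pinv_app[OF h(1) z(1)] by simp_all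
      have "k ?b = c" using k_eq[OF h(1) b(1)] h b c by simp
      then have "\<tau> (L ?b) = y" using \<tau>L[OF b(1,2)] c(3) by simp
      moreover have "L ?b \<in> ?X" using L_X[OF b(1)] b(2) by simp
      ultimately show "y \<in> \<tau> ` ?X" by blast
    qed
    then have "\<tau> \<in> Bij ?X" by (simp add: Bij_def \<tau>_def)
    moreover have "\<exists>\<rho>\<in>G (\<pi>V x). \<forall>y\<in>F. \<rho> y = \<tau> y" if F: "finite F" "F \<subseteq> ?X" for F
    proof -
      have "finite (insert x ((\<lambda>y. tgt (?s y)) ` F))" "insert x ((\<lambda>y. tgt (?s y)) ` F) \<subseteq> V"
        using F x s by auto
      then obtain h where h: "h \<in> U" "h x = g x" "\<And>y. y \<in> F \<Longrightarrow> h (tgt (?s y)) = g (tgt (?s y))"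
        using approx[rule_format, of "insert x ((\<lambda>y. tgt (?s y)) ` F)"] by auto
      have "loc h x y = \<tau> y" if "y \<in> F" for y
      proof -
        have y: "y \<in> ?X" using F that by blast
        have "arc_map T h (?s y) = k (?s y)" using k_eq[OF h(1) s(1)[OF y]] h s(2)[OF y] that by simp
        then show ?thesis using loc_L[OF s(1)[OF y], of h] s(2,3)[OF y] y by (simp add: \<tau>_def)
      qed
      then show ?thesis using loc_mem[OF h(1) x] by blast
    qed
    ultimately have "\<tau> \<in> G (\<pi>V x)"
      using local_closed[of "\<pi>V x"] x unfolding closedin_perm_topology by simp
    then show ?thesis using \<tau>L by (intro bexI[of _ \<tau>]) simp_all
  qed
  have "restrict g V \<in> U"
    by (rule universal_group_intro(1)[where h = k]) (fact gV g\<pi> k(1) k(2) k_rv k(4) local)+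
  moreover have "restrict g V = g" using g by (simp add: Bij_def extensional_restrict)
  ultimately show "g \<in> U" by simp
qed

text \<open>Finiteness spreads outward from \<open>b\<close>. At a vertex, the orbit of a second arc
  \<open>c'\<close> is covered by finitely many translates, one for each image of \<open>c\<close>,
  of its orbit under the stabiliser of \<open>c\<close>; on labels the latter is contained in a
  suborbit of the local group.\<close>

lemma subdegree_finite_imp_finite_orbits:
  assumes sf: "\<And>v. v \<in> \<Gamma>.V \<Longrightarrow> subdegree_finite (X v) (G v)" and b: "b \<in> E" and y: "y \<in> V"
  shows "finite {u y | u. u \<in> U \<and> arc_map T u b = b}"
proof -
  let ?Ub = "{u. u \<in> U \<and> arc_map T u b = b}"
  let ?fin = "\<lambda>c. finite ((\<lambda>u. arc_map T u c) ` ?Ub)"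
  have star: "?fin c'" if c: "?fin c" "c \<in> E" "c' \<in> E" "src c = src c'" for c c'
  proof -
    let ?x = "src c" and ?M = "(\<lambda>u. arc_map T u c') ` {u. u \<in> U \<and> arc_map T u c = c}"
    have "finite ?M"
    proof (rule finite_imageD)
      have "L ` ?M \<subseteq> {\<tau> (L c') | \<tau>. \<tau> \<in> G (\<pi>V ?x) \<and> \<tau> (L c) = L c}"
      proof safe
        fix u assume u: "u \<in> U" "arc_map T u c = c"
        show "\<exists>\<tau>. L (arc_map T u c') = \<tau> (L c') \<and> \<tau> \<in> G (\<pi>V ?x) \<and> \<tau> (L c) = L c"
          using loc_L[OF c(2), of u] loc_L[OF c(3), of u] u c
          by (intro exI[of _ "loc u ?x"]) simp
      qed
      moreover have "finite {\<tau> (L c') | \<tau>. \<tau> \<in> G (\<pi>V ?x) \<and> \<tau> (L c) = L c}"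
        using sf[of "\<pi>V ?x"] L_X[OF c(2)] L_X[OF c(3)] c unfolding subdegree_finite_iff by simp
      ultimately show "finite (L ` ?M)" by (rule finite_subset)
      show "inj_on L ?M"
      proof (rule inj_onI)
        fix d e assume "d \<in> ?M" "e \<in> ?M" and Lde: "L d = L e"
        then obtain u u' where u: "u \<in> U" "arc_map T u c = c" "d = arc_map T u c'"
          "u' \<in> U" "arc_map T u' c = c" "e = arc_map T u' c'" by blast
        then have "src d = ?x" "src e = ?x" using U_src[of u c] U_src[of u' c] c by simp_all
        then show "d = e" using u c Lde by (intro L_inj) simp_all
      qed
    qed
    define f where "f d = (SOME u. u \<in> ?Ub \<and> arc_map T u c = d)" for d
    have "(\<lambda>u. arc_map T u c') ` ?Ub \<subseteq> (\<Union>d\<in>(\<lambda>u. arc_map T u c) ` ?Ub. arc_map T (f d) ` ?M)"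
    proof
      fix e assume "e \<in> (\<lambda>u. arc_map T u c') ` ?Ub"
      then obtain u where u: "u \<in> ?Ub" "e = arc_map T u c'" by blast
      let ?d = "arc_map T u c"
      have f: "f ?d \<in> ?Ub \<and> arc_map T (f ?d) c = ?d"
        unfolding f_def by (rule someI[of _ u]) (use u in simp)
      let ?w = "compose V (U.pinv (f ?d)) u"
      have "arc_map T (U.pinv (f ?d)) ?d = c" using f c(2) arc_map_pinv(1)[of "f ?d" c] by simp
      then have "?w \<in> U" "arc_map T ?w c = c" "arc_map T (f ?d) (arc_map T ?w c') = e"
        using f u c by simp_all
      then have "e \<in> arc_map T (f ?d) ` ?M" by blast
      then show "e \<in> (\<Union>d\<in>(\<lambda>u. arc_map T u c) ` ?Ub. arc_map T (f d) ` ?M)" using u(1) by blast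
    qed
    moreover have "finite (\<Union>d\<in>(\<lambda>u. arc_map T u c) ` ?Ub. arc_map T (f d) ` ?M)"
      by (rule finite_UN_I[OF c(1)]) (rule finite_imageI[OF \<open>finite ?M\<close>])
    ultimately show ?thesis by (rule finite_subset)
  qed
  let ?W = "{x \<in> V. finite ((\<lambda>u. u x) ` ?Ub) \<and> (\<forall>c\<in>E. src c = x \<longrightarrow> ?fin c)}"
  have "?W = V"
  proof (rule connected_closed[OF connected])
    have "(\<lambda>u. u (src b)) ` ?Ub \<subseteq> {src b}" using U_src[OF _ b] by force
    then have "finite ((\<lambda>u. u (src b)) ` ?Ub)" by (rule finite_subset) simp
    moreover have "(\<lambda>u. arc_map T u b) ` ?Ub \<subseteq> {b}" by auto
    then have "?fin b" by (rule finite_subset) simp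
    then have "?fin c" if "c \<in> E" "src c = src b" for c using star[OF _ b] that by simp
    ultimately have "src b \<in> ?W" using b by simp
    then show "?W \<noteq> {}" by blast
  next
    fix d assume d: "d \<in> E" "src d \<in> ?W"
    then have fd: "?fin d" by simp
    have "(\<lambda>u. u (tgt d)) ` ?Ub = tgt ` (\<lambda>u. arc_map T u d) ` ?Ub"
      unfolding image_image using U_tgt[OF _ d(1)] by (intro image_cong) auto
    then have "finite ((\<lambda>u. u (tgt d)) ` ?Ub)" using fd by simp
    moreover have "(\<lambda>u. arc_map T u (rv d)) ` ?Ub = rv ` (\<lambda>u. arc_map T u d) ` ?Ub"
      unfolding image_image using U_rv[OF _ d(1)] by (intro image_cong) auto
    then have "?fin (rv d)" using fd by simp
    then have "?fin c" if "c \<in> E" "src c = tgt d" for c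
      using star[of "rv d" c] that d(1) by simp
    ultimately show "tgt d \<in> ?W" using d(1) by simp
  qed auto
  then have "y \<in> ?W" using y by simp
  moreover have "{u y | u. u \<in> U \<and> arc_map T u b = b} = (\<lambda>u. u y) ` ?Ub" by blast
  ultimately show ?thesis by simp
qed

lemma arc_stabilizer_eq:
  "b \<in> E \<Longrightarrow> arc_stabilizer T U b = {h \<in> U. \<forall>x\<in>{src b, tgt b}. h x = x}"
  unfolding arc_stabilizer_def
proof (intro Collect_cong conj_cong refl iffI)
  fix h assume "b \<in> E" "h \<in> U" "arc_map T h b = b"
  then show "\<forall>x\<in>{src b, tgt b}. h x = x" using U_src[of h b] U_tgt[of h b] by simp
qed (auto intro: U_arc_eqI)

lemma compactin_arc_stabilizer:
  assumes sf: "\<And>v. v \<in> \<Gamma>.V \<Longrightarrow> subdegree_finite (X v) (G v)" and b: "b \<in> E"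
  shows "compactin (perm_topology V) (arc_stabilizer T U b)"
  unfolding arc_stabilizer_eq[OF b]
proof (rule U.compactin_stabilizer[OF closedin_U])
  fix y assume y: "y \<in> V"
  have "finite {u y | u. u \<in> U \<and> arc_map T u b = b}"
    by (rule subdegree_finite_imp_finite_orbits[OF sf b y])
  moreover have "{u y | u. u \<in> U \<and> arc_map T u b = b} = {h y | h. h \<in> U \<and> (\<forall>x\<in>{src b, tgt b}. h x = x)}"
    using arc_stabilizer_eq[OF b] unfolding arc_stabilizer_def by blast
  ultimately show "finite {h y | h. h \<in> U \<and> (\<forall>x\<in>{src b, tgt b}. h x = x)}" by simp
qed (use b in simp)

lemma no_arcs_verts:
  assumes "E = {}" "x \<in> V" shows "V = {x}"
  using connected_closed[OF connected, of "{x}"] assms by auto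

lemma locally_compact_U:
  assumes sf: "\<And>v. v \<in> \<Gamma>.V \<Longrightarrow> subdegree_finite (X v) (G v)"
  shows "locally_compact_space (subgroup_topology V U)"
proof -
  obtain S where S: "finite S" "S \<subseteq> V" "\<And>y. y \<in> V \<Longrightarrow> finite {h y | h. h \<in> U \<and> (\<forall>x\<in>S. h x = x)}"
  proof (cases "E = {}")
    \<comment> \<open>A tree without arcs offers no arc stabiliser; it is one vertex and the empty
      set serves as \<open>S\<close>.\<close>
    case True
    obtain x where "x \<in> V" using nonempty by blast
    then have "finite V" using no_arcs_verts[OF True] by (metis finite.emptyI finite_insert)
    moreover have "{h y | h. h \<in> U \<and> (\<forall>x\<in>{}. h x = x)} \<subseteq> V" if "y \<in> V" for y
      using U_vert that by blast
    ultimately show thesis using that[of "{}"] finite_subset by (metis (no_types, lifting) empty_subsetI finite.emptyI)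
  next
    case False
    then obtain b where b: "b \<in> E" by blast
    have "finite {h y | h. h \<in> U \<and> (\<forall>x\<in>{src b, tgt b}. h x = x)}" if "y \<in> V" for y
    proof -
      have "{u y | u. u \<in> U \<and> arc_map T u b = b} = {h y | h. h \<in> U \<and> (\<forall>x\<in>{src b, tgt b}. h x = x)}"
        using arc_stabilizer_eq[OF b] unfolding arc_stabilizer_def by blast
      then show ?thesis using subdegree_finite_imp_finite_orbits[OF sf b that] by simp
    qed
    then show thesis using that[of "{src b, tgt b}"] b by simp
  qed
  show ?thesis
    unfolding locally_compact_space_def
  proof
    fix g assume "g \<in> topspace (subgroup_topology V U)"
    then have g: "g \<in> U" by (simp add: subgroup_topology_def)
    let ?C = "{h \<in> U. \<forall>x\<in>S. h x = g x}"
    have "perm_open V {h \<in> Bij V. \<forall>x\<in>S. h x = g x}"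
      unfolding perm_open_iff using S(1,2) by (auto intro!: exI[of _ S])
    moreover have "?C = {h \<in> Bij V. \<forall>x\<in>S. h x = g x} \<inter> U" using U.subset_Bij by blast
    ultimately have "openin (subgroup_topology V U) ?C"
      unfolding subgroup_topology_def openin_subtopology openin_perm_topology by blast
    moreover have "compactin (subgroup_topology V U) ?C"
      using U.compactin_coset[OF closedin_U S(2) g S(3)] by (simp add: subgroup_topology_def compactin_subtopology)
    moreover have "g \<in> ?C" using g by simp
    ultimately show "\<exists>W K. openin (subgroup_topology V U) W \<and> compactin (subgroup_topology V U) K \<and> g \<in> W \<and> W \<subseteq> K"
      by blast
  qed
qed

text \<open>Each colour set is an orbit of a compactly generated group and so countable. Finiteness
  of the quotient graph makes every star countable, and the tree is the union of the balls around
  one vertex.\<close>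

lemma countable_tree:
  assumes fin: "finite_graph (lgraph \<Delta>)"
    and cg: "\<And>v. v \<in> \<Gamma>.V \<Longrightarrow> compactly_generated (perm_group (X v) (G v)) (subgroup_topology (X v) (G v))"
  shows "countable_graph T"
proof -
  have colours: "countable (colours \<Delta> a)" if a: "a \<in> \<Gamma>.E" for a
  proof -
    let ?v = "\<Gamma>.src a"
    have v: "?v \<in> \<Gamma>.V" using a by simp
    interpret P: perm_subgroup "X ?v" "G ?v" using v by (rule local_perm)
    obtain x where x: "x \<in> colours \<Delta> a" using colours_nonempty[OF a] by blast
    obtain K where "K \<subseteq> G ?v" "compactin (perm_topology (X ?v)) K"
        "generate (perm_group (X ?v) (G ?v)) K = G ?v"
      using cg[OF v] by (auto simp: compactly_generated_def subgroup_topology_def compactin_subtopology)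
    then show ?thesis unfolding local_orbit[OF a x]
      using colours_X[OF a x] by (rule P.compactly_generated_countable_orbit)
  qed
  have star: "countable (arcs_from T x)" if x: "x \<in> V" for x
  proof -
    have "finite (arcs_from (lgraph \<Delta>) (\<pi>V x))" using fin by (simp add: finite_graph_def arcs_from_def)
    then have "countable (X (\<pi>V x))"
      unfolding vcolours_def
      by (rule countable_UN[OF countable_finite]) (simp_all add: arcs_from_def colours)
    moreover have "inj_on L (arcs_from T x)" "L ` arcs_from T x = X (\<pi>V x)"
      using L_star[OF x] by (simp_all add: bij_betw_def)
    ultimately show ?thesis by (metis countable_image_inj_on)
  qed
  obtain x0 where x0: "x0 \<in> V" using nonempty by blast
  define N where "N A = A \<union> (\<Union>x\<in>A. tgt ` arcs_from T x)" for A
  define B where "B n = (N ^^ n) {x0}" for n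
  have B: "countable (B n) \<and> B n \<subseteq> V" for n
  proof (induction n)
    case (Suc n)
    then show ?case using star by (auto simp: B_def N_def arcs_from_def subset_iff)
  qed (use x0 in \<open>simp add: B_def\<close>)
  have "(\<Union>n. B n) = V"
  proof (rule connected_closed[OF connected])
    have "x0 \<in> B 0" by (simp add: B_def)
    then show "(\<Union>n. B n) \<noteq> {}" by blast
    fix b assume b: "b \<in> E" "src b \<in> (\<Union>n. B n)"
    then obtain n where "src b \<in> B n" by blast
    then have "tgt b \<in> B (Suc n)" using b(1) by (auto simp: B_def N_def arcs_from_def)
    then show "tgt b \<in> (\<Union>n. B n)" by blast
  qed (use B in auto)
  moreover have "countable (\<Union>n. B n)" using B by simp
  ultimately have V: "countable V" by simp
  then have "countable (\<Union>x\<in>V. arcs_from T x)" using star by simp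
  moreover have "(\<Union>x\<in>V. arcs_from T x) = E" by (auto simp: arcs_from_def)
  ultimately show ?thesis using V by (simp add: countable_graph_def)
qed

end

section \<open>Compact generation of the universal group\<close>

context delta_tree_setup
begin

text \<open>
  The local groups lift to vertex stabilisers generated by an arc stabiliser and finitely many
  elements; adding one element for each arc of \<open>\<Gamma>\<close>, moving a representative vertex to a neighbour
  of another one, gives a subgroup that is transitive on the fibres of \<open>\<pi>V\<close>.
\<close>

lemma compactly_generated_U:
  assumes fin: "finite_graph (lgraph \<Delta>)"
    and cg: "\<And>v. v \<in> \<Gamma>.V \<Longrightarrow> compactly_generated (perm_group (X v) (G v)) (subgroup_topology (X v) (G v))"
    and sf: "\<And>v. v \<in> \<Gamma>.V \<Longrightarrow> subdegree_finite (X v) (G v)"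
  shows "compactly_generated (perm_group V U) (subgroup_topology V U)"
proof (cases "E = {}")
  case True
  obtain x where x: "x \<in> V" using nonempty by blast
  have V: "V = {x}" by (rule no_arcs_verts[OF True x])
  have "h = (\<lambda>x\<in>V. x)" if "h \<in> U" for h
  proof (rule U.ext[OF that U.id_mem])
    fix y assume "y \<in> V"
    then show "h y = (\<lambda>x\<in>V. x) y" using U_vert[OF that] V by auto
  qed
  then have "U \<subseteq> {\<lambda>x\<in>V. x}" by blast
  then have "finite U" by (meson finite.emptyI finite_insert finite_subset)
  then have "compactin (subgroup_topology V U) U"
    using U.subset_Bij by (intro finite_imp_compactin) (simp_all add: subgroup_topology_def)
  moreover have "generate (perm_group V U) U = U"
    by (rule equalityI[OF U.generate_subset[OF subset_refl] subsetI[OF generate.incl]])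
  ultimately show ?thesis unfolding compactly_generated_def by auto
next
  case False
  have star_nonempty: "\<exists>b\<in>E. src b = x" if "x \<in> V" for x
  proof -
    have "{x \<in> V. \<exists>b\<in>E. src b = x} = V"
    proof (rule connected_closed[OF connected])
      obtain b where "b \<in> E" using False by blast
      then have "src b \<in> {x \<in> V. \<exists>b\<in>E. src b = x}" by auto
      then show "{x \<in> V. \<exists>b\<in>E. src b = x} \<noteq> {}" by blast
    next
      fix b assume "b \<in> E"
      then show "tgt b \<in> {x \<in> V. \<exists>b\<in>E. src b = x}" by (auto intro!: bexI[of _ "rv b"])
    qed auto
    then show ?thesis using that by blast
  qed
  have "\<forall>v\<in>\<Gamma>.V. \<exists>x. x \<in> V \<and> \<pi>V x = v" using \<pi>V_surj by blast
  from bchoice[OF this] obtain rep where "\<forall>v\<in>\<Gamma>.V. rep v \<in> V \<and> \<pi>V (rep v) = v" ..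
  then have rep: "rep v \<in> V \<and> \<pi>V (rep v) = v" if "v \<in> \<Gamma>.V" for v using that by simp
  have "\<forall>v\<in>\<Gamma>.V. \<exists>e. e \<in> E \<and> src e = rep v" using star_nonempty rep by blast
  from bchoice[OF this] obtain b where "\<forall>v\<in>\<Gamma>.V. b v \<in> E \<and> src (b v) = rep v" ..
  then have b: "b v \<in> E \<and> src (b v) = rep v" if "v \<in> \<Gamma>.V" for v using that by simp
  have "\<exists>K. K \<subseteq> G v \<and> compactin (perm_topology (X v)) K \<and>
      generate (perm_group (X v) (G v)) K = G v" if v: "v \<in> \<Gamma>.V" for v
    using cg[OF v] perm_subgroup.carrier_perm_group[OF local_perm[OF v]]
    by (auto simp: compactly_generated_def subgroup_topology_def compactin_subtopology)
  then have "\<forall>v\<in>\<Gamma>.V. \<exists>K. K \<subseteq> G v \<and> compactin (perm_topology (X v)) K \<and>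
      generate (perm_group (X v) (G v)) K = G v" ..
  from bchoice[OF this] obtain K where "\<forall>v\<in>\<Gamma>.V. K v \<subseteq> G v \<and>
      compactin (perm_topology (X v)) (K v) \<and> generate (perm_group (X v) (G v)) (K v) = G v" ..
  then have K: "K v \<subseteq> G v \<and> compactin (perm_topology (X v)) (K v) \<and>
      generate (perm_group (X v) (G v)) (K v) = G v" if "v \<in> \<Gamma>.V" for v using that by simp
  define lifts where "lifts v \<tau> h \<longleftrightarrow> h (rep v) = rep v \<and>
    (\<forall>c\<in>E. src c = rep v \<longrightarrow> L (arc_map T h c) = \<tau> (L c))" for v \<tau> h
  have lift: "\<exists>h\<in>U. lifts v \<tau> h" if v: "v \<in> \<Gamma>.V" and \<tau>: "\<tau> \<in> G v" for v \<tau>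
  proof -
    have "\<tau> \<in> G (\<pi>V (rep v))" using \<tau> rep[OF v] by simp
    moreover have rv: "rep v \<in> V" using rep[OF v] by simp
    ultimately obtain h where "h \<in> U" "h (rep v) = rep v"
        "\<forall>c\<in>E. src c = rep v \<longrightarrow> L (arc_map T h c) = \<tau> (L c)"
      using extension[OF rv rv refl] by blast
    then show ?thesis unfolding lifts_def by blast
  qed
  define l where "l v \<tau> = (SOME h. h \<in> U \<and> lifts v \<tau> h)" for v \<tau>
  have l: "l v \<tau> \<in> U \<and> lifts v \<tau> (l v \<tau>)" if "v \<in> \<Gamma>.V" "\<tau> \<in> G v" for v \<tau>
    using someI_ex[OF lift[OF that, unfolded Bex_def]] by (simp add: l_def)
  \<comment> \<open>One generator is kept for each place to which \<open>K v\<close> moves the label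
    of \<open>b v\<close>. Compactness leaves finitely many, and any other element of
    \<open>K v\<close> differs from one of them by a permutation fixing that label.\<close>
  define k where "k v y = (SOME \<kappa>. \<kappa> \<in> K v \<and> \<kappa> (L (b v)) = y)" for v y
  define Y where "Y v = (\<lambda>\<kappa>. \<kappa> (L (b v))) ` K v" for v
  have k: "k v y \<in> K v" "k v y (L (b v)) = y" if "y \<in> Y v" for v y
  proof -
    have "\<exists>\<kappa>. \<kappa> \<in> K v \<and> \<kappa> (L (b v)) = y" using that unfolding Y_def by blast
    from someI_ex[OF this] show "k v y \<in> K v" "k v y (L (b v)) = y" by (simp_all add: k_def)
  qed
  have Lb: "L (b v) \<in> X v" if "v \<in> \<Gamma>.V" for v using L_X[of "b v"] b[OF that] rep[OF that] by simp
  have Y: "finite (Y v)" if "v \<in> \<Gamma>.V" for v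
    unfolding Y_def using K[OF that] by (intro compactin_perm_finite(1)[OF _ Lb[OF that]]) simp
  have "\<exists>c. c \<in> E \<and> \<pi>A c = a \<and> src c = rep (\<Gamma>.src a)" if a: "a \<in> \<Gamma>.E" for a
  proof -
    obtain x where "x \<in> colours \<Delta> a" using colours_nonempty[OF a] by blast
    moreover have "rep (\<Gamma>.src a) \<in> V" "\<Gamma>.src a = \<pi>V (rep (\<Gamma>.src a))"
      using rep[OF \<Gamma>.src_vert[OF a]] by simp_all
    ultimately show ?thesis using L_ex[OF _ a] by blast
  qed
  then have "\<forall>a\<in>\<Gamma>.E. \<exists>c. c \<in> E \<and> \<pi>A c = a \<and> src c = rep (\<Gamma>.src a)" ..
  from bchoice[OF this] obtain c
    where "\<forall>a\<in>\<Gamma>.E. c a \<in> E \<and> \<pi>A (c a) = a \<and> src (c a) = rep (\<Gamma>.src a)" ..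
  then have c: "c a \<in> E \<and> \<pi>A (c a) = a \<and> src (c a) = rep (\<Gamma>.src a)" if "a \<in> \<Gamma>.E" for a
    using that by simp
  have "\<exists>g. g \<in> U \<and> g (rep (\<Gamma>.tgt a)) = tgt (c a)" if a: "a \<in> \<Gamma>.E" for a
  proof -
    have t: "rep (\<Gamma>.tgt a) \<in> V" "\<pi>V (rep (\<Gamma>.tgt a)) = \<Gamma>.tgt a"
      using rep[OF \<Gamma>.tgt_vert[OF a]] by simp_all
    have ca: "c a \<in> E" "\<pi>A (c a) = a" using c[OF a] by simp_all
    have "\<pi>V (rep (\<Gamma>.tgt a)) = \<pi>V (tgt (c a))" using t(2) tgt_\<pi>A[OF ca(1)] ca(2) by simp
    then show ?thesis using vertex_transitive[OF t(1) tgt_vert[OF ca(1)]] by blast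
  qed
  then have "\<forall>a\<in>\<Gamma>.E. \<exists>g. g \<in> U \<and> g (rep (\<Gamma>.tgt a)) = tgt (c a)" ..
  from bchoice[OF this] obtain m where "\<forall>a\<in>\<Gamma>.E. m a \<in> U \<and> m a (rep (\<Gamma>.tgt a)) = tgt (c a)" ..
  then have m: "m a \<in> U \<and> m a (rep (\<Gamma>.tgt a)) = tgt (c a)" if "a \<in> \<Gamma>.E" for a using that by simp
  define N where "N = (\<Union>v\<in>\<Gamma>.V. arc_stabilizer T U (b v)) \<union> (\<Union>v\<in>\<Gamma>.V. (\<lambda>y. l v (k v y)) ` Y v) \<union> m ` \<Gamma>.E"
  have lk: "l v (k v y) \<in> U" if "v \<in> \<Gamma>.V" "y \<in> Y v" for v y
    using l[OF that(1)] k(1)[OF that(2)] K[OF that(1)] by blast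
  have NU: "N \<subseteq> U"
    unfolding N_def arc_stabilizer_def using lk m by blast
  have "compactin (perm_topology V) N"
    unfolding N_def
  proof (intro compactin_Un)
    have fV: "finite \<Gamma>.V" and fE: "finite \<Gamma>.E" using fin by (simp_all add: finite_graph_def)
    show "compactin (perm_topology V) (\<Union>v\<in>\<Gamma>.V. arc_stabilizer T U (b v))"
      using compactin_arc_stabilizer[OF sf] b fV by (intro compactin_Union) auto
    have "finite (\<Union>v\<in>\<Gamma>.V. (\<lambda>y. l v (k v y)) ` Y v)" using fV Y by simp
    moreover have "(\<Union>v\<in>\<Gamma>.V. (\<lambda>y. l v (k v y)) ` Y v) \<subseteq> Bij V" using lk U.subset_Bij by blast
    ultimately show "compactin (perm_topology V) (\<Union>v\<in>\<Gamma>.V. (\<lambda>y. l v (k v y)) ` Y v)"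
      by (intro finite_imp_compactin) simp_all
    have "m ` \<Gamma>.E \<subseteq> Bij V" using m U.subset_Bij by blast
    then show "compactin (perm_topology V) (m ` \<Gamma>.E)" using fE by (intro finite_imp_compactin) simp_all
  qed
  then have cN: "compactin (subgroup_topology V U) N"
    using NU by (simp add: subgroup_topology_def compactin_subtopology)
  define H where "H = generate (perm_group V U) N"
  have NH: "g \<in> H" if "g \<in> N" for g unfolding H_def using that by (rule generate.incl)
  interpret H: perm_subgroup V H unfolding H_def by (rule U.subgroup_generate[OF NU])
  have HU: "g \<in> U" if "g \<in> H" for g using that U.generate_subset[OF NU] unfolding H_def by blast
  have stab_H: "g \<in> H" if v: "v \<in> \<Gamma>.V" and "g \<in> U" "arc_map T g (b v) = b v" for v g
  proof (rule NH)
    have "g \<in> arc_stabilizer T U (b v)" using that by (simp add: arc_stabilizer_def)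
    then show "g \<in> N" unfolding N_def using v by blast
  qed
  have lift_H: "\<exists>h\<in>H. lifts v \<tau> h" if v: "v \<in> \<Gamma>.V" and \<tau>: "\<tau> \<in> G v" for v \<tau>
  proof -
    interpret P: perm_subgroup "X v" "G v" using v by (rule local_perm)
    have LX: "L d \<in> X v" if "d \<in> E" "src d = rep v" for d using that L_X[of d] rep[OF v] by simp
    have gen: "\<exists>h\<in>H. lifts v \<kappa> h" if \<kappa>: "\<kappa> \<in> K v" for \<kappa>
    proof -
      let ?y = "\<kappa> (L (b v))"
      let ?s = "l v (k v ?y)"
      have y: "?y \<in> Y v" using \<kappa> by (simp add: Y_def)
      have kG: "k v ?y \<in> G v" "\<kappa> \<in> G v" using k(1)[OF y] K[OF v] \<kappa> by blast+
      have s: "?s \<in> U" "lifts v (k v ?y) ?s" using l[OF v kG(1)] by simp_all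
      have sH: "?s \<in> H" by (rule NH) (use y v in \<open>auto simp: N_def\<close>)
      \<comment> \<open>The correction fixes the label of \<open>b v\<close>, so its lift lies in
        the arc stabiliser of \<open>b v\<close>, which is among the generators.\<close>
      let ?\<rho> = "compose (X v) (P.pinv (k v ?y)) \<kappa>"
      have \<rho>: "?\<rho> \<in> G v" using kG by simp
      have "?\<rho> (L (b v)) = L (b v)"
        using k(2)[OF y] kG Lb[OF v] by (simp add: compose_eq P.pinv_eq_iff)
      obtain r where r: "r \<in> U" "lifts v ?\<rho> r" using lift[OF v \<rho>] by blast
      have "arc_map T r (b v) = b v"
        using r b[OF v] \<open>?\<rho> (L (b v)) = L (b v)\<close> by (intro L_inj) (simp_all add: lifts_def)
      then have rH: "r \<in> H" using stab_H[OF v r(1)] by simp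
      have "L (arc_map T (compose V ?s r) d) = \<kappa> (L d)" if d: "d \<in> E" "src d = rep v" for d
      proof -
        have "L (arc_map T (compose V ?s r) d) = k v ?y (?\<rho> (L d))"
          using s r d by (simp add: lifts_def)
        also have "\<dots> = \<kappa> (L d)" using kG LX[OF d] by (simp add: compose_eq)
        finally show ?thesis .
      qed
      moreover have "compose V ?s r (rep v) = rep v"
        using s(2) r(2) rep[OF v] by (simp add: lifts_def compose_eq)
      ultimately have "lifts v \<kappa> (compose V ?s r)" by (simp add: lifts_def)
      then show ?thesis using H.compose_mem[OF sH rH] by blast
    qed
    have gen_inv: "\<exists>h\<in>H. lifts v (P.pinv \<kappa>) h" if \<kappa>: "\<kappa> \<in> K v" for \<kappa>
    proof -
      obtain h where h: "h \<in> H" "lifts v \<kappa> h" using gen[OF \<kappa>] by blast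
      have hU: "h \<in> U" by (rule HU[OF h(1)])
      have \<kappa>G: "\<kappa> \<in> G v" using \<kappa> K[OF v] by blast
      have fix_rep: "U.pinv h (rep v) = rep v"
        using h(2) hU rep[OF v] by (simp add: lifts_def U.pinv_eq_iff)
      have "L (arc_map T (U.pinv h) d) = P.pinv \<kappa> (L d)" if d: "d \<in> E" "src d = rep v" for d
      proof -
        let ?e = "arc_map T (U.pinv h) d"
        have e: "?e \<in> E" "src ?e = rep v" using d hU fix_rep by simp_all
        have "arc_map T h ?e = d" using hU d(1) by simp
        then have "L d = \<kappa> (L ?e)" using h(2) e unfolding lifts_def by metis
        then show ?thesis using \<kappa>G LX[OF e] by simp
      qed
      then have "lifts v (P.pinv \<kappa>) (U.pinv h)" using fix_rep by (simp add: lifts_def)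
      then show ?thesis using H.pinv_mem[OF h(1)] by blast
    qed
    have "\<tau> \<in> generate (perm_group (X v) (G v)) (K v)" "K v \<subseteq> G v" using \<tau> K[OF v] by simp_all
    then show ?thesis
    proof (induction rule: P.generate_perm_induct)
      case one
      have "lifts v (\<lambda>x\<in>X v. x) (\<lambda>x\<in>V. x)" using rep[OF v] LX by (auto simp: lifts_def)
      then show ?case using H.id_mem by blast
    next
      case (incl k)
      then show ?case by (rule gen)
    next
      case (inv k)
      then show ?case by (rule gen_inv)
    next
      case (mult \<sigma> \<rho>)
      obtain g h where gh: "g \<in> H" "lifts v \<sigma> g" "h \<in> H" "lifts v \<rho> h" using mult by blast
      have "L (arc_map T (compose V g h) d) = compose (X v) \<sigma> \<rho> (L d)" if "d \<in> E" "src d = rep v" for d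
        using that gh HU LX[OF that] by (simp add: lifts_def compose_eq)
      moreover have "compose V g h (rep v) = rep v"
        using gh rep[OF v] by (simp add: lifts_def compose_eq)
      ultimately have "lifts v (compose (X v) \<sigma> \<rho>) (compose V g h)" by (simp add: lifts_def)
      then show ?case using H.compose_mem[OF gh(1,3)] by blast
    qed
  qed
  \<comment> \<open>A lift in \<open>H\<close> with the same local action at \<open>rep v\<close>
    moves \<open>b v\<close> to the same arc as \<open>u\<close>; the two differ by an element
    fixing \<open>b v\<close>.\<close>
  have vertex_H: "u \<in> H" if v: "v \<in> \<Gamma>.V" and u: "u \<in> U" "u (rep v) = rep v" for v u
  proof -
    have "loc u (rep v) \<in> G v" using loc_mem[OF u(1), of "rep v"] rep[OF v] by simp
    then obtain h where h: "h \<in> H" "lifts v (loc u (rep v)) h" using lift_H[OF v] by blast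
    have hU: "h \<in> U" by (rule HU[OF h(1)])
    have bv: "b v \<in> E" "src (b v) = rep v" using b[OF v] by simp_all
    have "arc_map T h (b v) = arc_map T u (b v)"
    proof (rule L_inj)
      show "src (arc_map T h (b v)) = src (arc_map T u (b v))"
        using h(2) hU u bv by (simp add: lifts_def)
      show "L (arc_map T h (b v)) = L (arc_map T u (b v))"
        using h(2) bv loc_L[OF bv(1), of u] by (simp add: lifts_def)
    qed (use hU u bv in simp_all)
    then have "arc_map T (compose V (U.pinv h) u) (b v) = b v"
      using hU u(1) bv(1) arc_map_pinv(1)[OF hU bv(1)] by simp
    then have "compose V (U.pinv h) u \<in> H" using stab_H[OF v] hU u(1) by simp
    then have "compose V h (compose V (U.pinv h) u) \<in> H" by (rule H.compose_mem[OF h(1)])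
    moreover have "compose V h (compose V (U.pinv h) u) = u"
      using hU u(1) by (intro U.ext) (simp_all add: compose_eq)
    ultimately show ?thesis by simp
  qed
  have cover: "\<exists>h\<in>H. \<exists>v\<in>\<Gamma>.V. x = h (rep v)" if "x \<in> V" for x
  proof -
    let ?W = "{x \<in> V. \<exists>h\<in>H. \<exists>v\<in>\<Gamma>.V. x = h (rep v)}"
    have "?W = V"
    proof (rule connected_closed[OF connected])
      obtain v where v: "v \<in> \<Gamma>.V" using nonempty \<pi>V_vert by blast
      have "rep v = (\<lambda>x\<in>V. x) (rep v)" "rep v \<in> V" using rep[OF v] by simp_all
      then have "rep v \<in> ?W" using H.id_mem v by blast
      then show "?W \<noteq> {}" by blast
    next
      fix e assume e: "e \<in> E" "src e \<in> ?W"
      then obtain h v where h: "h \<in> H" "v \<in> \<Gamma>.V" "src e = h (rep v)" by blast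
      have hU: "h \<in> U" by (rule HU[OF h(1)])
      let ?d = "arc_map T (U.pinv h) e"
      have d: "?d \<in> E" "src ?d = rep v" using hU e(1) h(3) rep[OF h(2)] by simp_all
      define a where "a = \<pi>A ?d"
      have a: "a \<in> \<Gamma>.E" "\<Gamma>.src a = v" using d rep[OF h(2)] unfolding a_def by (simp_all add: src_\<pi>A[OF d(1)] del: U_\<pi>A)
      have ca: "c a \<in> E" "\<pi>A (c a) = \<pi>A ?d" "src (c a) = rep v"
        using c[OF a(1)] a(2) by (simp_all add: a_def)
      \<comment> \<open>After translating by \<open>h\<close>, the arc starts at
        \<open>rep v\<close> and lies over \<open>a\<close>, as does the chosen arc
        \<open>c a\<close>. The element relating them fixes \<open>rep v\<close> and is already in
        \<open>H\<close>, and \<open>m a\<close> then reaches the far end of \<open>c a\<close> from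
        a representative.\<close>
      obtain u where u: "u \<in> U" "arc_map T u (c a) = ?d" by (rule arc_transitive[OF ca(1) d(1) ca(2)])
      have "u (rep v) = rep v" using U_src[OF u(1) ca(1)] u(2) ca(3) d(2) by simp
      then have uH: "u \<in> H" by (rule vertex_H[OF h(2) u(1)])
      have mH: "m a \<in> H" by (rule NH) (use a(1) in \<open>simp add: N_def\<close>)
      have t: "\<Gamma>.tgt a \<in> \<Gamma>.V" using a(1) by simp
      have "tgt e = h (tgt ?d)" using hU e(1) by simp
      also have "tgt ?d = u (tgt (c a))" using U_tgt[OF u(1) ca(1)] u(2) by simp
      also have "tgt (c a) = m a (rep (\<Gamma>.tgt a))" using m[OF a(1)] by simp
      finally have "tgt e = compose V h (compose V u (m a)) (rep (\<Gamma>.tgt a))"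
        using rep[OF t] by (simp add: compose_eq)
      moreover have "compose V h (compose V u (m a)) \<in> H" using h(1) uH mH by simp
      ultimately show "tgt e \<in> ?W" using t tgt_vert[OF e(1)] by blast
    qed auto
    then show ?thesis using that by blast
  qed
  have "g \<in> H" if g: "g \<in> U" for g
  proof -
    obtain v where v: "v \<in> \<Gamma>.V" using nonempty \<pi>V_vert by blast
    have "g (rep v) \<in> V" using U_vert[OF g] rep[OF v] by simp
    then obtain h v' where h: "h \<in> H" "v' \<in> \<Gamma>.V" "g (rep v) = h (rep v')" using cover by blast
    have hU: "h \<in> U" by (rule HU[OF h(1)])
    have "v' = v" using U_\<pi>V[OF g, of "rep v"] U_\<pi>V[OF hU, of "rep v'"] rep[OF v] rep[OF h(2)] h(3) by simp
    then have "compose V (U.pinv h) g (rep v) = rep v"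
      using h(3) hU rep[OF v] by (simp add: compose_eq)
    then have "compose V (U.pinv h) g \<in> H" using vertex_H[OF v] hU g by simp
    then have "compose V h (compose V (U.pinv h) g) \<in> H" by (rule H.compose_mem[OF h(1)])
    moreover have "compose V h (compose V (U.pinv h) g) = g"
      using hU g by (intro U.ext) (simp_all add: compose_eq)
    ultimately show ?thesis by simp
  qed
  then have "H = U" using HU by blast
  then show ?thesis unfolding compactly_generated_def H_def
    using NU cN by (intro exI[of _ N]) simp
qed

end

section \<open>The equivalence and its topological consequences\<close>

theorem theorem1p9:
  fixes \<Delta> :: "('v, 'a, 'x) local_action_diagram"
    and T :: "('w, 'b) graph"
    and \<pi>V :: "'w \<Rightarrow> 'v" and \<pi>A :: "'b \<Rightarrow> 'a" and L :: "'b \<Rightarrow> 'x"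
  defines "U \<equiv> universal_group \<Delta> T \<pi>V \<pi>A L"
  defines "cond_i \<equiv>
      compactly_generated (perm_group (verts T) U) (subgroup_topology (verts T) U) \<and>
      locally_compact_space (subgroup_topology (verts T) U) \<and>
      geometrically_dense T U"
  defines "cond_ii \<equiv>
      irreducible_diagram \<Delta> \<and>
      finite_graph (lgraph \<Delta>) \<and>
      (\<forall>v\<in>verts (lgraph \<Delta>).
         compactly_generated (perm_group (vcolours \<Delta> v) (lgroup \<Delta> v))
           (subgroup_topology (vcolours \<Delta> v) (lgroup \<Delta> v)) \<and>
         subdegree_finite (vcolours \<Delta> v) (lgroup \<Delta> v))"
  assumes "is_local_action_diagram \<Delta>"
    and "delta_tree \<Delta> T \<pi>V \<pi>A L"
  shows "(cond_i \<longleftrightarrow> cond_ii) \<and>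
    (cond_i \<and> cond_ii \<longrightarrow>
       polish_space_on (subgroup_topology (verts T) U) \<and>
       countable_graph T \<and>
       (\<forall>a\<in>arcs T. compactin (subgroup_topology (verts T) U) (arc_stabilizer T U a)))"
proof -
  interpret S: delta_tree_setup \<Delta> T \<pi>V \<pi>A L
    using assms(4,5) by unfold_locales
  have "cond_ii" if i: "cond_i"
  proof -
    have cg: "compactly_generated (perm_group (verts T) U) (subgroup_topology (verts T) U)"
      and lc: "locally_compact_space (subgroup_topology (verts T) U)"
      and dense: "geometrically_dense T U" using i by (simp_all add: cond_i_def)
    have irr: "irreducible_diagram \<Delta>"
      using dense unfolding U_def by (rule S.dense_imp_irreducible)
    have fin: "finite_graph (lgraph \<Delta>)"
      using cg dense unfolding U_def by (rule S.compactly_generated_imp_finite_graph)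
    have sf: "subdegree_finite (vcolours \<Delta> v) (lgroup \<Delta> v)" if "v \<in> verts (lgraph \<Delta>)" for v
      by (rule S.finite_orbits_imp_subdegree_finite[OF S.locally_compact_imp_finite_orbits[OF irr lc[unfolded U_def]] that])
    show ?thesis unfolding cond_ii_def
      using irr fin sf S.local_compactly_generated[OF cg[unfolded U_def] fin sf] by blast
  qed
  \<comment> \<open>The further conclusions rest on the same finiteness properties of the local
    groups as condition (i), and are derived alongside it.\<close>
  moreover have "cond_i \<and> polish_space_on (subgroup_topology (verts T) U) \<and> countable_graph T \<and>
      (\<forall>a\<in>arcs T. compactin (subgroup_topology (verts T) U) (arc_stabilizer T U a))" if ii: "cond_ii"
  proof -
    have irr: "irreducible_diagram \<Delta>" and fin: "finite_graph (lgraph \<Delta>)"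
      using ii by (simp_all add: cond_ii_def)
    have cg: "compactly_generated (perm_group (vcolours \<Delta> v) (lgroup \<Delta> v))
        (subgroup_topology (vcolours \<Delta> v) (lgroup \<Delta> v))"
      and sf: "subdegree_finite (vcolours \<Delta> v) (lgroup \<Delta> v)" if "v \<in> verts (lgraph \<Delta>)" for v
      using ii that by (simp_all add: cond_ii_def)
    have "cond_i" unfolding cond_i_def U_def
      using S.compactly_generated_U[OF fin cg sf] S.locally_compact_U[OF sf]
        S.irreducible_imp_dense[OF irr] by blast
    moreover have ct: "countable_graph T" by (rule S.countable_tree[OF fin cg])
    then have "countable (verts T)" by (simp add: countable_graph_def)
    then have "polish_space_on (subgroup_topology (verts T) U)"
      unfolding polish_space_on_def subgroup_topology_def U_def
      using completely_metrizable_space_closedin[OF completely_metrizable_perm_topology S.closedin_U]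
        separable_perm_subtopology[OF _ S.U.subset_Bij] by blast
    moreover have "compactin (subgroup_topology (verts T) U) (arc_stabilizer T U a)" if "a \<in> arcs T" for a
      using S.compactin_arc_stabilizer[OF sf that] unfolding subgroup_topology_def U_def
      by (simp add: compactin_subtopology arc_stabilizer_def)
    ultimately show ?thesis using ct by blast
  qed
  ultimately show ?thesis by blast
qed

end
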